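(* Let $d\ge 3$, let $u>0$ be any level (intensity parameter) of random interlacements on $\mathbb{Z}^d$, and let $\beta>1$ be any fixed bias. Let $(X_n)_{n\ge 0}$, $X_0=0$, be the $\beta$-biased random walk on the interlacement set $\mathcal{I}^u$, and let $\mathbb{P}$ be its averaged (annealed) law under the environment conditioned on $0\in\mathcal{I}^u$. Then $$\lim_{n\to\infty}\|X_n\|=\infty\qquad \mathbb{P}\text{-a.s.}$$
   Context: Random interlacements. For $x\in\mathbb{Z}^d$, $d\ge 3$, let $P^{\mathrm{SRW}}_x$ be the law of simple random walk $(S_k)_{k\ge 0}$ on $\mathbb{Z}^d$ started at $x$. For finite $A\subset\mathbb{Z}^d$ let $T_A=\min\{k\ge 1:S_k\in A\}$ ($\min\emptyset=+\infty$), $e_A(x)=P^{\mathrm{SRW}}_x[T_A=\infty]\mathbf{1}_A(x)$, and $\mathrm{cap}(A)=\sum_{x\in A}e_A(x)$. The interlacement set $\mathcal{I}^u\subset\mathbb{Z}^d$ at level $u>0$ is the random set whose complement $\mathcal{V}^u=\mathbb{Z}^d\setminus\mathcal{I}^u$ (the vacant set) has the law characterized by $\mathbf{P}[A\subset\mathcal{V}^u]=\exp(-u\,\mathrm{cap}(A))$ for all finite $A\subset\mathbb{Z}^d$. Equivalently, for finite $A$, $\mathcal{I}^u\cap A$ has the law of the set of sites of $A$ visited by a Poisson($u\,\mathrm{cap}(A)$) number of independent simple random walks with independent starting points of law $e_A/\mathrm{cap}(A)$. The set $\mathcal{I}^u$ is a.s. connected. Write $\mathbf{P}_0[\cdot]=\mathbf{P}[\cdot\mid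 0\in\mathcal{I}^u]$. Biased walk. Let $\|\cdot\|$ be the Euclidean norm, $x\cdot y$ the usual scalar product, $e_1,\dots,e_d$ the canonical basis, and $x\sim y$ if $\|x-y\|=1$. Set $c(x,y)=\beta^{\max(x\cdot e_1,\,y\cdot e_1)}$ if $x,y\in\mathcal{I}^u$ and $x\sim y$, and $c(x,y)=0$ otherwise; $\omega=\{c(x,y)\}$ is the environment. Given $\omega$, the walk $(X_n)_{n\ge0}$ is the Markov chain on $\mathcal{I}^u$ with transition probabilities $c(x,y)/\sum_z c(x,z)$; its law started at $x$ is $\mathrm{P}^\omega_x$. The averaged measure is $\mathbb{P}[\cdot]=\int \mathrm{P}^\omega_0[\cdot]\,d\mathbf{P}_0$. *)

theory Defs
  imports "HOL-Probability.Probability"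
begin

section \<open>The lattice\<close>

text \<open>The lattice $\mathbb{Z}^d$ is the type \<^typ>\<open>int ^ 'd\<close> with $d$ = \<open>CARD('d)\<close>.\<close>

definition lnorm :: "int ^ 'd \<Rightarrow> real" where
  "lnorm x = norm ((\<chi> i. real_of_int (x $ i)) :: real ^ 'd)"

definition adj :: "int ^ 'd \<Rightarrow> int ^ 'd \<Rightarrow> bool" where
  "adj x y \<longleftrightarrow> lnorm (x - y) = 1"

lemma finite_adj: "finite {y. adj x y}"
proof -
  have le1: "\<bar>(x - y) $ i\<bar> \<le> 1" if "adj x y" for y i
  proof -
    have "\<bar>real_of_int ((x - y) $ i)\<bar> \<le> lnorm (x - y)"
      unfolding lnorm_def
      using component_le_norm_cart[of "(\<chi> i. real_of_int ((x - y) $ i)) :: real ^ 'a" i] by simp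
    then show ?thesis using that by (simp add: adj_def)
  qed
  then have "{y. adj x y} \<subseteq> {y. \<forall>i. y $ i \<in> {x $ i - 1 .. x $ i + 1}}"
  proof (intro subsetI CollectI allI)
    fix y i assume "y \<in> {y. adj x y}"
    with le1[of y i] show "y $ i \<in> {x $ i - 1 .. x $ i + 1}"
      by (auto simp: abs_le_iff)
  qed
  also have "\<dots> = (\<lambda>f. \<chi> i. f i) ` (PiE UNIV (\<lambda>i. {x $ i - 1 .. x $ i + 1}))"
  proof (intro subset_antisym subsetI)
    fix y assume "y \<in> {y. \<forall>i. y $ i \<in> {x $ i - 1 .. x $ i + 1}}"
    then show "y \<in> (\<lambda>f. \<chi> i. f i) ` (PiE UNIV (\<lambda>i. {x $ i - 1 .. x $ i + 1}))"
      by (intro image_eqI[of _ _ "vec_nth y"]) (auto simp: PiE_UNIV_domain)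
  qed (auto simp: PiE_UNIV_domain Pi_iff)
  finally show ?thesis
    by (rule finite_subset) (auto intro!: finite_imageI finite_PiE)
qed

lemma adj_nonempty: "{y. adj x y} \<noteq> {}"
proof -
  fix i :: 'a
  have "(\<chi> j. real_of_int ((x - (x - axis i 1)) $ j)) = (axis i 1 :: real ^ 'a)"
    by (simp add: vec_eq_iff axis_def)
  then have "adj x (x - axis i 1)" by (simp add: adj_def lnorm_def)
  then show ?thesis by auto
qed


section \<open>Markov chains on a discrete state space\<close>

text \<open>The law on path space of the Markov chain started at \<open>x\<close> with transition kernel \<open>K\<close> is
  the measure given by the Ionescu-Tulcea theorem; its finite-dimensional distributions are
  computed in \<open>emeasure_markov_law\<close> below.\<close>

abbreviation paths :: "(nat \<Rightarrow> 'a) measure" where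
  "paths \<equiv> PiM UNIV (\<lambda>_. count_space UNIV)"

primrec markov_step :: "('a \<Rightarrow> 'a pmf) \<Rightarrow> 'a \<Rightarrow> nat \<Rightarrow> (nat \<Rightarrow> 'a) \<Rightarrow> 'a measure" where
  "markov_step K x 0 h = measure_pmf (return_pmf x)"
| "markov_step K x (Suc n) h = measure_pmf (K (h n))"

definition markov_law :: "('a \<Rightarrow> 'a pmf) \<Rightarrow> 'a \<Rightarrow> (nat \<Rightarrow> 'a) measure" where
  "markov_law K x = projective_family.lim UNIV
     (Ionescu_Tulcea.CI (markov_step K x) (\<lambda>_. count_space UNIV)) (\<lambda>_. count_space UNIV)"

lemma Ionescu_Tulcea_markov: "Ionescu_Tulcea (markov_step K x) (\<lambda>_. count_space UNIV)"
proof (rule Ionescu_Tulcea.intro)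
  show "markov_step K x i \<in> PiM {0..<i} (\<lambda>_. count_space UNIV) \<rightarrow>\<^sub>M subprob_algebra (count_space UNIV)" for i
  proof (cases i)
    case 0
    have "measure_pmf (return_pmf x) \<in> space (subprob_algebra (count_space UNIV))"
      by (simp add: space_subprob_algebra measure_pmf.subprob_space_axioms)
    then have "(\<lambda>_. measure_pmf (return_pmf x)) \<in>
        PiM {0..<i} (\<lambda>_. count_space UNIV) \<rightarrow>\<^sub>M subprob_algebra (count_space UNIV)"
      by (rule measurable_const)
    moreover have "markov_step K x i = (\<lambda>_. measure_pmf (return_pmf x))"
      using 0 by (simp add: fun_eq_iff)
    ultimately show ?thesis by simp
  next
    case (Suc n)
    have "(\<lambda>h. h n) \<in> PiM {0..<Suc n} (\<lambda>_. count_space UNIV) \<rightarrow>\<^sub>M count_space UNIV"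
      by (rule measurable_component_singleton) simp
    moreover have "(\<lambda>y. measure_pmf (K y)) \<in> count_space UNIV \<rightarrow>\<^sub>M subprob_algebra (count_space UNIV)"
      by (auto simp: space_subprob_algebra measure_pmf.subprob_space_axioms)
    ultimately have "(\<lambda>h. measure_pmf (K (h n))) \<in>
        PiM {0..<Suc n} (\<lambda>_. count_space UNIV) \<rightarrow>\<^sub>M subprob_algebra (count_space UNIV)"
      by (rule measurable_compose)
    moreover have "markov_step K x i = (\<lambda>h. measure_pmf (K (h n)))"
      using Suc by (simp add: fun_eq_iff)
    ultimately show ?thesis using Suc by simp
  qed
  show "prob_space (markov_step K x i h)" for i h
    by (cases i) (auto simp: measure_pmf.prob_space_axioms simp del: return_pmf.rep_eq)
qed

lemma sets_markov_law [measurable_cong]: "sets (markov_law K x) = sets paths"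
proof -
  interpret IT: Ionescu_Tulcea "markov_step K x" "\<lambda>_. count_space UNIV"
    by (rule Ionescu_Tulcea_markov)
  show ?thesis by (simp add: markov_law_def IT.PF.sets_lim)
qed

lemma prob_space_markov_law: "prob_space (markov_law K x)"
proof -
  interpret IT: Ionescu_Tulcea "markov_step K x" "\<lambda>_. count_space UNIV"
    by (rule Ionescu_Tulcea_markov)
  have "prob_space (distr IT.PF.lim (PiM {} (\<lambda>_. count_space UNIV)) (\<lambda>x. restrict x {}))"
    using IT.PF.prob_space_P[of "{}"] by (simp add: IT.distr_lim)
  then show ?thesis
    unfolding markov_law_def by (rule prob_space_distrD[rotated]) (auto simp: measurable_cong_sets[OF IT.PF.sets_lim refl] intro!: measurable_restrict)
qed

lemma emeasure_markov_law:
  "emeasure (markov_law K x) {X. \<forall>i\<le>n. X i = xs i} =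
     ennreal (if xs 0 = x then \<Prod>i<n. pmf (K (xs i)) (xs (Suc i)) else 0)"
proof -
  interpret IT: Ionescu_Tulcea "markov_step K x" "\<lambda>_. count_space UNIV"
    by (rule Ionescu_Tulcea_markov)
  let ?M = "\<lambda>n. PiM {0..<n} (\<lambda>_::nat. count_space (UNIV :: 'a set))"
  let ?r = "\<lambda>n. restrict xs {0..<n}"
  have r_sets: "{?r n} \<in> sets (?M n)" for n
  proof -
    have "{?r n} = PiE {0..<n} (\<lambda>i. {xs i})" by (auto simp: PiE_eq_singleton set_eq_iff PiE_iff fun_eq_iff extensional_def)
    then show ?thesis by (auto intro!: sets_PiM_I_finite)
  qed
  have step: "emeasure (IT.C 0 (Suc n) (\<lambda>_. undefined)) {?r (Suc n)} =
      emeasure (IT.C 0 n (\<lambda>_. undefined)) {?r n} * emeasure (markov_step K x n (?r n)) {xs n}" for n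
  proof -
    have u: "(\<lambda>_. undefined) \<in> space (?M 0)" by (simp add: space_PiM)
    have sp: "space (IT.C 0 n (\<lambda>_. undefined)) = space (?M n)" using IT.space_C[OF u, of n] by simp
    have st: "sets (IT.C 0 n (\<lambda>_. undefined)) = sets (?M n)" using IT.sets_C[OF u, of n] by simp
    have "emeasure (IT.C 0 (Suc n) (\<lambda>_. undefined)) {?r (Suc n)} =
      (\<integral>\<^sup>+h. emeasure (IT.eP n h) {?r (Suc n)} \<partial>IT.C 0 n (\<lambda>_. undefined))"
      using r_sets[of "Suc n"]
      by (simp, subst emeasure_bind[where N="?M (Suc n)"])
         (auto simp: sp measurable_cong_sets[OF st refl] space_PiM PiE_eq_empty_iff)
    also have "\<dots> = (\<integral>\<^sup>+h. emeasure (markov_step K x n (?r n)) {xs n} * indicator {?r n} h \<partial>IT.C 0 n (\<lambda>_. undefined))"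
    proof (rule nn_integral_cong)
      fix h assume "h \<in> space (IT.C 0 n (\<lambda>_. undefined))"
      then have h: "h \<in> space (?M n)" by (simp add: sp)
      then have he: "h \<in> extensional {0..<n}" by (simp add: space_PiM PiE_def)
      have "(\<lambda>y. h(n := y)) -` {?r (Suc n)} \<inter> space (count_space UNIV) = (if h = ?r n then {xs n} else {})"
      proof -
        have "h(n := y) = ?r (Suc n) \<longleftrightarrow> h = ?r n \<and> y = xs n" for y
        proof
          assume a: "h(n := y) = ?r (Suc n)"
          have "h i = ?r n i" for i
            using fun_cong[OF a, of i] he by (cases "i < n") (auto simp: extensional_def split: if_splits)
          moreover have "y = xs n" using fun_cong[OF a, of n] by simp
          ultimately show "h = ?r n \<and> y = xs n" by blast
        qed (auto simp: fun_eq_iff)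
        then show ?thesis by auto
      qed
      then show "emeasure (IT.eP n h) {?r (Suc n)} =
          emeasure (markov_step K x n (?r n)) {xs n} * indicator {?r n} h"
        using IT.emeasure_eP[OF h r_sets] by (auto split: split_indicator)
    qed
    also have "\<dots> = emeasure (IT.C 0 n (\<lambda>_. undefined)) {?r n} * emeasure (markov_step K x n (?r n)) {xs n}"
      using r_sets[of n] by (subst nn_integral_cmult_indicator) (auto simp: st mult.commute)
    finally show ?thesis .
  qed
  have C: "emeasure (IT.C 0 (Suc n) (\<lambda>_. undefined)) {?r (Suc n)} =
     ennreal (if xs 0 = x then \<Prod>i<n. pmf (K (xs i)) (xs (Suc i)) else 0)" for n
  proof (induction n)
    case 0
    have e: "emeasure (IT.C 0 0 (\<lambda>_. undefined)) {?r 0} = 1"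
      using r_sets[of 0] by (simp add: restrict_def)
    show ?case by (subst step, subst e) (auto simp: emeasure_pmf_single simp del: return_pmf.rep_eq)
  next
    case (Suc n)
    have e: "emeasure (markov_step K x (Suc n) (?r (Suc n))) {xs (Suc n)} = ennreal (pmf (K (xs n)) (xs (Suc n)))"
      by (simp add: emeasure_pmf_single)
    show ?case
      by (subst step, subst Suc.IH, subst e) (auto simp: ennreal_mult' mult.commute)
  qed
  have "{X. \<forall>i\<le>n. X i = xs i} = IT.PF.emb UNIV {0..<Suc n} {?r (Suc n)}"
  proof -
    have "restrict X {0..<Suc n} = ?r (Suc n) \<longleftrightarrow> (\<forall>i\<le>n. X i = xs i)" for X
      by (metis atLeastLessThan_iff le0 less_Suc_eq_le restrict_apply' restrict_ext)
    then show ?thesis by (auto simp: prod_emb_def)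
  qed
  moreover have "emeasure IT.PF.lim (IT.PF.emb UNIV {0..<Suc n} {?r (Suc n)}) =
      emeasure (IT.C 0 (Suc n) (\<lambda>_. undefined)) {?r (Suc n)}"
    using r_sets[of "Suc n"] 
    by (subst IT.lim) (auto simp: IT.emeasure_CI[where n="Suc n"] prod_emb_id)
  ultimately show ?thesis using C by (simp add: markov_law_def)
qed


section \<open>Random interlacements\<close>

definition srw_law :: "int ^ 'd \<Rightarrow> (nat \<Rightarrow> int ^ 'd) measure" where
  "srw_law x = markov_law (\<lambda>y. pmf_of_set {z. adj y z}) x"

definition hitting_time :: "'a set \<Rightarrow> (nat \<Rightarrow> 'a) \<Rightarrow> enat" where
  "hitting_time A S = Inf {enat k | k. k \<ge> 1 \<and> S k \<in> A}"

lemma hitting_time_eq_infinity_iff: "hitting_time A S = \<infinity> \<longleftrightarrow> (\<forall>k\<ge>1. S k \<notin> A)"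
  unfolding hitting_time_def top_enat_def[symmetric] Inf_top_conv
  by (auto simp: top_enat_def)

lemma sets_hitting_time_infinity: "{S. hitting_time A S = \<infinity>} \<in> sets (srw_law x)"
proof -
  have "{S \<in> space paths. \<forall>k\<ge>1. S k \<notin> A} \<in> sets paths" by measurable
  then show ?thesis
    by (simp add: hitting_time_eq_infinity_iff srw_law_def sets_markov_law space_PiM)
qed

definition equilibrium :: "(int ^ 'd) set \<Rightarrow> int ^ 'd \<Rightarrow> real" where
  "equilibrium A x = measure (srw_law x) {S. hitting_time A S = \<infinity>} * indicator A x"

definition capacity :: "(int ^ 'd) set \<Rightarrow> real" where
  "capacity A = (\<Sum>x\<in>A. equilibrium A x)"

definition interlacement_set ::
  "'w measure \<Rightarrow> ('w \<Rightarrow> (int ^ 'd) set) \<Rightarrow> real \<Rightarrow> bool" where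
  "interlacement_set M I u \<longleftrightarrow>
     prob_space M \<and>
     (\<forall>x. {w \<in> space M. x \<in> I w} \<in> sets M) \<and>
     (\<forall>A. finite A \<longrightarrow> measure M {w \<in> space M. A \<subseteq> - I w} = exp (- u * capacity A))"


section \<open>The biased walk\<close>

text \<open>The index \<open>k\<close> is the one of the basis vector $e_1$, so $x \cdot e_1$ is \<open>x $ k\<close>.\<close>

definition conductance :: "real \<Rightarrow> 'd \<Rightarrow> (int ^ 'd) set \<Rightarrow> int ^ 'd \<Rightarrow> int ^ 'd \<Rightarrow> real" where
  "conductance \<beta> k J x y =
     (if x \<in> J \<and> y \<in> J \<and> adj x y then \<beta> powi max (x $ k) (y $ k) else 0)"

text \<open>The total conductance is a sum over all \<open>z \<sim> x\<close>, as \<open>conductance \<beta> k J x z = 0\<close> for all other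
  \<open>z\<close>. It vanishes only outside of \<open>J\<close> and at isolated points of \<open>J\<close>, where the quotients are
  meaningless; there the chain stays put by convention.\<close>

definition total_conductance :: "real \<Rightarrow> 'd \<Rightarrow> (int ^ 'd) set \<Rightarrow> int ^ 'd \<Rightarrow> real" where
  "total_conductance \<beta> k J x = (\<Sum>z | adj x z. conductance \<beta> k J x z)"

definition walk_kernel :: "real \<Rightarrow> 'd \<Rightarrow> (int ^ 'd) set \<Rightarrow> int ^ 'd \<Rightarrow> (int ^ 'd) pmf" where
  "walk_kernel \<beta> k J x =
     (if total_conductance \<beta> k J x = 0 then return_pmf x
      else embed_pmf (\<lambda>y. conductance \<beta> k J x y / total_conductance \<beta> k J x))"

lemma pmf_walk_kernel:
  assumes "\<beta> > 0"
  shows "pmf (walk_kernel \<beta> k J x) y =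
    (if total_conductance \<beta> k J x = 0 then indicator {x} y
     else conductance \<beta> k J x y / total_conductance \<beta> k J x)"
proof (cases "total_conductance \<beta> k J x = 0")
  case True
  then show ?thesis by (simp add: walk_kernel_def indicator_def)
next
  case False
  let ?p = "\<lambda>y. conductance \<beta> k J x y / total_conductance \<beta> k J x"
  have c: "0 \<le> conductance \<beta> k J x y" for y
    using assms by (simp add: conductance_def)
  then have t: "0 \<le> total_conductance \<beta> k J x"
    unfolding total_conductance_def by (intro sum_nonneg)
  have p: "0 \<le> ?p y" for y using c t by simp
  have "(\<integral>\<^sup>+y. ennreal (?p y) \<partial>count_space UNIV) = (\<Sum>y | adj x y. ennreal (?p y))"
    by (rule nn_integral_count_space'[OF finite_adj]) (auto simp: conductance_def)
  also have "\<dots> = ennreal (\<Sum>y | adj x y. ?p y)"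
    using p by (simp add: sum_ennreal)
  also have "(\<Sum>y | adj x y. ?p y) = 1"
    using False by (simp add: sum_divide_distrib[symmetric] total_conductance_def)
  finally have "(\<integral>\<^sup>+y. ennreal (?p y) \<partial>count_space UNIV) = 1" by simp
  with p have "pmf (embed_pmf ?p) y = ?p y" by (intro pmf_embed_pmf)
  with False show ?thesis by (simp add: walk_kernel_def)
qed

definition quenched_law ::
  "real \<Rightarrow> 'd \<Rightarrow> (int ^ 'd) set \<Rightarrow> int ^ 'd \<Rightarrow> (nat \<Rightarrow> int ^ 'd) measure" where
  "quenched_law \<beta> k J x = markov_law (walk_kernel \<beta> k J) x"

definition conditioned :: "'w measure \<Rightarrow> ('w \<Rightarrow> (int ^ 'd) set) \<Rightarrow> 'w measure" where
  "conditioned M I = uniform_measure M {w \<in> space M. 0 \<in> I w}"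

definition averaged_law ::
  "'w measure \<Rightarrow> ('w \<Rightarrow> (int ^ 'd) set) \<Rightarrow> real \<Rightarrow> 'd \<Rightarrow> (nat \<Rightarrow> int ^ 'd) measure" where
  "averaged_law M I \<beta> k = conditioned M I \<bind> (\<lambda>w. quenched_law \<beta> k (I w) 0)"

text \<open>The quenched law depends measurably on the environment, so that the above is indeed
  $\int P^\omega_0[\cdot]\,d\mathbf{P}_0$.\<close>

lemma sets_paths_generated:
  "sets (paths :: (nat \<Rightarrow> 'a :: countable) measure) =
     sigma_sets UNIV (insert {} (range (\<lambda>(n, xs). {X. \<forall>i\<le>n. X i = xs i})))"
  (is "_ = sigma_sets _ ?G")
proof
  have "{X. \<forall>i\<le>n. X i = xs i} \<in> sets (paths :: (nat \<Rightarrow> 'a) measure)" for n :: nat and xs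
  proof -
    have "{X \<in> space (paths :: (nat \<Rightarrow> 'a) measure). \<forall>i\<le>n. X i = xs i} \<in> sets paths" by measurable
    then show ?thesis by (simp add: space_PiM)
  qed
  then have "?G \<subseteq> sets (paths :: (nat \<Rightarrow> 'a) measure)" by auto
  then have "sigma_sets (space (paths :: (nat \<Rightarrow> 'a) measure)) ?G \<subseteq> sets (paths :: (nat \<Rightarrow> 'a) measure)"
    by (rule sets.sigma_sets_subset)
  then show "sigma_sets UNIV ?G \<subseteq> sets (paths :: (nat \<Rightarrow> 'a) measure)" by (simp add: space_PiM)
next
  have "{X. X i \<in> A} \<in> sigma_sets UNIV ?G" for i and A :: "'a set"
  proof -
    define c where "c l = {X. \<forall>j\<le>i. X j = (l :: 'a list) ! j}" for l
    have "{X. X i \<in> A} = (\<Union>l\<in>{l. length l = Suc i \<and> l ! i \<in> A}. c l)"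
    proof safe
      fix X :: "nat \<Rightarrow> 'a" assume "X i \<in> A"
      then show "X \<in> (\<Union>l\<in>{l. length l = Suc i \<and> l ! i \<in> A}. c l)"
        by (intro UN_I[of "map X [0..<Suc i]"]) (auto simp: c_def simp del: upt_Suc)
    qed (auto simp: c_def)
    moreover have "(\<Union>l\<in>{l. length l = Suc i \<and> l ! i \<in> A}. c l) \<in> sigma_sets UNIV ?G"
    proof (rule sigma_sets_UNION)
      fix B assume "B \<in> c ` {l. length l = Suc i \<and> l ! i \<in> A}"
      then have "B \<in> ?G" by (auto simp: c_def image_iff)
      then show "B \<in> sigma_sets UNIV ?G" by (rule sigma_sets.Basic)
    qed auto
    ultimately show ?thesis by simp
  qed
  then have "sigma_sets UNIV {{X. X i \<in> A} | i A. A \<in> UNIV} \<subseteq> sigma_sets UNIV ?G"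
    by (intro sigma_sets_mono) auto
  then show "sets (paths :: (nat \<Rightarrow> 'a) measure) \<subseteq> sigma_sets UNIV ?G"
    by (simp add: sets_PiM_single PiE_UNIV_domain)
qed

lemma measurable_quenched_law:
  assumes I: "\<And>x. {w \<in> space M. x \<in> I w} \<in> sets M" and "\<beta> > 0"
  shows "(\<lambda>w. quenched_law \<beta> k (I w) x) \<in> M \<rightarrow>\<^sub>M prob_algebra paths"
proof (rule measurable_prob_algebra_generated[OF sets_paths_generated])
  have [measurable]: "Measurable.pred M (\<lambda>w. x \<in> I w)" for x
    using I[of x] by (simp add: pred_def)
  have c [measurable]: "(\<lambda>w. conductance \<beta> k (I w) x y) \<in> borel_measurable M" for x y
    unfolding conductance_def by measurable
  have t [measurable]: "(\<lambda>w. total_conductance \<beta> k (I w) x) \<in> borel_measurable M" for x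
    unfolding total_conductance_def by measurable
  have [measurable]: "(\<lambda>w. pmf (walk_kernel \<beta> k (I w) y) z) \<in> borel_measurable M" for y z
    unfolding pmf_walk_kernel[OF assms(2)] by measurable
  show "(\<lambda>w. emeasure (quenched_law \<beta> k (I w) x) A) \<in> borel_measurable M"
    if "A \<in> insert {} (range (\<lambda>(n, xs). {X. \<forall>i\<le>n. X i = xs i}))" for A
    using that by (auto simp: quenched_law_def emeasure_markov_law)
  let ?c = "\<lambda>n (xs :: nat \<Rightarrow> int ^ 'a). {X. \<forall>i\<le>n. X i = xs i}"
  have "?c n xs \<inter> ?c m ys = {} \<or> ?c n xs \<inter> ?c m ys = ?c m ys" if "n \<le> m" for n m xs ys
  proof (cases "\<forall>i\<le>n. xs i = ys i")
    case True
    with that have "?c m ys \<subseteq> ?c n xs" by auto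
    then show ?thesis by blast
  next
    case False
    then obtain i where "i \<le> n" "xs i \<noteq> ys i" by auto
    with that have "?c n xs \<inter> ?c m ys = {}" by auto
    then show ?thesis by blast
  qed
  then have *: "?c n xs \<inter> ?c m ys \<in> {{}, ?c n xs, ?c m ys}" for n m xs ys
    using nat_le_linear[of n m] by (metis (no_types, lifting) Int_commute insertCI)
  show "Int_stable (insert {} (range (\<lambda>(n, xs). ?c n xs)))"
  proof (rule Int_stableI)
    fix A B assume AB: "A \<in> insert {} (range (\<lambda>(n, xs). ?c n xs))"
      "B \<in> insert {} (range (\<lambda>(n, xs). ?c n xs))"
    have "A \<inter> B \<in> {{}, A, B}"
    proof (cases "A = {} \<or> B = {}")
      case False
      with AB obtain n xs m ys where "A = ?c n xs" "B = ?c m ys" by auto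
      then show ?thesis using *[of n xs m ys] by simp
    qed auto
    with AB show "A \<inter> B \<in> insert {} (range (\<lambda>(n, xs). ?c n xs))"
      by (metis (no_types, lifting) insertE insertI1 singletonD)
  qed
qed (auto simp: quenched_law_def prob_space_markov_law sets_markov_law)

lemma emeasure_averaged_law:
  assumes I: "\<And>x. {w \<in> space M. x \<in> I w} \<in> sets M" and "space M \<noteq> {}" and "\<beta> > 0"
    and E: "E \<in> sets paths"
  shows "emeasure (averaged_law M I \<beta> k) E =
    (\<integral>\<^sup>+w. emeasure (quenched_law \<beta> k (I w) 0) E \<partial>conditioned M I)"
proof -
  have "(\<lambda>w. quenched_law \<beta> k (I w) 0) \<in> M \<rightarrow>\<^sub>M subprob_algebra paths"
    by (rule measurable_prob_algebraD[OF measurable_quenched_law[OF I \<open>\<beta> > 0\<close>]])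
  then show ?thesis
    unfolding averaged_law_def using E \<open>space M \<noteq> {}\<close>
    by (intro emeasure_bind[where N=paths]) (auto simp: conditioned_def)
qed

end

(*
  An effective resistance argument. The biased walk is transient as soon as, for every point y of
  the interlacement set, there are nearest neighbour paths from y to arbitrarily high levels x . e_1
  along which the sum of beta^(-level) stays bounded: for the truncated Green function g of the walk,
  the Dirichlet energy of g is at most 2 pi(z) g(z), and Cauchy-Schwarz along such a path turns this
  into a bound on the expected number of visits to z, so that Borel-Cantelli applies.

  The paths are built by climbing from level 4 * 2^j to level 4 * 2^(j+1) inside {level >= 2 * 2^j}.
  Select one point of the path built so far on each of 2^j levels. By the Green function bound
  g(x, y) = O(|x - y|^(-1/2)) this set has capacity at least c 2^(j/2), so even in a fresh independent
  interlacement of the tiny intensity delta (9/10)^j / 10 some trajectory hits it, and then climbs to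
  the next level within O(4^j) steps (gambler's ruin), except with probability O((8/9)^j). The cost
  of the new piece is O(4^j beta^(-2 * 2^j)). No connectivity of the interlacement set is needed.
*)
theory Submission
  imports Defs
begin

section \<open>Nearest neighbours and the one-step Markov property\<close>

text \<open>The hypothesis on \<open>I\<close> supplies void probabilities and no trajectories,
  while the climbing argument needs independent trajectories at prescribed levels. But void
  probabilities determine the law of a random subset of a finite set, so on each finite box
  \<open>I\<close> may be exchanged for an explicit random set \<open>soup\<close>; and they
  multiply under independent unions, so the \<open>soup\<close> at level u splits into stages whose
  levels add up to u. All stages must share one box, hence the length bounds carried along with the
  paths.

  The rates must fit together. The weak decay -1/2 of the Green function serves all d >= 3 at once,
  and it is used only through differences of levels, so the horizontal shape of the path built so
  far does not matter. The capacity 2^(j/2) beats the intensity (9/10)^j because (9/10) * sqrt 2 >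
  1, while the intensities stay summable with a total as small as desired. The passage to an almost
  sure statement rests on a cost bound chosen before the target level.\<close>

lemma adj_iff: "adj x y \<longleftrightarrow> (\<exists>i. y = x + axis i 1 \<or> y = x - axis i 1)"
proof
  assume "adj x y"
  define z where "z = y - x"
  have n: "lnorm (x - y) ^ 2 = (\<Sum>i\<in>UNIV. (real_of_int (z $ i))\<^sup>2)"
    by (simp add: lnorm_def norm_vec_def L2_set_def sum_nonneg z_def power2_commute)
  have "(\<Sum>i\<in>UNIV. (real_of_int (z $ i))\<^sup>2) = 1"
    using \<open>adj x y\<close> unfolding n[symmetric] by (simp add: adj_def)
  then have "real_of_int (\<Sum>i\<in>UNIV. (z $ i)\<^sup>2) = 1"
    by simp
  then have s: "(\<Sum>i\<in>UNIV. (z $ i)\<^sup>2) = 1" by linarith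
  then obtain i where i: "z $ i \<noteq> 0"
    by (metis (no_types, lifting) power_zero_numeral sum.neutral zero_neq_one)
  have s': "(z $ i)\<^sup>2 + (\<Sum>j\<in>UNIV - {i}. (z $ j)\<^sup>2) = 1"
    using s by (simp add: sum.remove[of UNIV i])
  have "(\<Sum>j\<in>UNIV - {i}. (z $ j)\<^sup>2) \<ge> 0" by (simp add: sum_nonneg)
  moreover have "(z $ i)\<^sup>2 \<ge> 1" using i
    by (smt (verit) zero_less_power2)
  ultimately have zi: "(z $ i)\<^sup>2 = 1" and "(\<Sum>j\<in>UNIV - {i}. (z $ j)\<^sup>2) = 0"
    using s' by linarith+
  then have zj: "z $ j = 0" if "j \<noteq> i" for j
    using that by (simp add: sum_nonneg_eq_0_iff)
  have "z $ i = 1 \<or> z $ i = -1" using zi by (simp add: power2_eq_1_iff)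
  then have "z = axis i 1 \<or> z = - axis i 1"
    using zj by (auto simp: vec_eq_iff axis_def)
  then show "\<exists>i. y = x + axis i 1 \<or> y = x - axis i 1"
    unfolding z_def by (metis add_diff_cancel_left' diff_add_cancel add.commute uminus_add_conv_diff)
next
  have e: "(\<chi> j. real_of_int ((axis i 1 :: int ^ 'a) $ j)) = axis i 1"
    "(\<chi> j. real_of_int ((- axis i 1 :: int ^ 'a) $ j)) = - axis i 1" for i :: 'a
    by (auto simp: vec_eq_iff axis_def)
  assume "\<exists>i. y = x + axis i 1 \<or> y = x - axis i 1"
  then obtain i where "x - y = - axis i 1 \<or> x - y = axis i 1" by fastforce
  then show "adj x y" unfolding adj_def lnorm_def
    by (auto simp: e simp del: vector_uminus_component vector_minus_component)
qed

lemma adj_sym: "adj x y \<longleftrightarrow> adj y x"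
  unfolding adj_iff by (metis add_diff_cancel_right' diff_add_cancel)

lemma sum_adj:
  fixes x :: "int ^ 'd" and f :: "int ^ 'd \<Rightarrow> real"
  shows "(\<Sum>y | adj x y. f y) = (\<Sum>i\<in>UNIV. f (x + axis i 1) + f (x - axis i 1))"
proof -
  let ?P = "range (\<lambda>i. x + axis i 1)" and ?N = "range (\<lambda>i. x - axis i 1)"
  have inj: "inj (\<lambda>i :: 'd. axis i (1 :: int))"
    by (auto intro!: injI simp: axis_eq_axis)
  have "{y. adj x y} = ?P \<union> ?N" by (auto simp: adj_iff)
  moreover have "?P \<inter> ?N = {}"
  proof -
    have "x + axis i 1 \<noteq> x - axis j (1 :: int)" for i j :: 'd
    proof
      assume "x + axis i 1 = x - axis j (1 :: int)"
      then have "(x + axis i 1) $ i = (x - axis j 1) $ i" by simp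
      then show False by (simp add: axis_def split: if_splits)
    qed
    then show ?thesis by blast
  qed
  ultimately have "(\<Sum>y | adj x y. f y) = sum f ?P + sum f ?N"
    by (simp add: sum.union_disjoint)
  also have "sum f ?P = (\<Sum>i\<in>UNIV. f (x + axis i 1))"
    by (subst sum.reindex) (use inj in \<open>auto simp: inj_on_def\<close>)
  also have "sum f ?N = (\<Sum>i\<in>UNIV. f (x - axis i 1))"
    by (subst sum.reindex) (use inj in \<open>auto simp: inj_on_def\<close>)
  finally show ?thesis by (simp add: sum.distrib)
qed

lemma card_adj: "card {y. adj x y} = 2 * CARD('d)" for x :: "int ^ 'd"
  using sum_adj[where x = x and f = "\<lambda>_. 1"] by simp

lemma adj_component: "adj x y \<Longrightarrow> \<bar>y $ i - x $ i\<bar> \<le> 1"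
  by (auto simp: adj_iff axis_def)

section \<open>Cylinder sets and the one-step Markov property\<close>

definition cyl :: "nat \<Rightarrow> (nat \<Rightarrow> 'a) \<Rightarrow> (nat \<Rightarrow> 'a) set" where
  "cyl n xs = {X. \<forall>i\<le>n. X i = xs i}"

lemma Int_stable_cyl: "Int_stable (insert {} (range (\<lambda>(n, xs). cyl n xs)))"
proof (rule Int_stableI)
  have "cyl n xs \<inter> cyl m ys = {} \<or> cyl n xs \<inter> cyl m ys = cyl m ys" if "n \<le> m"
    for n m and xs ys :: "nat \<Rightarrow> 'a"
  proof (cases "\<forall>i\<le>n. xs i = ys i")
    case True
    with that have "cyl m ys \<subseteq> cyl n xs" by (auto simp: cyl_def)
    then show ?thesis by blast
  next
    case False
    then obtain i where "i \<le> n" "xs i \<noteq> ys i" by auto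
    with that have "cyl n xs \<inter> cyl m ys = {}" by (auto simp: cyl_def)
    then show ?thesis by blast
  qed
  then have *: "cyl n xs \<inter> cyl m ys \<in> {{}, cyl n xs, cyl m ys}" for n m and xs ys :: "nat \<Rightarrow> 'a"
    using nat_le_linear[of n m] by (metis (no_types, lifting) Int_commute insertCI)
  fix A B :: "(nat \<Rightarrow> 'a) set"
  assume AB: "A \<in> insert {} (range (\<lambda>(n, xs). cyl n xs))" "B \<in> insert {} (range (\<lambda>(n, xs). cyl n xs))"
  have "A \<inter> B \<in> {{}, A, B}"
  proof (cases "A = {} \<or> B = {}")
    case False
    with AB obtain n xs m ys where "A = cyl n xs" "B = cyl m ys" by auto
    then show ?thesis using *[of n xs m ys] by simp
  qed auto
  with AB show "A \<inter> B \<in> insert {} (range (\<lambda>(n, xs). cyl n xs))"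
    by (metis (no_types, lifting) insertE insertI1 singletonD)
qed

lemma sets_paths_cyl:
  "sets (paths :: (nat \<Rightarrow> 'a :: countable) measure) =
     sigma_sets UNIV (insert {} (range (\<lambda>(n, xs). cyl n xs)))"
  unfolding cyl_def by (rule sets_paths_generated)

lemma measurable_case_nat_paths [measurable]: "case_nat x \<in> paths \<rightarrow>\<^sub>M paths"
proof (rule measurable_PiM_single')
  fix i :: nat
  show "(\<lambda>X. case_nat x X i) \<in> paths \<rightarrow>\<^sub>M count_space UNIV" by (cases i) simp_all
qed (auto simp: space_PiM)

text \<open>Conditioning on the first step. Both sides are finite measures in \<open>E\<close> that
  agree on cylinders, where the product formula of \<open>emeasure_markov_law\<close> loses its
  first factor; cylinders are stable under intersection and generate the sigma-algebra.\<close>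

lemma emeasure_markov_law_step:
  fixes K :: "'a :: countable \<Rightarrow> 'a pmf"
  assumes E: "E \<in> sets paths"
  shows "emeasure (markov_law K x) E =
    (\<integral>\<^sup>+y. emeasure (markov_law K y) {X. case_nat x X \<in> E} \<partial>measure_pmf (K x))"
proof -
  let ?D = "\<lambda>y. distr (markov_law K y) paths (case_nat x)"
  let ?N = "measure_pmf (K x) \<bind> ?D"
  have ps: "prob_space (?D y)" for y
    by (rule prob_space.prob_space_distr[OF prob_space_markov_law])
       (simp add: measurable_cong_sets[OF sets_markov_law refl])
  have D: "?D \<in> measure_pmf (K x) \<rightarrow>\<^sub>M subprob_algebra paths"
    by (auto simp: space_subprob_algebra intro: prob_space_imp_subprob_space ps)
  have emN: "emeasure ?N F = (\<integral>\<^sup>+y. emeasure (markov_law K y) {X. case_nat x X \<in> F} \<partial>measure_pmf (K x))"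
    if "F \<in> sets paths" for F
  proof -
    have "emeasure ?N F = (\<integral>\<^sup>+y. emeasure (?D y) F \<partial>measure_pmf (K x))"
      by (rule emeasure_bind[OF _ D that]) simp
    also have "\<dots> = (\<integral>\<^sup>+y. emeasure (markov_law K y) {X. case_nat x X \<in> F} \<partial>measure_pmf (K x))"
    proof (rule nn_integral_cong)
      fix y
      have "emeasure (?D y) F = emeasure (markov_law K y) (case_nat x -` F \<inter> space (markov_law K y))"
        by (rule emeasure_distr) (simp_all add: measurable_cong_sets[OF sets_markov_law refl] that)
      also have "case_nat x -` F \<inter> space (markov_law K y) = {X. case_nat x X \<in> F}"
        using sets_eq_imp_space_eq[OF sets_markov_law[of K y]] by (auto simp: space_PiM)
      finally show "emeasure (?D y) F = emeasure (markov_law K y) {X. case_nat x X \<in> F}" .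
    qed
    finally show ?thesis .
  qed
  have "markov_law K x = ?N"
  proof (rule measure_eqI_generator_eq_countable[OF Int_stable_cyl])
    show "sets (markov_law K x) = sigma_sets UNIV (insert {} (range (\<lambda>(n, xs). cyl n xs)))"
      by (simp add: sets_markov_law sets_paths_cyl)
    show "sets ?N = sigma_sets UNIV (insert {} (range (\<lambda>(n, xs). cyl n xs)))"
      unfolding sets_paths_cyl[symmetric] by (rule sets_bind) auto
    \<comment> \<open>The uniqueness theorem asks for a countable cover by generators: fix the
      starting state only.\<close>
    show "\<Union> (range (\<lambda>a. cyl 0 (\<lambda>_. a))) = UNIV" by (auto simp: cyl_def)
    show "emeasure (markov_law K x) F = emeasure ?N F"
      if "F \<in> insert {} (range (\<lambda>(n, xs). cyl n xs))" for F
    proof (cases "F = {}")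
      case False
      with that obtain n xs where F: "F = cyl n xs" by auto
      have Fs: "F \<in> sets paths" unfolding sets_paths_cyl using that by (rule sigma_sets.Basic)
      show ?thesis
      proof (cases n)
        case 0
        have "{X. case_nat x X \<in> F} = (if xs 0 = x then UNIV else {})"
          by (auto simp: F cyl_def 0)
        moreover have "emeasure (markov_law K y) UNIV = 1" for y
          using prob_space.emeasure_space_1[OF prob_space_markov_law[of K y]]
            sets_eq_imp_space_eq[OF sets_markov_law[of K y]] by (simp add: space_PiM)
        ultimately show ?thesis
          unfolding emN[OF Fs] unfolding F cyl_def emeasure_markov_law
          by (simp add: 0)
      next
        case (Suc m)
        have "(\<forall>i\<le>Suc m. P i) \<longleftrightarrow> P 0 \<and> (\<forall>i\<le>m. P (Suc i))" for P
          by (metis Suc_le_mono le0 nat.exhaust)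
        then have "{X. case_nat x X \<in> F} = (if xs 0 = x then {X. \<forall>i\<le>m. X i = xs (Suc i)} else {})"
          unfolding F cyl_def Suc by auto
        then have "(\<integral>\<^sup>+y. emeasure (markov_law K y) {X. case_nat x X \<in> F} \<partial>measure_pmf (K x)) =
          (\<integral>\<^sup>+y. ennreal (if xs 0 = x then \<Prod>i<m. pmf (K (xs (Suc i))) (xs (Suc (Suc i))) else 0) *
             indicator {xs 1} y \<partial>measure_pmf (K x))"
          by (intro nn_integral_cong)
             (simp add: emeasure_markov_law[of _ _ _ "\<lambda>i. xs (Suc i)"] split: split_indicator)
        also have "\<dots> = ennreal (if xs 0 = x then \<Prod>i<m. pmf (K (xs (Suc i))) (xs (Suc (Suc i))) else 0)
            * ennreal (pmf (K x) (xs 1))"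
          by (subst nn_integral_cmult_indicator) (auto simp: emeasure_pmf_single)
        also have "\<dots> = emeasure (markov_law K x) F"
          unfolding F cyl_def emeasure_markov_law Suc prod.lessThan_Suc_shift
          by (auto simp: ennreal_mult'[symmetric] mult.commute prod_nonneg)
        finally show ?thesis unfolding emN[OF Fs] by simp
      qed
    qed simp
    show "emeasure (markov_law K x) F \<noteq> \<infinity>" for F
    proof -
      interpret prob_space "markov_law K x" by (rule prob_space_markov_law)
      show ?thesis using emeasure_finite[of F] by (simp add: top_unique)
    qed
  qed (auto simp: sets_paths_cyl[symmetric])
  then show ?thesis using emN[OF E] by simp
qed

lemma space_markov_law [simp]: "space (markov_law K x) = UNIV"
  using sets_eq_imp_space_eq[OF sets_markov_law[of K x]] by (simp add: space_PiM)

lemma space_srw_law [simp]: "space (srw_law x) = UNIV"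
  by (simp add: srw_law_def)

lemma sets_srw_law [measurable_cong]: "sets (srw_law x) = sets paths"
  by (simp add: srw_law_def sets_markov_law)

lemma prob_space_srw_law: "prob_space (srw_law x)"
  by (simp add: srw_law_def prob_space_markov_law)

lemma cyl_in_sets: "cyl n xs \<in> sets (paths :: (nat \<Rightarrow> 'a :: countable) measure)"
  unfolding sets_paths_cyl by (rule sigma_sets.Basic) auto

text \<open>An event that depends only on the coordinates up to \<open>n\<close> is a union of
  cylinders, and a countable one because there are countably many finite words over a countable
  state space.\<close>

lemma sets_paths_prefix:
  fixes E :: "(nat \<Rightarrow> 'a :: countable) set"
  assumes "\<And>X Y. (\<And>i. i \<le> n \<Longrightarrow> X i = Y i) \<Longrightarrow> X \<in> E \<Longrightarrow> Y \<in> E"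
  shows "E \<in> sets paths"
proof -
  have "E = (\<Union>l\<in>{l. cyl n (nth l) \<subseteq> E}. cyl n (nth l))"
  proof (rule antisym[OF subsetI])
    fix X assume "X \<in> E"
    let ?l = "map X [0..<Suc n]"
    have "cyl n (nth ?l) \<subseteq> E"
    proof
      fix Y assume "Y \<in> cyl n (nth ?l)"
      then have "Y i = X i" if "i \<le> n" for i
        using that by (auto simp: cyl_def simp del: upt_Suc)
      then show "Y \<in> E" using assms[of X Y] \<open>X \<in> E\<close> by simp
    qed
    moreover have "X \<in> cyl n (nth ?l)" by (auto simp: cyl_def simp del: upt_Suc)
    ultimately show "X \<in> (\<Union>l\<in>{l. cyl n (nth l) \<subseteq> E}. cyl n (nth l))" by blast
  qed blast
  also have "\<dots> \<in> sets paths"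
    by (rule sets.countable_UN') (auto intro: cyl_in_sets)
  finally show ?thesis .
qed

lemma sets_case_nat_vimage:
  assumes "E \<in> sets paths"
  shows "{X. case_nat x X \<in> E} \<in> sets paths"
  using measurable_sets[OF measurable_case_nat_paths assms, of x]
  by (simp add: vimage_def space_PiM)

lemma measure_markov_law_start: "measure (markov_law K x) {X. X 0 = x} = 1"
  using emeasure_markov_law[of K x 0 "\<lambda>_. x"] by (simp add: measure_def)

text \<open>The chain starts at \<open>x\<close> almost surely, so events need to be compared only
  on paths with that start.\<close>

lemma measure_markov_law_cong:
  fixes K :: "'a :: countable \<Rightarrow> 'a pmf"
  assumes "E \<in> sets paths" "F \<in> sets paths" "\<And>X. X 0 = x \<Longrightarrow> X \<in> E \<longleftrightarrow> X \<in> F"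
  shows "measure (markov_law K x) E = measure (markov_law K x) F"
proof -
  interpret prob_space "markov_law K x" by (rule prob_space_markov_law)
  have "{X :: nat \<Rightarrow> 'a. X 0 = x} \<in> sets paths" by (rule sets_paths_prefix[of 0]) auto
  then have "AE X in markov_law K x. X 0 = x"
    using measure_markov_law_start[of K x] prob_eq_1[of "{X. X 0 = x}"] by (simp add: sets_markov_law)
  then show ?thesis
    by (intro finite_measure_eq_AE) (use assms in \<open>auto simp: sets_markov_law\<close>)
qed

lemma measure_markov_law_step:
  fixes K :: "'a :: countable \<Rightarrow> 'a pmf"
  assumes E: "E \<in> sets paths" and S: "finite S" "set_pmf (K x) \<subseteq> S"
  shows "measure (markov_law K x) E =
    (\<Sum>y\<in>S. pmf (K x) y * measure (markov_law K y) {X. case_nat x X \<in> E})"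
proof -
  interpret finite_measure "markov_law K y" for y
    using prob_space_markov_law[of K y] by (rule prob_space.finite_measure)
  let ?m = "\<lambda>y. measure (markov_law K y) {X. case_nat x X \<in> E}"
  have "ennreal (measure (markov_law K x) E) = (\<integral>\<^sup>+y. ennreal (?m y) \<partial>measure_pmf (K x))"
    using emeasure_markov_law_step[OF E, of K x] by (simp add: emeasure_eq_measure)
  also have "\<dots> = (\<Sum>y\<in>S. ennreal (?m y) * ennreal (pmf (K x) y))"
    using S by (intro nn_integral_measure_pmf_support) (auto simp: set_pmf_iff)
  also have "\<dots> = ennreal (\<Sum>y\<in>S. pmf (K x) y * ?m y)"
    by (simp add: ennreal_mult'[symmetric] sum_ennreal mult.commute)
  finally show ?thesis by (simp add: sum_nonneg)
qed

section \<open>Simple random walk\<close>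

definition avg :: "(int ^ 'd \<Rightarrow> real) \<Rightarrow> int ^ 'd \<Rightarrow> real" where
  "avg f x = (\<Sum>y | adj x y. f y) / (2 * CARD('d))"

text \<open>First-step analysis: if an event for the walk from \<open>x\<close> amounts to
  \<open>F\<close> for the walk after one step, its probability is a neighbour average. All
  recursions for simple random walk below come from this form.\<close>

lemma srw_step:
  fixes x :: "int ^ 'd"
  assumes E: "E \<in> sets paths" and F: "F \<in> sets paths"
    and EF: "\<And>X. adj x (X 0) \<Longrightarrow> case_nat x X \<in> E \<longleftrightarrow> X \<in> F"
  shows "measure (srw_law x) E = avg (\<lambda>y. measure (srw_law y) F) x"
proof -
  have "measure (srw_law x) E = (\<Sum>y | adj x y. pmf (pmf_of_set {z. adj x z}) y *
      measure (srw_law y) {X. case_nat x X \<in> E})"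
    unfolding srw_law_def
    by (rule measure_markov_law_step[OF E]) (use set_pmf_of_set[OF adj_nonempty finite_adj, of x] in \<open>simp_all add: finite_adj\<close>)
  also have "\<dots> = (\<Sum>y | adj x y. measure (srw_law y) F / (2 * CARD('d)))"
  proof (intro sum.cong refl)
    fix y assume y: "y \<in> {y. adj x y}"
    have "measure (srw_law y) {X. case_nat x X \<in> E} = measure (srw_law y) F"
      unfolding srw_law_def using y
      by (intro measure_markov_law_cong sets_case_nat_vimage E F) (auto simp: EF)
    then show "pmf (pmf_of_set {z. adj x z}) y * measure (srw_law y) {X. case_nat x X \<in> E} =
        measure (srw_law y) F / (2 * CARD('d))"
      using y by (simp add: pmf_of_set[OF adj_nonempty finite_adj] card_adj)
  qed
  finally show ?thesis by (simp add: avg_def sum_divide_distrib)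
qed

lemma srw_start:
  assumes "E \<in> sets paths"
  shows "(\<And>X. X 0 = x \<Longrightarrow> X \<in> E) \<Longrightarrow> measure (srw_law x) E = 1"
    and "(\<And>X. X 0 = x \<Longrightarrow> X \<notin> E) \<Longrightarrow> measure (srw_law x) E = 0"
proof -
  interpret prob_space "srw_law x" by (rule prob_space_srw_law)
  show "measure (srw_law x) E = 1" if "\<And>X. X 0 = x \<Longrightarrow> X \<in> E"
    using measure_markov_law_cong[OF assms, of UNIV x] that prob_space
    by (auto simp: srw_law_def sets.top[of paths, simplified space_PiM, simplified])
  show "measure (srw_law x) E = 0" if "\<And>X. X 0 = x \<Longrightarrow> X \<notin> E"
    using measure_markov_law_cong[OF assms, of "{}" x] that by (auto simp: srw_law_def)
qed

lemma avg_mono: "(\<And>y. adj x y \<Longrightarrow> f y \<le> g y) \<Longrightarrow> avg f x \<le> avg g x"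
  unfolding avg_def by (intro divide_right_mono sum_mono) auto

lemma avg_cong: "(\<And>y. adj x y \<Longrightarrow> f y = g y) \<Longrightarrow> avg f x = avg g x"
  unfolding avg_def by (intro arg_cong2[of _ _ _ _ "(/)"] sum.cong) auto

lemma avg_add: "avg (\<lambda>y. f y + g y) x = avg f x + avg g x"
  by (simp add: avg_def sum.distrib add_divide_distrib)

lemma avg_cmult: "avg (\<lambda>y. c * f y) x = c * avg f x"
  by (simp add: avg_def sum_distrib_left[symmetric])

lemma avg_sum: "avg (\<lambda>y. \<Sum>i\<in>A. f i y) x = (\<Sum>i\<in>A. avg (f i) x)"
proof -
  have "(\<Sum>y | adj x y. \<Sum>i\<in>A. f i y) = (\<Sum>i\<in>A. \<Sum>y | adj x y. f i y)" by (rule sum.swap)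
  then show ?thesis by (simp add: avg_def sum_divide_distrib)
qed

section \<open>Gambler's ruin for one coordinate of the walk\<close>

lemma avg_level:
  fixes x :: "int ^ 'd" and h :: "int \<Rightarrow> real"
  shows "avg (\<lambda>y. h (y $ k)) x = h (x $ k) +
    (h (x $ k + 1) + h (x $ k - 1) - 2 * h (x $ k)) / (2 * CARD('d))"
proof -
  \<comment> \<open>Of the 2d neighbours only two change coordinate \<open>k\<close>, so the level
    is a lazy walk on the integers.\<close>
  have "(\<Sum>y | adj x y. h (y $ k)) =
      (\<Sum>i\<in>UNIV. 2 * h (x $ k) + (if i = k then h (x $ k + 1) + h (x $ k - 1) - 2 * h (x $ k) else 0))"
    unfolding sum_adj by (intro sum.cong) (auto simp: axis_def)
  also have "\<dots> = 2 * CARD('d) * h (x $ k) + (h (x $ k + 1) + h (x $ k - 1) - 2 * h (x $ k))"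
    by (simp add: sum.distrib)
  finally show ?thesis by (simp add: avg_def add_divide_distrib)
qed

text \<open>Adjacency is part of the event because path space consists of arbitrary sequences;
  membership then yields a genuine lattice path without almost sure exceptions.\<close>

definition reach :: "'d \<Rightarrow> int \<Rightarrow> int \<Rightarrow> nat \<Rightarrow> (nat \<Rightarrow> int ^ 'd) set" where
  "reach k a b T = {S. \<exists>t\<le>T. b \<le> S t $ k \<and> (\<forall>i\<le>t. a \<le> S i $ k) \<and> (\<forall>i<t. adj (S i) (S (Suc i)))}"

definition stay :: "'d \<Rightarrow> int \<Rightarrow> int \<Rightarrow> nat \<Rightarrow> (nat \<Rightarrow> int ^ 'd) set" where
  "stay k a b T = {S. \<forall>t\<le>T. a \<le> S t $ k \<and> S t $ k < b}"

lemma sets_reach: "reach k a b T \<in> sets paths"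
proof (rule sets_paths_prefix[of T])
  fix X Y assume eq: "\<And>i. i \<le> T \<Longrightarrow> X i = Y i" and "X \<in> reach k a b T"
  then obtain t where "t \<le> T" "b \<le> X t $ k" "\<forall>i\<le>t. a \<le> X i $ k" "\<forall>i<t. adj (X i) (X (Suc i))"
    by (auto simp: reach_def)
  then show "Y \<in> reach k a b T" unfolding reach_def
    by (intro CollectI exI[of _ t]) (auto simp: eq[symmetric])
qed

lemma sets_stay: "stay k a b T \<in> sets paths"
  by (rule sets_paths_prefix[of T]) (auto simp: stay_def)

lemma case_nat_reach:
  assumes "adj x (X 0)" "x $ k < b" "a \<le> x $ k"
  shows "case_nat x X \<in> reach k a b (Suc T) \<longleftrightarrow> X \<in> reach k a b T"
proof
  assume "case_nat x X \<in> reach k a b (Suc T)"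
  then obtain t where t: "t \<le> Suc T" "b \<le> case_nat x X t $ k" "\<forall>i\<le>t. a \<le> case_nat x X i $ k"
    "\<forall>i<t. adj (case_nat x X i) (case_nat x X (Suc i))" by (auto simp: reach_def)
  then obtain s where s: "t = Suc s" using assms by (cases t) auto
  show "X \<in> reach k a b T" unfolding reach_def
  proof (intro CollectI exI[of _ s] conjI allI impI)
    show "s \<le> T" "b \<le> X s $ k" using t s by auto
    show "a \<le> X i $ k" if "i \<le> s" for i using t(3)[rule_format, of "Suc i"] that s by simp
    show "adj (X i) (X (Suc i))" if "i < s" for i using t(4)[rule_format, of "Suc i"] that s by simp
  qed
next
  assume "X \<in> reach k a b T"
  then obtain t where t: "t \<le> T" "b \<le> X t $ k" "\<forall>i\<le>t. a \<le> X i $ k" "\<forall>i<t. adj (X i) (X (Suc i))"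
    by (auto simp: reach_def)
  then show "case_nat x X \<in> reach k a b (Suc T)" unfolding reach_def using assms
    by (intro CollectI exI[of _ "Suc t"]) (auto split: nat.split)
qed

lemma case_nat_stay:
  assumes "x $ k < b" "a \<le> x $ k"
  shows "case_nat x X \<in> stay k a b (Suc T) \<longleftrightarrow> X \<in> stay k a b T"
proof -
  have "(\<forall>i\<le>Suc T. P i) \<longleftrightarrow> P 0 \<and> (\<forall>i\<le>T. P (Suc i))" for P
    by (metis Suc_le_mono le0 nat.exhaust)
  then show ?thesis using assms by (simp add: stay_def)
qed

lemma reach_stay:
  fixes x :: "int ^ 'd"
  assumes "a \<le> b" "a - 1 \<le> x $ k" "x $ k \<le> b"
  shows "real_of_int (x $ k - a + 1) / real_of_int (b - a + 1) \<le>
    measure (srw_law x) (reach k a b T) + measure (srw_law x) (stay k a b T)"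
  using assms(2,3)
proof (induction T arbitrary: x)
  have frac: "real_of_int (x $ k - a + 1) / real_of_int (b - a + 1) \<le> 1" if "x $ k \<le> b" for x :: "int ^ 'd"
    using that assms(1) by simp
  note start = srw_start(1)[OF sets_reach] srw_start(1)[OF sets_stay]
  {
    case 0
    show ?case
    proof (cases "a \<le> x $ k")
      case True
      then have "measure (srw_law x) (reach k a b 0) = 1 \<or> measure (srw_law x) (stay k a b 0) = 1"
        using 0 start(1)[of x k a b 0] start(2)[of x k a b 0]
        by (cases "x $ k = b") (simp_all add: reach_def stay_def)
      then show ?thesis using frac[of x] 0
        by (smt (verit, ccfv_SIG) measure_nonneg)
    next
      case False
      with 0 have "x $ k = a - 1" by linarith
      then show ?thesis by simp
    qed
  next
    case (Suc T)
    consider "x $ k = a - 1" | "x $ k = b" "a \<le> x $ k" | "a \<le> x $ k" "x $ k < b"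
      using Suc.prems by linarith
    then show ?case
    proof cases
      case 1
      then show ?thesis by simp
    next
      case 2
      then have "measure (srw_law x) (reach k a b (Suc T)) = 1"
        by (intro start(1)) (auto simp: reach_def intro!: exI[of _ 0])
      then show ?thesis using frac[of x] 2
        by (smt (verit, ccfv_SIG) measure_nonneg)
    next
      case 3
      let ?w = "\<lambda>y :: int ^ 'd. real_of_int (y $ k - a + 1) / real_of_int (b - a + 1)"
      have "?w x = avg ?w x"
        using avg_level[of "\<lambda>l. real_of_int (l - a + 1) / real_of_int (b - a + 1)" k x]
        by (simp add: diff_divide_distrib add_divide_distrib)
      also have "\<dots> \<le> avg (\<lambda>y. measure (srw_law y) (reach k a b T) + measure (srw_law y) (stay k a b T)) x"
      proof (rule avg_mono)
        fix y assume "adj x y"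
        then have "\<bar>y $ k - x $ k\<bar> \<le> 1" by (rule adj_component)
        then show "?w y \<le> measure (srw_law y) (reach k a b T) + measure (srw_law y) (stay k a b T)"
          using 3 by (intro Suc.IH) auto
      qed
      also have "\<dots> = measure (srw_law x) (reach k a b (Suc T)) + measure (srw_law x) (stay k a b (Suc T))"
        unfolding avg_add
        by (intro arg_cong2[of _ _ _ _ "(+)"] srw_step[symmetric] sets_reach sets_stay case_nat_reach case_nat_stay)
           (use 3 in auto)
      finally show ?thesis .
    qed
  }
qed

text \<open>A bound on the expected exit time. The quadratic on the right vanishes at
  \<open>a - 1\<close> and \<open>b\<close> and drops by exactly 1 under \<open>avg\<close> inside
  the strip, the factor d compensating for the laziness of one coordinate. It dominates the sum of
  the probabilities of \<open>stay\<close> over all times up to \<open>T\<close>, and these decrease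
  in time.\<close>

lemma stay_le:
  fixes x :: "int ^ 'd"
  assumes "a \<le> b" "a - 1 \<le> x $ k" "x $ k \<le> b"
  shows "real (Suc T) * measure (srw_law x) (stay k a b T) \<le>
    real CARD('d) * real_of_int (x $ k - a + 1) * real_of_int (b - x $ k)"
proof -
  interpret prob_space "srw_law y" for y :: "int ^ 'd" by (rule prob_space_srw_law)
  let ?D = "\<lambda>x :: int ^ 'd. real CARD('d) * real_of_int (x $ k - a + 1) * real_of_int (b - x $ k)"
  let ?s = "\<lambda>T x. measure (srw_law x) (stay k a b T)"
  have "(\<Sum>j\<le>T. ?s j x) \<le> ?D x"
    using assms(2,3)
  proof (induction T arbitrary: x)
    have out: "?s j x = 0" if "x $ k = a - 1 \<or> x $ k = b" for j x
      using that by (intro srw_start(2)[OF sets_stay]) (auto simp: stay_def)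
    have zero: "?s 0 x = 1" if "a \<le> x $ k" "x $ k < b" for x
      using that by (intro srw_start(1)[OF sets_stay]) (auto simp: stay_def)
    {
      case 0
      show ?case
      proof (cases "a \<le> x $ k \<and> x $ k < b")
        case True
        then have "1 \<le> real_of_int (x $ k - a + 1)" "1 \<le> real_of_int (b - x $ k)" by linarith+
        moreover have "1 \<le> real CARD('d)" by simp
        ultimately have "1 * 1 * 1 \<le> ?D x" by (intro mult_mono) auto
        then show ?thesis using zero True by simp
      next
        case False
        with 0 have "x $ k = a - 1 \<or> x $ k = b" by arith
        then show ?thesis using out[of x 0] by auto
      qed
    next
      case (Suc T)
      show ?case
      proof (cases "a \<le> x $ k \<and> x $ k < b")
        case True
        have "(\<Sum>j\<le>Suc T. ?s j x) = 1 + (\<Sum>j\<le>T. ?s (Suc j) x)"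
          using zero True by (subst sum.atMost_Suc_shift) simp
        also have "(\<Sum>j\<le>T. ?s (Suc j) x) = avg (\<lambda>y. \<Sum>j\<le>T. ?s j y) x"
          unfolding avg_sum using True
          by (intro sum.cong refl srw_step sets_stay case_nat_stay) auto
        also have "\<dots> \<le> avg ?D x"
        proof (rule avg_mono)
          fix y assume "adj x y"
          then have "\<bar>y $ k - x $ k\<bar> \<le> 1" by (rule adj_component)
          then show "(\<Sum>j\<le>T. ?s j y) \<le> ?D y" using True by (intro Suc.IH) auto
        qed
        also have "avg ?D x = ?D x - 1"
          using avg_level[of "\<lambda>l. real CARD('d) * real_of_int (l - a + 1) * real_of_int (b - l)" k x]
          by (simp add: field_simps)
        finally show ?thesis by simp
      next
        case False
        with Suc.prems have *: "x $ k = a - 1 \<or> x $ k = b" by arith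
        then have D: "?D x = 0" by auto
        show ?thesis unfolding D by (simp add: out[OF *])
      qed
    }
  qed
  moreover have "?s T x \<le> ?s j x" if "j \<le> T" for j
    using that by (intro finite_measure_mono) (auto simp: stay_def sets_srw_law sets_stay[unfolded stay_def])
  then have "(\<Sum>j\<le>T. ?s T x) \<le> (\<Sum>j\<le>T. ?s j x)" by (intro sum_mono) auto
  ultimately show ?thesis by simp
qed

section \<open>A polynomially decaying superharmonic function\<close>

text \<open>The Taylor coefficient of second order is 10/64; the slightly larger 11/64 absorbs the
  remainder. Taking fourth powers reduces the claim to a polynomial inequality.\<close>

lemma powr_quarter_bound:
  fixes t :: real
  assumes "\<bar>t\<bar> \<le> 1 / 20"
  shows "(1 + t) powr (- 1 / 4) \<le> 1 - t / 4 + 11 / 64 * t\<^sup>2"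
proof -
  define y where "y = 1 - t / 4 + 11 / 64 * t\<^sup>2"
  \<comment> \<open>This is (y^4 (1 + t) - 1) / t^2 in Horner form. The constant term 1/16 exceeds
    1/20, the most that the other terms can contribute for |t| at most 1/20.\<close>
  define q where "q = 1 / 16 + t * (31/64 + t * (-549/2048 + t * (863/4096 + t * (-4455/65536
      + t * (6897/262144 + t * (-70543/16777216 + t * (14641/16777216)))))))"
  have step: "\<bar>c + t * r\<bar> \<le> \<bar>c\<bar> + B / 20" if "\<bar>r\<bar> \<le> B" for c r B :: real
  proof -
    have "\<bar>t\<bar> * \<bar>r\<bar> \<le> 1 / 20 * B" using assms that by (intro mult_mono) auto
    then have "\<bar>t * r\<bar> \<le> B / 20" by (simp add: abs_mult)
    then show ?thesis by linarith
  qed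
  let ?r7 = "14641/16777216 :: real"
  let ?r6 = "-70543/16777216 + t * ?r7"
  let ?r5 = "6897/262144 + t * ?r6"
  let ?r4 = "-4455/65536 + t * ?r5"
  let ?r3 = "863/4096 + t * ?r4"
  let ?r2 = "-549/2048 + t * ?r3"
  let ?r1 = "31/64 + t * ?r2"
  have "\<bar>?r7\<bar> \<le> 1" by simp
  from step[OF this, of "-70543/16777216"] have "\<bar>?r6\<bar> \<le> 1" by linarith
  from step[OF this, of "6897/262144"] have "\<bar>?r5\<bar> \<le> 1" by linarith
  from step[OF this, of "-4455/65536"] have "\<bar>?r4\<bar> \<le> 1" by linarith
  from step[OF this, of "863/4096"] have "\<bar>?r3\<bar> \<le> 1" by linarith
  from step[OF this, of "-549/2048"] have "\<bar>?r2\<bar> \<le> 1" by linarith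
  from step[OF this, of "31/64"] have "\<bar>?r1\<bar> \<le> 1" by linarith
  from step[OF this, of 0] have "\<bar>t * ?r1\<bar> \<le> 1 / 20" by simp
  then have q: "q \<ge> 0" unfolding q_def by linarith
  have "y ^ 4 * (1 + t) - 1 = t\<^sup>2 * q"
    unfolding y_def q_def by (simp add: power2_eq_square power4_eq_xxxx field_simps)
  then have y4: "1 \<le> y ^ 4 * (1 + t)" using q by (smt (verit) mult_nonneg_nonneg zero_le_power2)
  have t: "1 + t > 0" using assms by linarith
  have y0: "y \<ge> 0" unfolding y_def using assms zero_le_power2[of t] by linarith
  have "((1 + t) powr (- 1 / 4)) ^ 4 = (1 + t) powr (- 1)"
    using t by (simp add: powr_power)
  also have "\<dots> = 1 / (1 + t)" using t by (simp add: powr_minus_divide)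
  also have "\<dots> \<le> y ^ 4" using t y4 by (simp add: divide_le_eq)
  finally have "(1 + t) powr (- 1 / 4) \<le> y"
    by (rule power_le_imp_le_base[of _ 3, simplified]) (use y0 in auto)
  then show ?thesis by (simp add: y_def)
qed

definition sqn :: "int ^ 'd \<Rightarrow> real" where
  "sqn x = (\<Sum>i\<in>UNIV. (real_of_int (x $ i))\<^sup>2)"

text \<open>The exponent \<open>1/4\<close> lies below \<open>(d - 2) / 2\<close> for all \<open>d \<ge> 3\<close>; the shift \<open>3600\<close> keeps the
  relative increment of the argument along an edge within the range of \<open>powr_quarter_bound\<close>.\<close>

definition radial :: "int ^ 'd \<Rightarrow> real" where
  "radial x = (sqn x + 3600) powr (- 1 / 4)"

lemma sqn_component: "(real_of_int (x $ i))\<^sup>2 \<le> sqn x"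
  unfolding sqn_def by (rule member_le_sum) auto

lemma sqn_nonneg: "0 \<le> sqn x"
  unfolding sqn_def by (intro sum_nonneg) auto

lemma sqn_axis:
  fixes x :: "int ^ 'd" and \<sigma> :: int
  assumes "\<sigma>\<^sup>2 = 1"
  shows "sqn (x + axis i \<sigma>) = sqn x + (1 + 2 * \<sigma> * x $ i)"
proof -
  have "sqn (x + axis i \<sigma>) = (\<Sum>j\<in>UNIV. (real_of_int (x $ j))\<^sup>2 +
      (if j = i then real_of_int (1 + 2 * \<sigma> * x $ i) else 0))"
    unfolding sqn_def
  proof (intro sum.cong refl)
    fix j
    have "(real_of_int \<sigma>)\<^sup>2 = 1" using assms by (metis of_int_1 of_int_power)
    then show "(real_of_int ((x + axis i \<sigma>) $ j))\<^sup>2 = (real_of_int (x $ j))\<^sup>2 +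
      (if j = i then real_of_int (1 + 2 * \<sigma> * x $ i) else 0)"
      by (auto simp: axis_def power2_sum)
  qed
  then show ?thesis by (simp add: sum.distrib sqn_def)
qed

lemma radial_nonneg: "0 \<le> radial x" by (simp add: radial_def)

text \<open>Second-order expansion along the 2d edges. With s the shifted square distance and w = x
  - z, the first-order terms contribute the relative change -1/(4s), the others at most 11/(48s)
  plus O(1/s^2). Here d >= 3 enters through |w|^2 / d \<le> s / 3. The gap that remains is more than
  1/(100s).\<close>

lemma avg_radial:
  fixes x :: "int ^ 'd"
  assumes "CARD('d) \<ge> 3"
  shows "avg (\<lambda>y. radial (y - z)) x \<le> radial (x - z) * (1 - 1 / (100 * (sqn (x - z) + 3600)))"
proof -
  define w where "w = x - z"
  define s where "s = sqn w + 3600"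
  define F where "F = s powr (- 1 / 4)"
  have s: "s \<ge> 3600" using sqn_nonneg[of w] by (simp add: s_def)
  have F: "F \<ge> 0" by (simp add: F_def)
  have step: "radial (w + axis i \<sigma>) \<le> F * (1 - (1 + 2 * \<sigma> * w $ i) / (4 * s)
      + 11 / 64 * ((1 + 2 * \<sigma> * w $ i) / s)\<^sup>2)" if "\<sigma>\<^sup>2 = 1" for \<sigma> i
  proof -
    define t where "t = real_of_int (1 + 2 * \<sigma> * w $ i) / s"
    have "\<bar>\<sigma>\<bar> = 1" using that by (auto simp: power2_eq_1_iff)
    then have "\<bar>real_of_int (2 * \<sigma> * w $ i)\<bar> = 2 * \<bar>real_of_int (w $ i)\<bar>"
      by (simp add: abs_mult) (metis mult_1 of_int_1 of_int_abs)
    moreover have "\<bar>real_of_int (w $ i)\<bar> \<le> sqrt s"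
      using sqn_component[of w i] by (intro real_le_rsqrt) (simp add: s_def)
    ultimately have "\<bar>real_of_int (1 + 2 * \<sigma> * w $ i)\<bar> \<le> 1 + 2 * sqrt s" by simp
    \<comment> \<open>The purpose of the shift: 1 + 2 sqrt s is at most 3 sqrt s, hence at most s /
      20.\<close>
    moreover have "60 \<le> sqrt s" using s by (intro real_le_rsqrt) simp
    moreover from this have "60 * sqrt s \<le> sqrt s * sqrt s" by (intro mult_right_mono) linarith+
    ultimately have "\<bar>real_of_int (1 + 2 * \<sigma> * w $ i)\<bar> \<le> s / 20" using s by simp
    then have t: "\<bar>t\<bar> \<le> 1 / 20" using s by (simp add: t_def divide_le_eq)
    have "radial (w + axis i \<sigma>) = (s * (1 + t)) powr (- 1 / 4)"
    proof -
      have "s * t = real_of_int (1 + 2 * \<sigma> * w $ i)" using s by (simp add: t_def)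
      then have "sqn (w + axis i \<sigma>) + 3600 = s * (1 + t)"
        by (simp add: sqn_axis[OF that] s_def distrib_left)
      then show ?thesis by (simp add: radial_def)
    qed
    also have "\<dots> = F * (1 + t) powr (- 1 / 4)"
      using s t by (simp add: F_def powr_mult)
    also have "\<dots> \<le> F * (1 - t / 4 + 11 / 64 * t\<^sup>2)"
      using F powr_quarter_bound[OF t] by (rule mult_left_mono[rotated])
    finally show ?thesis by (simp add: t_def mult.commute[of s 4])
  qed
  have pair: "radial (w + axis i 1) + radial (w - axis i 1) \<le>
      F * (2 - 1 / (2 * s) + 11 / 64 * (2 + 8 * (real_of_int (w $ i))\<^sup>2) / s\<^sup>2)" for i
  proof -
    have m: "w - axis i 1 = w + axis i (- 1)" by (simp add: vec_eq_iff axis_def)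
    have "radial (w + axis i 1) + radial (w - axis i 1) \<le>
      F * (1 - (1 + 2 * w $ i) / (4 * s) + 11 / 64 * ((1 + 2 * w $ i) / s)\<^sup>2) +
      F * (1 - (1 - 2 * w $ i) / (4 * s) + 11 / 64 * ((1 - 2 * w $ i) / s)\<^sup>2)"
      unfolding m using step[of 1 i] step[of "-1" i] by (intro add_mono) simp_all
    also have "\<dots> = F * (2 - 1 / (2 * s) + 11 / 64 * (2 + 8 * (real_of_int (w $ i))\<^sup>2) / s\<^sup>2)"
      using s by (simp add: field_simps power2_eq_square)
    finally show ?thesis .
  qed
  let ?d = "real CARD('d)"
  have d: "?d \<ge> 3" using assms by simp
  have "avg (\<lambda>y. radial (y - z)) x = (\<Sum>i\<in>UNIV. radial (w + axis i 1) + radial (w - axis i 1)) / (2 * ?d)"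
    unfolding avg_def sum_adj w_def by (simp add: algebra_simps)
  also have "\<dots> \<le> (\<Sum>i\<in>UNIV. F * (2 - 1 / (2 * s) + 11 / 64 * (2 + 8 * (real_of_int (w $ i))\<^sup>2) / s\<^sup>2)) / (2 * ?d)"
    by (intro divide_right_mono sum_mono pair) simp
  also have "(\<Sum>i\<in>UNIV. F * (2 - 1 / (2 * s) + 11 / 64 * (2 + 8 * (real_of_int (w $ i))\<^sup>2) / s\<^sup>2)) =
      F * (?d * (2 - 1 / (2 * s)) + 11 / 64 * (2 * ?d + 8 * sqn w) / s\<^sup>2)"
  proof -
    define A where "A = F * (2 - 1 / (2 * s)) + F * 11 / 32 / s\<^sup>2"
    define B where "B = F * 11 / 8 / s\<^sup>2"
    have "F * (2 - 1 / (2 * s) + 11 / 64 * (2 + 8 * W) / s\<^sup>2) = A + B * W" for W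
      unfolding A_def B_def by (simp add: algebra_simps add_divide_distrib)
    then have "(\<Sum>i\<in>UNIV. F * (2 - 1 / (2 * s) + 11 / 64 * (2 + 8 * (real_of_int (w $ i))\<^sup>2) / s\<^sup>2)) =
        ?d * A + B * sqn w"
      by (simp add: sum.distrib sum_distrib_left[symmetric] sqn_def)
    then show ?thesis unfolding A_def B_def by (simp add: algebra_simps add_divide_distrib)
  qed
  also have "\<dots> / (2 * ?d) = F * (1 - 1 / (4 * s) + 11 / 64 / s\<^sup>2 + 11 / 16 * (sqn w / ?d) / s\<^sup>2)"
    using d s by (simp add: field_simps power2_eq_square)
  also have "\<dots> \<le> F * (1 - 1 / (100 * s))"
  proof (rule mult_left_mono[OF _ F])
    have "sqn w / ?d \<le> s / 3"
      using d s sqn_nonneg[of w] by (intro frac_le) (auto simp: s_def)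
    then have "11 / 16 * (sqn w / ?d) / s\<^sup>2 \<le> 11 / 16 * (s / 3) / s\<^sup>2"
      by (intro divide_right_mono) auto
    also have "\<dots> = (11 / 48) / s" using s by (simp add: power2_eq_square)
    finally have 1: "11 / 16 * (sqn w / ?d) / s\<^sup>2 \<le> (11 / 48) / s" .
    have "11 / 64 / s\<^sup>2 = (11 / 64 / s) / s" by (simp add: power2_eq_square)
    also have "\<dots> \<le> (1 / 1000) / s" using s by (intro divide_right_mono) (auto simp: divide_le_eq)
    finally have 2: "11 / 64 / s\<^sup>2 \<le> (1 / 1000) / s" .
    have 3: "1 / (4 * s) = (1 / 4) / s" "1 / (100 * s) = (1 / 100) / s" by simp_all
    have "(1 / 1000) / s + (11 / 48) / s + (1 / 100) / s \<le> (1 / 4) / s"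
      using s unfolding add_divide_distrib[symmetric] by (intro divide_right_mono) auto
    then show "1 - 1 / (4 * s) + 11 / 64 / s\<^sup>2 + 11 / 16 * (sqn w / ?d) / s\<^sup>2 \<le> 1 - 1 / (100 * s)"
      using 1 2 unfolding 3 by linarith
  qed
  finally show ?thesis by (simp add: F_def s_def w_def radial_def)
qed

text \<open>At \<open>x = z\<close> the shifted square distance is 3600, and the relative gap of
  \<open>avg_radial\<close> leaves room for a point mass; elsewhere only superharmonicity is
  kept.\<close>

lemma radial_superharmonic:
  assumes "CARD('d) \<ge> 3"
  obtains c :: real where "c > 0"
    "\<And>x z :: int ^ 'd. c * indicator {z} x + avg (\<lambda>y. radial (y - z)) x \<le> radial (x - z)"
proof
  let ?c = "3600 powr (- 1 / 4) * (1 / 360000) :: real"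
  show "?c > 0" by simp
  fix x z :: "int ^ 'd"
  show "?c * indicator {z} x + avg (\<lambda>y. radial (y - z)) x \<le> radial (x - z)"
  proof (cases "x = z")
    case True
    then have "sqn (x - z) = 0" by (simp add: sqn_def)
    then show ?thesis using avg_radial[OF assms, of z x] True by (simp add: radial_def algebra_simps)
  next
    case False
    have "radial (x - z) * (1 - 1 / (100 * (sqn (x - z) + 3600))) \<le> radial (x - z) * 1"
      using sqn_nonneg[of "x - z"] by (intro mult_left_mono radial_nonneg) auto
    then show ?thesis using avg_radial[OF assms, of z x] False by simp
  qed
qed

lemma radial_le_level: "radial x \<le> 2 / sqrt (1 + \<bar>real_of_int (x $ k)\<bar>)"
proof -
  define l where "l = \<bar>real_of_int (x $ k)\<bar>"
  have "0 \<le> (l - 1)\<^sup>2" by simp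
  then have "(1 + l)\<^sup>2 / 2 \<le> 1 + l\<^sup>2" by (simp add: power2_sum power2_diff)
  also have "\<dots> \<le> sqn x + 3600" using sqn_component[of x k] by (simp add: l_def)
  finally have "radial x \<le> ((1 + l)\<^sup>2 / 2) powr (- 1 / 4)"
    unfolding radial_def by (intro powr_mono2') (auto simp: l_def add_nonneg_eq_0_iff)
  also have "\<dots> = ((1 + l) powr 2) powr (- 1 / 4) * (1 / 2) powr (- 1 / 4)"
    by (simp add: powr_mult[symmetric] l_def)
  also have "((1 + l) powr 2) powr (- 1 / 4) = (1 + l) powr (- (1 / 2))"
    by (subst powr_powr) simp
  also have "\<dots> = 1 / sqrt (1 + l)"
    by (subst powr_minus_divide, subst powr_half_sqrt) (auto simp: l_def)
  also have "(1 / 2 :: real) powr (- 1 / 4) = 2 powr (1 / 4)"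
    by (simp add: powr_divide powr_minus_divide)
  also have "1 / sqrt (1 + l) * 2 powr (1 / 4) \<le> 1 / sqrt (1 + l) * 2 powr 1"
    by (intro mult_left_mono powr_mono) (auto simp: l_def)
  finally show ?thesis by (simp add: l_def)
qed

section \<open>Green function and capacity\<close>

definition srw_prob :: "nat \<Rightarrow> int ^ 'd \<Rightarrow> int ^ 'd \<Rightarrow> real" where
  "srw_prob n x z = measure (srw_law x) {S. S n = z}"

definition green :: "int ^ 'd \<Rightarrow> int ^ 'd \<Rightarrow> real" where
  "green x z = (\<Sum>n. srw_prob n x z)"

lemma sets_coord: "{S. Q (S n)} \<in> sets (paths :: (nat \<Rightarrow> 'a :: countable) measure)"
  by (rule sets_paths_prefix[of n]) auto

lemma sets_hit: "{S. \<exists>k\<ge>n. S k \<in> A} \<in> sets (paths :: (nat \<Rightarrow> 'a :: countable) measure)"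
proof -
  have "{S :: nat \<Rightarrow> 'a. \<exists>k\<ge>n. S k \<in> A} = (\<Union>k\<in>{n..}. {S. S k \<in> A})" by auto
  then show ?thesis by (auto intro: sets_coord)
qed

lemma srw_prob_nonneg: "0 \<le> srw_prob n x z"
  by (simp add: srw_prob_def)

lemma srw_prob_0: "srw_prob 0 x z = indicator {z} x"
  unfolding srw_prob_def
  by (cases "x = z") (auto intro!: srw_start sets_coord[where Q = "\<lambda>y. y = z"])

lemma srw_prob_Suc: "srw_prob (Suc n) x z = avg (\<lambda>y. srw_prob n y z) x"
  unfolding srw_prob_def by (rule srw_step) (auto intro: sets_coord[where Q = "\<lambda>y. y = z"])

text \<open>Reversibility. The recursion by the last step, \<open>right\<close>, is derived from the
  one by the first step; it is the latter with the two sites exchanged.\<close>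

lemma srw_prob_sym: "srw_prob n x z = srw_prob n z x"
proof -
  have right: "srw_prob (Suc n) x z = avg (srw_prob n x) z" for n and x z :: "int ^ 'a"
  proof (induction n arbitrary: x)
    case 0
    have *: "(\<Sum>y | adj x y. if y = z then 1 else 0) = (if adj x z then 1 else (0 :: real))"
      for x z :: "int ^ 'a"
      by (simp add: finite_adj)
    have "(\<Sum>y | adj x y. indicator {z} y) = (\<Sum>y | adj z y. indicator {y} x :: real)"
    proof -
      have "indicator {z} y = (if y = z then 1 else 0 :: real)" "indicator {y} x = (if y = x then 1 else 0 :: real)" for y
        by (auto simp: indicator_def)
      then show ?thesis using *[of x z] *[of z x] adj_sym[of x z] by simp
    qed
    then show ?case unfolding srw_prob_Suc srw_prob_0 avg_def by simp
  next
    case (Suc n)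
    have "srw_prob (Suc (Suc n)) x z = avg (\<lambda>y. avg (srw_prob n y) z) x"
      unfolding srw_prob_Suc[of "Suc n"] Suc.IH ..
    also have "\<dots> = avg (\<lambda>w. avg (\<lambda>y. srw_prob n y w) x) z"
      unfolding avg_def sum_divide_distrib by (rule sum.swap)
    finally show ?case by (simp add: srw_prob_Suc)
  qed
  show ?thesis
  proof (induction n arbitrary: x z)
    case 0
    show ?case by (auto simp: srw_prob_0 indicator_def)
  next
    case (Suc n)
    show ?case unfolding srw_prob_Suc[of n x z] right[of n z x] by (intro avg_cong Suc.IH)
  qed
qed

text \<open>Minimality of the Green function, for partial sums: a nonnegative function that exceeds
  its neighbour average by at least \<open>c\<close> at the pole and by at least 0 elsewhere
  dominates \<open>c\<close> times the expected number of visits.\<close>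

lemma sum_srw_prob_le:
  fixes x z :: "int ^ 'd"
  assumes c: "c > 0" "\<And>x z :: int ^ 'd. c * indicator {z} x + avg (\<lambda>y. radial (y - z)) x \<le> radial (x - z)"
  shows "(\<Sum>k<n. srw_prob k x z) \<le> radial (x - z) / c"
proof (induction n arbitrary: x)
  case 0
  show ?case using c(1) by (simp add: radial_nonneg)
next
  case (Suc n)
  have "(\<Sum>k<Suc n. srw_prob k x z) = indicator {z} x + avg (\<lambda>y. \<Sum>k<n. srw_prob k y z) x"
    by (simp add: sum.lessThan_Suc_shift srw_prob_0 srw_prob_Suc avg_sum del: sum.lessThan_Suc)
  also have "\<dots> \<le> indicator {z} x + avg (\<lambda>y. 1 / c * radial (y - z)) x"
    using Suc.IH by (intro add_left_mono avg_mono) simp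
  also have "\<dots> = (c * indicator {z} x + avg (\<lambda>y. radial (y - z)) x) / c"
    unfolding avg_cmult using c(1) by (simp add: add_divide_distrib)
  also have "\<dots> \<le> radial (x - z) / c"
    using c by (intro divide_right_mono) auto
  finally show ?case .
qed

lemma summable_srw_prob:
  fixes x z :: "int ^ 'd"
  assumes "CARD('d) \<ge> 3"
  shows "summable (\<lambda>n. srw_prob n x z)"
proof -
  obtain c :: real where c: "c > 0"
    "\<And>x z :: int ^ 'd. c * indicator {z} x + avg (\<lambda>y. radial (y - z)) x \<le> radial (x - z)"
    using radial_superharmonic[OF assms] by blast
  show ?thesis
    by (rule summableI_nonneg_bounded[OF srw_prob_nonneg sum_srw_prob_le[OF c]])
qed

lemma green_le:
  assumes "CARD('d) \<ge> 3"
  obtains C :: real where "C > 0"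
    "\<And>(x :: int ^ 'd) z k. green x z \<le> C / sqrt (1 + \<bar>real_of_int (x $ k - z $ k)\<bar>)"
proof -
  obtain c :: real where c: "c > 0"
    "\<And>x z :: int ^ 'd. c * indicator {z} x + avg (\<lambda>y. radial (y - z)) x \<le> radial (x - z)"
    using radial_superharmonic[OF assms] by blast
  show ?thesis
  proof
    show "2 / c > 0" using c by simp
    fix x z :: "int ^ 'd" and k
    have "green x z \<le> radial (x - z) / c"
      unfolding green_def
      by (intro suminf_le_const summable_srw_prob assms sum_srw_prob_le c)
    also have "\<dots> \<le> (2 / sqrt (1 + \<bar>real_of_int ((x - z) $ k)\<bar>)) / c"
      using c by (intro divide_right_mono radial_le_level) auto
    finally show "green x z \<le> 2 / c / sqrt (1 + \<bar>real_of_int (x $ k - z $ k)\<bar>)" by (simp add: mult.commute)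
  qed
qed

lemma green_sym: "green x z = green z x"
  unfolding green_def by (simp add: srw_prob_sym[of _ x])

section \<open>Hitting probabilities, last exit and capacity\<close>

definition hit :: "nat \<Rightarrow> (int ^ 'd) set \<Rightarrow> int ^ 'd \<Rightarrow> real" where
  "hit n A x = measure (srw_law x) {S. \<exists>k\<ge>n. S k \<in> A}"

lemma hit_Suc: "hit (Suc n) A x = avg (hit n A) x"
proof -
  have "(\<exists>k\<ge>Suc n. case_nat x X k \<in> A) \<longleftrightarrow> (\<exists>k\<ge>n. X k \<in> A)" for X
    by (metis (no_types, lifting) Suc_le_D Suc_le_mono nat.case(2))
  then show ?thesis unfolding hit_def by (intro srw_step sets_hit) simp
qed

lemma hit_in: "x \<in> A \<Longrightarrow> hit 0 A x = 1"
  unfolding hit_def by (intro srw_start(1) sets_hit) auto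

lemma hit_0_1: "hit 0 A x - hit 1 A x = equilibrium A x"
proof -
  interpret prob_space "srw_law x" by (rule prob_space_srw_law)
  let ?N = "{S. \<forall>k\<ge>1. S k \<notin> A}"
  have N: "?N = UNIV - {S. \<exists>k\<ge>1. S k \<in> A}" by auto
  have e: "equilibrium A x = (1 - hit 1 A x) * indicator A x"
    unfolding equilibrium_def hitting_time_eq_infinity_iff N hit_def
    using prob_compl[of "{S. \<exists>k\<ge>1. S k \<in> A}"] sets_hit[of 1 A] by (simp add: sets_srw_law)
  show ?thesis
  proof (cases "x \<in> A")
    case True
    then show ?thesis by (simp add: e hit_in)
  next
    case False
    have "hit 0 A x = hit 1 A x" unfolding hit_def srw_law_def
    proof (intro measure_markov_law_cong sets_hit)
      fix X :: "nat \<Rightarrow> int ^ 'a" assume "X 0 = x"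
      then have "1 \<le> k" if "X k \<in> A" for k using that False by (cases k) auto
      then show "X \<in> {S. \<exists>k\<ge>0. S k \<in> A} \<longleftrightarrow> X \<in> {S. \<exists>k\<ge>1. S k \<in> A}" by auto
    qed
    then show ?thesis using False by (simp add: e)
  qed
qed

lemma equilibrium_nonneg: "0 \<le> equilibrium A x"
  by (simp add: equilibrium_def)

lemma equilibrium_le_1: "equilibrium A x \<le> 1"
proof -
  interpret prob_space "srw_law x" by (rule prob_space_srw_law)
  show ?thesis by (simp add: equilibrium_def indicator_def)
qed

text \<open>Decomposition by time n and place z of the last visit to \<open>A\<close>:
  \<open>hit n A x - hit (Suc n) A x\<close> is the probability that this visit happens at time n.
  The differences telescope, and \<open>hit N A x\<close> tends to 0 by transience.\<close>

lemma last_exit: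
  fixes x :: "int ^ 'd"
  assumes d: "CARD('d) \<ge> 3" and A: "finite A"
  shows "hit 0 A x = (\<Sum>z\<in>A. green x z * equilibrium A z)"
proof -
  define G where "G n x = (\<Sum>z\<in>A. srw_prob n x z * equilibrium A z)" for n and x :: "int ^ 'd"
  have diff: "hit n A x - hit (Suc n) A x = G n x" for n x
  proof (induction n arbitrary: x)
    case 0
    have "G 0 x = equilibrium A x"
      using A by (simp add: G_def srw_prob_0 indicator_def equilibrium_def)
    then show ?case using hit_0_1[of A x] by simp
  next
    case (Suc n)
    have "hit (Suc n) A x - hit (Suc (Suc n)) A x = avg (\<lambda>y. hit n A y + (-1) * hit (Suc n) A y) x"
      unfolding avg_add avg_cmult hit_Suc[of n] hit_Suc[of "Suc n"] by simp
    also have "\<dots> = avg (G n) x" using Suc.IH by (intro avg_cong) simp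
    also have "\<dots> = G (Suc n) x"
      unfolding G_def avg_sum srw_prob_Suc
      by (intro sum.cong refl) (simp add: mult.commute[of _ "equilibrium A _"] avg_cmult)
    finally show ?case .
  qed
  have part: "hit 0 A x - hit N A x = (\<Sum>n<N. G n x)" for N
  proof (induction N)
    case (Suc N)
    then show ?case using diff[of N x] by simp
  qed simp
  have "(\<lambda>N. hit N A x) \<longlonglongrightarrow> 0"
  proof -
    interpret prob_space "srw_law x" by (rule prob_space_srw_law)
    define f where "f k = (\<Sum>z\<in>A. srw_prob k x z)" for k
    have f: "summable f" unfolding f_def by (intro summable_sum summable_srw_prob d)
    have fk: "prob {S. S k \<in> A} = f k" for k
    proof -
      have "{S. S k \<in> A} = (\<Union>z\<in>A. {S. S k = z})" by auto
      also have "prob \<dots> = f k" unfolding f_def srw_prob_def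
        using A by (intro finite_measure_finite_Union)
          (auto simp: disjoint_family_on_def sets_srw_law intro: sets_coord[where Q = "\<lambda>y. y = _"])
      finally show ?thesis .
    qed
    \<comment> \<open>Union bound by a tail of the convergent series of expected visits to
      \<open>A\<close>.\<close>
    have le: "hit N A x \<le> (\<Sum>k. f (k + N))" for N
    proof -
      have "{S. \<exists>k\<ge>N. S k \<in> A} = (\<Union>k. {S. S (k + N) \<in> A})"
      proof safe
        fix S and k :: nat assume "N \<le> k" "S k \<in> A"
        then show "S \<in> (\<Union>k. {S. S (k + N) \<in> A})" by (intro UN_I[of "k - N"]) auto
      next
        fix S and k :: nat assume "S (k + N) \<in> A"
        then show "\<exists>k\<ge>N. S k \<in> A" by (intro exI[of _ "k + N"]) auto
      qed
      then have "hit N A x = prob (\<Union>k. {S. S (k + N) \<in> A})" by (simp add: hit_def)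
      also have "\<dots> \<le> (\<Sum>k. prob {S. S (k + N) \<in> A})"
        by (intro finite_measure_subadditive_countably)
           (auto simp: fk f summable_ignore_initial_segment sets_srw_law intro: sets_coord)
      finally show "hit N A x \<le> (\<Sum>k. f (k + N))" by (simp add: fk)
    qed
    show ?thesis
      by (rule tendsto_sandwich[OF _ _ tendsto_const suminf_exist_split2[OF f]])
         (use le in \<open>auto simp: hit_def\<close>)
  qed
  then have "(\<lambda>N. hit 0 A x - hit N A x) \<longlonglongrightarrow> hit 0 A x - 0"
    by (rule tendsto_diff[OF tendsto_const])
  then have "(\<lambda>n. G n x) sums hit 0 A x" by (simp add: sums_def part)
  moreover have "(\<lambda>n. G n x) sums (\<Sum>z\<in>A. green x z * equilibrium A z)"
    unfolding G_def green_def
    by (intro sums_sum sums_mult2 summable_sums summable_srw_prob d)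
  ultimately show ?thesis by (rule sums_unique2)
qed

text \<open>Balayage, from the last-exit formula for both sets, the symmetry of \<open>green\<close>
  and the fact that \<open>hit 0 A\<close> is 1 on \<open>K\<close>. It is the reason why walks
  started from the equilibrium measure of a box give the right void probabilities for every subset
  of the box.\<close>

lemma sweeping:
  fixes A K :: "(int ^ 'd) set"
  assumes d: "CARD('d) \<ge> 3" and A: "finite A" and K: "K \<subseteq> A"
  shows "capacity K = (\<Sum>x\<in>A. equilibrium A x * hit 0 K x)"
proof -
  have K': "finite K" using A K by (rule finite_subset[rotated])
  have "(\<Sum>x\<in>A. equilibrium A x * hit 0 K x) =
      (\<Sum>x\<in>A. \<Sum>z\<in>K. equilibrium A x * (green x z * equilibrium K z))"
    by (simp add: last_exit[OF d K'] sum_distrib_left)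
  also have "\<dots> = (\<Sum>z\<in>K. \<Sum>x\<in>A. equilibrium K z * (green z x * equilibrium A x))"
    by (subst sum.swap) (simp add: green_sym mult_ac)
  also have "\<dots> = (\<Sum>z\<in>K. equilibrium K z * hit 0 A z)"
    by (simp add: last_exit[OF d A] sum_distrib_left)
  also have "\<dots> = capacity K"
    unfolding capacity_def using K by (intro sum.cong) (auto simp: hit_in)
  finally show ?thesis by simp
qed

lemma capacity_nonneg: "0 \<le> capacity K"
  unfolding capacity_def by (intro sum_nonneg equilibrium_nonneg)

text \<open>Sum the last-exit formula over the starting points in \<open>K\<close>, where the
  hitting probability is 1, and exchange the sums.\<close>

lemma card_le_capacity:
  fixes K :: "(int ^ 'd) set"
  assumes d: "CARD('d) \<ge> 3" and K: "finite K"
    and M: "\<And>z. z \<in> K \<Longrightarrow> (\<Sum>x\<in>K. green x z) \<le> M"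
  shows "real (card K) \<le> capacity K * M"
proof -
  have "real (card K) = (\<Sum>x\<in>K. hit 0 K x)" by (simp add: hit_in)
  also have "\<dots> = (\<Sum>z\<in>K. equilibrium K z * (\<Sum>x\<in>K. green x z))"
    unfolding last_exit[OF d K] by (subst sum.swap) (simp add: sum_distrib_left mult.commute)
  also have "\<dots> \<le> (\<Sum>z\<in>K. equilibrium K z * M)"
    using M by (intro sum_mono mult_left_mono equilibrium_nonneg)
  finally show ?thesis by (simp add: capacity_def sum_distrib_right)
qed

lemma sum_inverse_sqrt_le: "(\<Sum>i<m. 1 / sqrt (1 + real i)) \<le> 2 * sqrt (real m)"
proof (induction m)
  case (Suc m)
  define s where "s = sqrt (1 + real m)"
  define r where "r = sqrt (real m)"
  have s: "s > 0" and r: "r \<ge> 0" and sr: "s\<^sup>2 = 1 + r\<^sup>2" by (auto simp: s_def r_def)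
  have "0 \<le> (s - r)\<^sup>2" by simp
  then have "2 * r * s + 1 \<le> 2 * s * s" using sr by (simp add: power2_diff power2_eq_square algebra_simps)
  then have "(2 * r + 1 / s) * s \<le> (2 * s) * s" using s by (simp add: algebra_simps)
  then have "2 * r + 1 / s \<le> 2 * s" using s by (simp only: mult_le_cancel_right_pos)
  then show ?case using Suc.IH by (simp add: s_def r_def add.commute)
qed simp

text \<open>The Green function bound involves only differences of levels, so with one point per
  level the sum of \<open>green\<close> over \<open>K\<close> is at most two copies of a sum of
  inverse square roots, of order \<open>sqrt (real m)\<close>, wherever the points lie within their
  levels.\<close>

lemma capacity_levels:
  assumes d: "CARD('d) \<ge> 3"
  obtains c :: real where "c > 0"
    "\<And>(K :: (int ^ 'd) set) k l m. bij_betw (\<lambda>x. x $ k) K {l..<l + int m} \<Longrightarrow> c * sqrt (real m) \<le> capacity K"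
proof -
  obtain C :: real where C: "C > 0"
    "\<And>(x :: int ^ 'd) z k. green x z \<le> C / sqrt (1 + \<bar>real_of_int (x $ k - z $ k)\<bar>)"
    using green_le[OF d] by blast
  show ?thesis
  proof
    show "1 / (4 * C) > 0" using C by simp
    fix K :: "(int ^ 'd) set" and k :: 'd and l :: int and m :: nat
    assume bij: "bij_betw (\<lambda>x. x $ k) K {l..<l + int m}"
    then have fin: "finite K" by (simp add: bij_betw_finite)
    have card: "card K = m" using bij_betw_same_card[OF bij] by simp
    let ?g = "\<lambda>i. 1 / sqrt (1 + real i)"
    have "(\<Sum>x\<in>K. green x z) \<le> 4 * C * sqrt (real m)" if z: "z \<in> K" for z
    proof -
      define q where "q = z $ k"
      have q: "l \<le> q" "q < l + int m" using bij_betwE[OF bij] z by (auto simp: q_def)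
      have "(\<Sum>x\<in>K. green x z) \<le> (\<Sum>x\<in>K. C / sqrt (1 + \<bar>real_of_int (x $ k - q)\<bar>))"
        unfolding q_def by (intro sum_mono C)
      also have "\<dots> = (\<Sum>j\<in>{l..<l + int m}. C / sqrt (1 + \<bar>real_of_int (j - q)\<bar>))"
        by (rule sum.reindex_bij_betw[OF bij])
      also have "{l..<l + int m} = {l..<q} \<union> {q..<l + int m}" using q by auto
      also have "(\<Sum>j\<in>{l..<q} \<union> {q..<l + int m}. C / sqrt (1 + \<bar>real_of_int (j - q)\<bar>)) =
          (\<Sum>j\<in>{l..<q}. C / sqrt (1 + \<bar>real_of_int (j - q)\<bar>)) +
          (\<Sum>j\<in>{q..<l + int m}. C / sqrt (1 + \<bar>real_of_int (j - q)\<bar>))"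
        by (rule sum.union_disjoint) auto
      also have "(\<Sum>j\<in>{l..<q}. C / sqrt (1 + \<bar>real_of_int (j - q)\<bar>)) \<le> (\<Sum>i<m. C * ?g i)"
      proof -
        \<comment> \<open>On the lower side the distance q - j is replaced by q - 1 - j: this only
          increases the term and lets the index start at 0.\<close>
        have "(\<Sum>j\<in>{l..<q}. C / sqrt (1 + \<bar>real_of_int (j - q)\<bar>)) \<le> (\<Sum>j\<in>{l..<q}. C * ?g (nat (q - 1 - j)))"
          using C(1) by (intro sum_mono) (auto intro!: divide_left_mono)
        also have "\<dots> = (\<Sum>i\<in>(\<lambda>j. nat (q - 1 - j)) ` {l..<q}. C * ?g i)"
          by (subst sum.reindex) (auto simp: inj_on_def)
        also have "\<dots> \<le> (\<Sum>i<m. C * ?g i)"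
          using q C(1) by (intro sum_mono2) auto
        finally show ?thesis .
      qed
      also have "(\<Sum>j\<in>{q..<l + int m}. C / sqrt (1 + \<bar>real_of_int (j - q)\<bar>)) \<le> (\<Sum>i<m. C * ?g i)"
      proof -
        have "(\<Sum>j\<in>{q..<l + int m}. C / sqrt (1 + \<bar>real_of_int (j - q)\<bar>)) = (\<Sum>i\<in>(\<lambda>j. nat (j - q)) ` {q..<l + int m}. C * ?g i)"
          by (subst sum.reindex) (auto simp: inj_on_def intro!: sum.cong)
        also have "\<dots> \<le> (\<Sum>i<m. C * ?g i)"
          using q C(1) by (intro sum_mono2) auto
        finally show ?thesis .
      qed
      also have "(\<Sum>i<m. C * ?g i) + (\<Sum>i<m. C * ?g i) = 2 * C * (\<Sum>i<m. ?g i)"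
        by (simp add: sum_distrib_left)
      also have "\<dots> \<le> 2 * C * (2 * sqrt (real m))"
        using C(1) by (intro mult_left_mono sum_inverse_sqrt_le) auto
      finally show ?thesis by simp
    qed
    then have "real m \<le> capacity K * (4 * C * sqrt (real m))"
      using card_le_capacity[OF d fin] card by metis
    then have "sqrt (real m) * sqrt (real m) \<le> (capacity K * (4 * C)) * sqrt (real m)" by (simp add: mult_ac)
    then have "sqrt (real m) \<le> capacity K * (4 * C)"
      using C(1) by (cases "m = 0")
        (simp add: capacity_nonneg, rule mult_right_le_imp_le[of _ "sqrt (real m)"], auto)
    then show "1 / (4 * C) * sqrt (real m) \<le> capacity K" using C(1) by (simp add: field_simps)
  qed
qed

section \<open>Finite-volume interlacements\<close>

text \<open>The strong Markov property at the first visit to \<open>\<gamma>\<close>, as an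
  inequality and without stopping times. The induction on the horizon of \<open>H\<close> uses
  first-step analysis off \<open>\<gamma>\<close>; prepending a step preserves the event
  \<open>F\<close>, so its probability is superharmonic.\<close>

lemma srw_excursion_ge:
  fixes x :: "int ^ 'd"
  assumes p: "p \<ge> 0" "\<And>y. y \<in> \<gamma> \<Longrightarrow> p \<le> measure (srw_law y) E" and E: "E \<in> sets paths"
  shows "p * hit 0 \<gamma> x \<le> measure (srw_law x) {S. \<exists>m. S m \<in> \<gamma> \<and> (\<lambda>i. S (m + i)) \<in> E}"
proof -
  define F where "F = {S. \<exists>m. S m \<in> \<gamma> \<and> (\<lambda>i. S (m + i)) \<in> E}"
  define H where "H n = {S :: nat \<Rightarrow> int ^ 'd. \<exists>m\<le>n. S m \<in> \<gamma>}" for n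
  have shift: "(\<lambda>S i. S (m + i)) \<in> paths \<rightarrow>\<^sub>M (paths :: (nat \<Rightarrow> int ^ 'd) measure)" for m
    by (rule measurable_PiM_single') (auto simp: space_PiM)
  have F: "F \<in> sets paths"
  proof -
    have "{S. (\<lambda>i. S (m + i)) \<in> E} \<in> sets paths" for m
      using measurable_sets[OF shift E, of m] by (simp add: vimage_def space_PiM)
    then have "(\<Union>m. {S. S m \<in> \<gamma>} \<inter> {S. (\<lambda>i. S (m + i)) \<in> E}) \<in> sets paths"
      by (intro sets.countable_UN sets.Int) (auto intro: sets_coord)
    also have "(\<Union>m. {S. S m \<in> \<gamma>} \<inter> {S. (\<lambda>i. S (m + i)) \<in> E}) = F"
      by (auto simp: F_def)
    finally show ?thesis .
  qed
  have H: "H n \<in> sets paths" for n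
    unfolding H_def by (rule sets_paths_prefix[of n]) auto
  interpret prob_space "srw_law y" for y :: "int ^ 'd" by (rule prob_space_srw_law)
  have super: "avg (\<lambda>y. prob y F) x \<le> prob x F" for x
  proof -
    have c: "{X. case_nat x X \<in> F} \<in> sets paths" for x by (rule sets_case_nat_vimage[OF F])
    have "F \<subseteq> {X. case_nat x X \<in> F}"
    proof
      fix X assume "X \<in> F"
      then obtain m where "X m \<in> \<gamma>" "(\<lambda>i. X (m + i)) \<in> E" by (auto simp: F_def)
      then show "X \<in> {X. case_nat x X \<in> F}" unfolding F_def by (auto intro!: exI[of _ "Suc m"])
    qed
    then have "avg (\<lambda>y. prob y F) x \<le> avg (\<lambda>y. prob y {X. case_nat x X \<in> F}) x"
      by (intro avg_mono finite_measure_mono) (auto simp: sets_srw_law c)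
    also have "\<dots> = prob x F" by (rule srw_step[symmetric, OF F c]) simp
    finally show ?thesis .
  qed
  have inside: "p \<le> prob x F" if "x \<in> \<gamma>" for x
  proof -
    have "p \<le> prob x E" using p that by simp
    also have "\<dots> = prob x (E \<inter> {S. S 0 \<in> \<gamma>})"
      unfolding srw_law_def using that
      by (intro measure_markov_law_cong E sets.Int sets_coord) auto
    also have "\<dots> \<le> prob x F"
      by (intro finite_measure_mono) (auto simp: F_def sets_srw_law F[unfolded F_def] intro: exI[of _ 0])
    finally show ?thesis .
  qed
  have "p * prob x (H n) \<le> prob x F" for n
  proof (induction n arbitrary: x)
    case 0
    have "prob x (H 0) = 0" if "x \<notin> \<gamma>"
      using that by (intro srw_start(2) H) (auto simp: H_def)
    moreover have "p * prob x (H 0) \<le> p * 1" using p by (intro mult_left_mono) auto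
    ultimately show ?case using inside[of x] by (cases "x \<in> \<gamma>") auto
  next
    case (Suc n)
    show ?case
    proof (cases "x \<in> \<gamma>")
      case True
      have "p * prob x (H (Suc n)) \<le> p * 1" using p by (intro mult_left_mono) auto
      then show ?thesis using inside[OF True] by simp
    next
      case False
      have ex: "(\<exists>m\<le>Suc n. P m) \<longleftrightarrow> P 0 \<or> (\<exists>m\<le>n. P (Suc m))" for P
        by (metis Suc_le_mono le0 nat.exhaust)
      have "prob x (H (Suc n)) = avg (\<lambda>y. prob y (H n)) x"
        using False by (intro srw_step H) (auto simp: H_def ex)
      then have "p * prob x (H (Suc n)) = avg (\<lambda>y. p * prob y (H n)) x"
        by (simp add: avg_cmult)
      also have "\<dots> \<le> avg (\<lambda>y. prob y F) x" by (intro avg_mono Suc.IH)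
      also have "\<dots> \<le> prob x F" by (rule super)
      finally show ?thesis .
    qed
  qed
  moreover have "(\<lambda>n. prob x (H n)) \<longlonglongrightarrow> prob x (\<Union>n. H n)"
  proof (rule finite_Lim_measure_incseq)
    show "range H \<subseteq> events x" using H by (auto simp: sets_srw_law)
    show "incseq H" by (rule incseq_SucI) (auto simp: H_def intro: le_SucI)
  qed
  then have "(\<lambda>n. p * prob x (H n)) \<longlonglongrightarrow> p * prob x (\<Union>n. H n)"
    by (rule tendsto_mult_left)
  ultimately have "p * prob x (\<Union>n. H n) \<le> prob x F"
    using LIMSEQ_le_const2 by blast
  moreover have "(\<Union>n. H n) = {S. \<exists>k\<ge>0. S k \<in> \<gamma>}" by (auto simp: H_def)
  ultimately show ?thesis by (simp add: hit_def F_def)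
qed

text \<open>The intensity, at level 1, of those trajectories whose trace on \<open>A\<close> is
  exactly \<open>s\<close>, with trajectories started from the equilibrium measure of
  \<open>A\<close>.\<close>

definition trace_mass :: "(int ^ 'd) set \<Rightarrow> (int ^ 'd) set \<Rightarrow> real" where
  "trace_mass A s = (\<Sum>x\<in>A. equilibrium A x * measure (srw_law x) {S. range S \<inter> A = s})"

lemma sets_trace:
  assumes "finite A"
  shows "{S. range S \<inter> A = s} \<in> sets (paths :: (nat \<Rightarrow> 'a :: countable) measure)"
proof (cases "s \<subseteq> A")
  case True
  have "{S :: nat \<Rightarrow> 'a. y \<in> range S} \<in> sets paths" for y
    using sets_hit[of 0 "{y}"] by (auto simp: image_def eq_commute)
  moreover from sets.compl_sets[OF this] have "{S :: nat \<Rightarrow> 'a. y \<notin> range S} \<in> sets paths" for y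
    by (simp add: space_PiM Compl_eq_Diff_UNIV[symmetric] Collect_neg_eq[symmetric])
  ultimately have "{S :: nat \<Rightarrow> 'a. y \<in> range S \<longleftrightarrow> y \<in> s} \<in> sets paths" for y
    by (cases "y \<in> s") auto
  then have "(\<Inter>y\<in>A. {S :: nat \<Rightarrow> 'a. y \<in> range S \<longleftrightarrow> y \<in> s}) \<in> sets paths"
    using assms by (cases "A = {}") (auto intro: sets.finite_INT simp: space_PiM sets.top[of paths, simplified space_PiM, simplified])
  also have "(\<Inter>y\<in>A. {S :: nat \<Rightarrow> 'a. y \<in> range S \<longleftrightarrow> y \<in> s}) = {S. range S \<inter> A = s}"
    using True by auto
  finally show ?thesis .
next
  case False
  then have "{S :: nat \<Rightarrow> 'a. range S \<inter> A = s} = {}" by auto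
  then show ?thesis by simp
qed

lemma trace_mass_nonneg: "0 \<le> trace_mass A s"
  unfolding trace_mass_def by (intro sum_nonneg mult_nonneg_nonneg equilibrium_nonneg) auto

lemma sum_trace_mass:
  assumes A: "finite A" and G: "G \<subseteq> Pow A"
  shows "(\<Sum>s\<in>G. trace_mass A s) =
    (\<Sum>x\<in>A. equilibrium A x * measure (srw_law x) {S. range S \<inter> A \<in> G})"
proof -
  have G': "finite G" using A G by (auto intro: finite_subset)
  have "measure (srw_law x) {S. range S \<inter> A \<in> G} = (\<Sum>s\<in>G. measure (srw_law x) {S. range S \<inter> A = s})" for x
  proof -
    interpret prob_space "srw_law x" by (rule prob_space_srw_law)
    have "{S :: nat \<Rightarrow> int ^ 'a. range S \<inter> A \<in> G} = (\<Union>s\<in>G. {S. range S \<inter> A = s})" by auto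
    moreover have "prob (\<Union>s\<in>G. {S. range S \<inter> A = s}) = (\<Sum>s\<in>G. prob {S. range S \<inter> A = s})"
      by (intro finite_measure_finite_Union G')
         (auto simp: disjoint_family_on_def sets_srw_law intro: sets_trace[OF A])
    ultimately show ?thesis by simp
  qed
  then show ?thesis unfolding trace_mass_def
    by (subst sum.swap) (simp add: sum_distrib_left)
qed

text \<open>Instead of a Poisson cloud of trajectories we use independent indicators, one for every
  possible trace \<open>s \<subseteq> A\<close>, of the event that some trajectory of the cloud has trace \<open>s\<close>.\<close>

definition trace_field :: "(int ^ 'd) set \<Rightarrow> real \<Rightarrow> ((int ^ 'd) set \<Rightarrow> bool) pmf" where
  "trace_field A v = Pi_pmf (Pow A) False (\<lambda>s. bernoulli_pmf (1 - exp (- v * trace_mass A s)))"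

definition soup :: "(int ^ 'd) set \<Rightarrow> real \<Rightarrow> (int ^ 'd) set pmf" where
  "soup A v = map_pmf (\<lambda>\<omega>. \<Union>{s \<in> Pow A. \<omega> s}) (trace_field A v)"

lemma set_soup: "set_pmf (soup A v) \<subseteq> Pow A"
  by (auto simp: soup_def)

lemma trace_field_none:
  assumes A: "finite A" and G: "G \<subseteq> Pow A" and v: "v \<ge> 0"
  shows "measure_pmf.prob (trace_field A v) {\<omega>. \<forall>s\<in>G. \<not> \<omega> s} = exp (- v * (\<Sum>s\<in>G. trace_mass A s))"
proof -
  let ?B = "\<lambda>s. if s \<in> G then {False} else UNIV"
  let ?p = "\<lambda>s. bernoulli_pmf (1 - exp (- v * trace_mass A s))"
  have "\<omega> s \<in> ?B s \<longleftrightarrow> (s \<in> G \<longrightarrow> \<not> \<omega> s)" for \<omega> s by simp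
  then have "Pi (Pow A) ?B = {\<omega>. \<forall>s\<in>Pow A. s \<in> G \<longrightarrow> \<not> \<omega> s}" by (simp only: Pi_def Ball_def)
  also have "\<dots> = {\<omega>. \<forall>s\<in>G. \<not> \<omega> s}" using G by blast
  finally have "{\<omega>. \<forall>s\<in>G. \<not> \<omega> s} = Pi (Pow A) ?B" by (rule sym)
  then have "measure_pmf.prob (trace_field A v) {\<omega>. \<forall>s\<in>G. \<not> \<omega> s} =
      (\<Prod>s\<in>Pow A. measure_pmf.prob (?p s) (?B s))"
    unfolding trace_field_def using A by (simp add: measure_Pi_pmf_Pi)
  also have "\<dots> = (\<Prod>s\<in>G. measure_pmf.prob (?p s) (?B s))"
    using A G by (intro prod.mono_neutral_right) auto
  also have "\<dots> = (\<Prod>s\<in>G. exp (- v * trace_mass A s))"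
    using v trace_mass_nonneg[of A]
    by (intro prod.cong) (auto simp: measure_pmf_single)
  also have "\<dots> = exp (- v * (\<Sum>s\<in>G. trace_mass A s))"
    using A G by (simp add: exp_sum sum_distrib_left finite_subset)
  finally show ?thesis .
qed

text \<open>The set avoids \<open>K\<close> iff no trace meeting \<open>K\<close> is present. The
  total mass of these traces is the equilibrium mass of the walks that hit \<open>K\<close>, which
  \<open>sweeping\<close> evaluates.\<close>

lemma soup_void:
  fixes A K :: "(int ^ 'd) set"
  assumes d: "CARD('d) \<ge> 3" and A: "finite A" and K: "K \<subseteq> A" and v: "v \<ge> 0"
  shows "measure_pmf.prob (soup A v) {s. s \<inter> K = {}} = exp (- v * capacity K)"
proof -
  let ?G = "{s \<in> Pow A. s \<inter> K \<noteq> {}}"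
  have sub: "?G \<subseteq> Pow A" by auto
  have "(\<lambda>\<omega>. \<Union>{s \<in> Pow A. \<omega> s}) -` {s. s \<inter> K = {}} = {\<omega>. \<forall>s\<in>?G. \<not> \<omega> s}" by auto
  then have "measure_pmf.prob (soup A v) {s. s \<inter> K = {}} = exp (- v * (\<Sum>s\<in>?G. trace_mass A s))"
    unfolding soup_def measure_map_pmf using trace_field_none[OF A sub v] by (simp only:)
  also have "(\<Sum>s\<in>?G. trace_mass A s) = (\<Sum>x\<in>A. equilibrium A x * hit 0 K x)"
  proof (subst sum_trace_mass[OF A])
    have "{S :: nat \<Rightarrow> int ^ 'd. range S \<inter> A \<in> ?G} = {S. \<exists>k\<ge>0. S k \<in> K}" using K by auto
    then show "(\<Sum>x\<in>A. equilibrium A x * measure (srw_law x) {S. range S \<inter> A \<in> ?G}) =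
      (\<Sum>x\<in>A. equilibrium A x * hit 0 K x)" by (simp add: hit_def)
  qed auto
  also have "\<dots> = capacity K" by (rule sweeping[OF d A K, symmetric])
  finally show ?thesis .
qed

section \<open>Laws of random finite sets from their void probabilities\<close>

lemma sum_Pow_eqD:
  fixes p q :: "'a set \<Rightarrow> real"
  assumes A: "finite A" and eq: "\<And>B. B \<subseteq> A \<Longrightarrow> (\<Sum>s\<in>Pow B. p s) = (\<Sum>s\<in>Pow B. q s)" and B: "B \<subseteq> A"
  shows "p B = q B"
  using finite_subset[OF B A] B
proof (induction B rule: finite_psubset_induct)
  case (psubset B)
  \<comment> \<open>Moebius inversion over subsets: proper subsets of \<open>B\<close> are settled
    by induction, so only the term of \<open>B\<close> itself is left.\<close>
  have "(\<Sum>s\<in>Pow B. r s) = r B + (\<Sum>s\<in>Pow B - {B}. r s)" for r :: "'a set \<Rightarrow> real"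
    using psubset.hyps by (intro sum.remove) auto
  moreover have "(\<Sum>s\<in>Pow B - {B}. p s) = (\<Sum>s\<in>Pow B - {B}. q s)"
    using psubset by (intro sum.cong) auto
  ultimately show ?case using eq[OF psubset.prems] by simp
qed

text \<open>Avoiding \<open>A - B\<close> means being contained in \<open>B\<close>, so void
  probabilities are subset sums of point masses.\<close>

lemma pmf_eqI_void:
  assumes A: "finite A" and p: "set_pmf p \<subseteq> Pow A" and q: "set_pmf q \<subseteq> Pow A"
    and void: "\<And>K. K \<subseteq> A \<Longrightarrow> measure_pmf.prob p {s. s \<inter> K = {}} = measure_pmf.prob q {s. s \<inter> K = {}}"
  shows "p = q"
proof -
  have below: "measure_pmf.prob r {s. s \<inter> (A - B) = {}} = (\<Sum>s\<in>Pow B. pmf r s)"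
    if "set_pmf r \<subseteq> Pow A" "B \<subseteq> A" for r B
  proof -
    have "measure_pmf.prob r {s. s \<inter> (A - B) = {}} = measure_pmf.prob r (Pow B)"
      using that by (intro measure_prob_cong_0) (auto simp: set_pmf_eq)
    also have "\<dots> = (\<Sum>s\<in>Pow B. pmf r s)"
      using A that by (intro measure_measure_pmf_finite) (auto intro: finite_subset)
    finally show ?thesis .
  qed
  have eq: "pmf p B = pmf q B" if "B \<subseteq> A" for B
  proof (rule sum_Pow_eqD[OF A _ that])
    show "(\<Sum>s\<in>Pow B. pmf p s) = (\<Sum>s\<in>Pow B. pmf q s)" if "B \<subseteq> A" for B
      using void[of "A - B"] below[OF p that] below[OF q that] by simp
  qed
  show ?thesis
  proof (rule pmf_eqI)
    fix B
    show "pmf p B = pmf q B"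
      using eq[of B] p q by (cases "B \<subseteq> A") (simp, metis PowD pmf_eq_0_set_pmf subsetD)
  qed
qed

text \<open>Chains two stages: the conditional failure probability of the second is added to the
  failure probability of the first.\<close>

lemma prob_bind_ge:
  assumes eps: "\<epsilon> \<ge> 0" and E: "\<And>s. s \<in> set_pmf p \<Longrightarrow> s \<in> E \<Longrightarrow> 1 - \<epsilon> \<le> measure_pmf.prob (f s) F"
  shows "measure_pmf.prob p E - \<epsilon> \<le> measure_pmf.prob (bind_pmf p f) F"
proof (cases "\<epsilon> \<le> 1")
  case True
  have "ennreal ((1 - \<epsilon>) * measure_pmf.prob p E) = (\<integral>\<^sup>+s. ennreal (1 - \<epsilon>) * indicator E s \<partial>p)"
    using True by (simp add: nn_integral_cmult_indicator measure_pmf.emeasure_eq_measure ennreal_mult)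
  also have "\<dots> \<le> (\<integral>\<^sup>+s. emeasure (f s) F \<partial>p)"
    using E by (intro nn_integral_mono_AE)
      (auto simp: AE_measure_pmf_iff measure_pmf.emeasure_eq_measure intro: ennreal_leI split: split_indicator)
  also have "\<dots> = ennreal (measure_pmf.prob (bind_pmf p f) F)"
    by (simp add: measure_pmf.emeasure_eq_measure[symmetric])
  finally have "(1 - \<epsilon>) * measure_pmf.prob p E \<le> measure_pmf.prob (bind_pmf p f) F" by simp
  moreover have "\<epsilon> * measure_pmf.prob p E \<le> \<epsilon> * 1" using eps by (intro mult_left_mono) auto
  ultimately show ?thesis by (simp add: algebra_simps)
next
  case False
  then show ?thesis using measure_pmf.prob_le_1[of p E] measure_nonneg[of "measure_pmf (bind_pmf p f)" F]
    by linarith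
qed

text \<open>Superposition: a union of independent sets avoids \<open>K\<close> iff both sets do, and
  the exponentials multiply.\<close>

lemma soup_add:
  fixes A :: "(int ^ 'd) set"
  assumes d: "CARD('d) \<ge> 3" and A: "finite A" and v: "v \<ge> 0" and w: "w \<ge> 0"
  shows "soup A (v + w) = bind_pmf (soup A v) (\<lambda>s. map_pmf (\<lambda>t. s \<union> t) (soup A w))"
proof (rule pmf_eqI_void[OF A set_soup])
  show "set_pmf (bind_pmf (soup A v) (\<lambda>s. map_pmf (\<lambda>t. s \<union> t) (soup A w))) \<subseteq> Pow A"
    using set_soup[of A v] set_soup[of A w] by auto
  fix K assume K: "K \<subseteq> A"
  let ?V = "{s. s \<inter> K = {}}"
  have "(\<lambda>t. s \<union> t) -` ?V = (if s \<in> ?V then ?V else {})" for s by auto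
  then have "emeasure (map_pmf (\<lambda>t. s \<union> t) (soup A w)) ?V = emeasure (soup A w) ?V * indicator ?V s" for s
    by simp
  then have "emeasure (bind_pmf (soup A v) (\<lambda>s. map_pmf (\<lambda>t. s \<union> t) (soup A w))) ?V =
      emeasure (soup A w) ?V * emeasure (soup A v) ?V"
    by (simp add: nn_integral_cmult_indicator del: emeasure_map_pmf)
  also have "\<dots> = ennreal (exp (- (v + w) * capacity K))"
    using v w by (simp add: measure_pmf.emeasure_eq_measure soup_void[OF d A K] ennreal_mult[symmetric]
        exp_add[symmetric] algebra_simps)
  finally show "measure_pmf.prob (soup A (v + w)) ?V =
      measure_pmf.prob (bind_pmf (soup A v) (\<lambda>s. map_pmf (\<lambda>t. s \<union> t) (soup A w))) ?V"
    using v w by (simp add: measure_pmf.emeasure_eq_measure soup_void[OF d A K])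
qed

section \<open>Climbing trajectories, and the passage from the interlacement to its finite-volume
  model\<close>

definition climb :: "'d \<Rightarrow> int \<Rightarrow> int \<Rightarrow> nat \<Rightarrow> (int ^ 'd) set \<Rightarrow> (int ^ 'd) set \<Rightarrow> (int ^ 'd) list \<Rightarrow> bool" where
  "climb k a b T \<gamma> s ys \<longleftrightarrow> ys \<noteq> [] \<and> hd ys \<in> \<gamma> \<and> set ys \<subseteq> s \<and> successively adj ys \<and> length ys \<le> Suc T
     \<and> (\<forall>y\<in>set ys. a \<le> y $ k) \<and> b \<le> last ys $ k"

text \<open>Walks from the equilibrium measure of \<open>A\<close> hit \<open>\<gamma>\<close> with
  total mass \<open>capacity \<gamma>\<close> and then climb with probability at least
  \<open>p\<close>, so the traces that contain a whole climb have mass at least the product. By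
  \<open>closed\<close> the restriction to \<open>A\<close> does not cut the climb into
  pieces.\<close>

lemma soup_climb:
  fixes A \<gamma> :: "(int ^ 'd) set"
  assumes d: "CARD('d) \<ge> 3" and A: "finite A" and \<gamma>: "\<gamma> \<subseteq> A" and v: "v \<ge> 0" and p: "p \<ge> 0"
    and reach: "\<And>y. y \<in> \<gamma> \<Longrightarrow> p \<le> measure (srw_law y) (reach k a b T)"
    and closed: "\<And>ys. climb k a b T \<gamma> UNIV ys \<Longrightarrow> set ys \<subseteq> A"
  shows "1 - exp (- v * (p * capacity \<gamma>)) \<le> measure_pmf.prob (soup A v) {s. \<exists>ys. climb k a b T \<gamma> s ys}"
proof -
  interpret prob_space "srw_law y" for y :: "int ^ 'd" by (rule prob_space_srw_law)
  let ?F = "{S. \<exists>m. S m \<in> \<gamma> \<and> (\<lambda>i. S (m + i)) \<in> reach k a b T}"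
  let ?G = "{s \<in> Pow A. \<exists>ys. climb k a b T \<gamma> s ys}"
  have sG: "{S. range S \<inter> A \<in> ?G} \<in> sets paths"
  proof -
    have "{S. range S \<inter> A \<in> ?G} = (\<Union>s\<in>?G. {S. range S \<inter> A = s})" by auto
    also have "\<dots> \<in> sets paths" using A by (intro sets.finite_UN sets_trace) auto
    finally show ?thesis .
  qed
  have sub: "?F \<subseteq> {S. range S \<inter> A \<in> ?G}"
  proof
    fix S assume "S \<in> ?F"
    then obtain m t where m: "S m \<in> \<gamma>" and t: "t \<le> T" "b \<le> S (m + t) $ k" "\<forall>i\<le>t. a \<le> S (m + i) $ k"
      "\<forall>i<t. adj (S (m + i)) (S (m + Suc i))" by (auto simp: reach_def)
    let ?ys = "map (\<lambda>i. S (m + i)) [0..<Suc t]"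
    have c: "climb k a b T \<gamma> UNIV ?ys"
      using m t by (auto simp: climb_def successively_conv_nth hd_map less_Suc_eq_le simp del: upt_Suc)
        (simp add: last_map)
    have "climb k a b T \<gamma> (range S \<inter> A) ?ys"
      using c closed[OF c] unfolding climb_def by auto
    then show "S \<in> {S. range S \<inter> A \<in> ?G}" by auto
  qed
  have "p * capacity \<gamma> = (\<Sum>x\<in>A. equilibrium A x * (p * hit 0 \<gamma> x))"
    unfolding sweeping[OF d A \<gamma>] sum_distrib_left by (simp add: mult_ac)
  also have "\<dots> \<le> (\<Sum>x\<in>A. equilibrium A x * measure (srw_law x) {S. range S \<inter> A \<in> ?G})"
  proof (intro sum_mono mult_left_mono equilibrium_nonneg)
    fix x
    have "p * hit 0 \<gamma> x \<le> measure (srw_law x) ?F"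
      by (intro srw_excursion_ge p reach sets_reach)
    also have "\<dots> \<le> measure (srw_law x) {S. range S \<inter> A \<in> ?G}"
      using sub sG by (intro finite_measure_mono) (auto simp: sets_srw_law)
    finally show "p * hit 0 \<gamma> x \<le> measure (srw_law x) {S. range S \<inter> A \<in> ?G}" .
  qed
  also have "\<dots> = (\<Sum>s\<in>?G. trace_mass A s)" by (rule sum_trace_mass[OF A, symmetric]) auto
  finally have mass: "p * capacity \<gamma> \<le> (\<Sum>s\<in>?G. trace_mass A s)" .
  let ?none = "{\<omega>. \<forall>s\<in>?G. \<not> \<omega> s}"
  have "1 - exp (- v * (p * capacity \<gamma>)) \<le> 1 - exp (- v * (\<Sum>s\<in>?G. trace_mass A s))"
    using v mass by (simp add: mult_left_mono)
  also have "\<dots> = 1 - measure_pmf.prob (trace_field A v) ?none"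
    by (subst trace_field_none[OF A _ v]) auto
  also have "\<dots> = measure_pmf.prob (trace_field A v) (- ?none)"
    by (subst measure_pmf.prob_compl[symmetric]) (auto simp: Compl_eq_Diff_UNIV)
  also have "\<dots> \<le> measure_pmf.prob (trace_field A v)
      ((\<lambda>\<omega>. \<Union>{s \<in> Pow A. \<omega> s}) -` {s. \<exists>ys. climb k a b T \<gamma> s ys})"
  proof (intro measure_pmf.finite_measure_mono subsetI)
    fix \<omega> assume "\<omega> \<in> - ?none"
    then obtain s ys where s: "s \<in> Pow A" "\<omega> s" and ys: "climb k a b T \<gamma> s ys" by auto
    have "climb k a b T \<gamma> (\<Union>{s \<in> Pow A. \<omega> s}) ys"
      using s ys unfolding climb_def by blast
    then show "\<omega> \<in> (\<lambda>\<omega>. \<Union>{s \<in> Pow A. \<omega> s}) -` {s. \<exists>ys. climb k a b T \<gamma> s ys}" by auto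
  qed simp
  finally show ?thesis by (simp add: soup_def)
qed

text \<open>Both laws live on the subsets of a finite set and have the same void probabilities. From
  here on the explicit model can stand in for the interlacement.\<close>

lemma interlacement_soup:
  fixes I :: "'w \<Rightarrow> (int ^ 'd) set"
  assumes d: "CARD('d) \<ge> 3" and I: "interlacement_set M I u" and u: "u \<ge> 0" and A: "finite A"
  shows "{w \<in> space M. I w \<inter> A \<in> F} \<in> sets M"
    and "measure M {w \<in> space M. I w \<inter> A \<in> F} = measure_pmf.prob (soup A u) F"
proof -
  interpret prob_space M using I by (simp add: interlacement_set_def)
  have [measurable]: "Measurable.pred M (\<lambda>w. x \<in> I w)" for x
    using I by (simp add: interlacement_set_def pred_def)
  have sets: "{w \<in> space M. I w \<inter> A = s} \<in> sets M" for s
  proof (cases "s \<subseteq> A")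
    case True
    then have "{w \<in> space M. I w \<inter> A = s} = {w \<in> space M. \<forall>y\<in>A. y \<in> I w \<longleftrightarrow> y \<in> s}" by auto
    also have "\<dots> \<in> sets M" using A by measurable
    finally show ?thesis .
  next
    case False
    then have empty: "{w \<in> space M. I w \<inter> A = s} = {}" by auto
    show ?thesis unfolding empty by simp
  qed
  have union: "{w \<in> space M. I w \<inter> A \<in> F} = (\<Union>s\<in>F \<inter> Pow A. {w \<in> space M. I w \<inter> A = s})" for F
    by auto
  have fin: "finite (F \<inter> Pow A)" for F using A by simp
  show "{w \<in> space M. I w \<inter> A \<in> F} \<in> sets M"
    unfolding union using sets fin by (intro sets.finite_UN) auto
  have sum: "prob {w \<in> space M. I w \<inter> A \<in> F} = (\<Sum>s\<in>F \<inter> Pow A. prob {w \<in> space M. I w \<inter> A = s})" for F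
    unfolding union using sets by (intro finite_measure_finite_Union fin) (auto simp: disjoint_family_on_def)
  have eq: "prob {w \<in> space M. I w \<inter> A = B} = pmf (soup A u) B" if "B \<subseteq> A" for B
  proof (rule sum_Pow_eqD[OF A _ that])
    fix B assume B: "B \<subseteq> A"
    then have "(\<Sum>s\<in>Pow B. prob {w \<in> space M. I w \<inter> A = s}) = prob {w \<in> space M. I w \<inter> A \<in> Pow B}"
      unfolding sum by (intro sum.cong) auto
    also have "{w \<in> space M. I w \<inter> A \<in> Pow B} = {w \<in> space M. A - B \<subseteq> - I w}" by auto
    also have "prob \<dots> = exp (- u * capacity (A - B))"
      using I A by (simp add: interlacement_set_def)
    also have "\<dots> = measure_pmf.prob (soup A u) {s. s \<inter> (A - B) = {}}"
      by (rule soup_void[OF d A _ u, symmetric]) auto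
    also have "\<dots> = measure_pmf.prob (soup A u) (Pow B)"
      using set_soup[of A u] B by (intro measure_prob_cong_0) (auto simp: set_pmf_eq)
    also have "\<dots> = (\<Sum>s\<in>Pow B. pmf (soup A u) s)"
      using A B by (intro measure_measure_pmf_finite) (auto intro: finite_subset)
    finally show "(\<Sum>s\<in>Pow B. prob {w \<in> space M. I w \<inter> A = s}) = (\<Sum>s\<in>Pow B. pmf (soup A u) s)" .
  qed
  have "prob {w \<in> space M. I w \<inter> A \<in> F} = (\<Sum>s\<in>F \<inter> Pow A. pmf (soup A u) s)"
    unfolding sum by (intro sum.cong) (auto simp: eq)
  also have "\<dots> = measure_pmf.prob (soup A u) (F \<inter> Pow A)"
    using A by (intro measure_measure_pmf_finite[symmetric]) auto
  also have "\<dots> = measure_pmf.prob (soup A u) F"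
    using set_soup[of A u] by (intro measure_prob_cong_0) (auto simp: set_pmf_eq)
  finally show "prob {w \<in> space M. I w \<inter> A \<in> F} = measure_pmf.prob (soup A u) F" .
qed

section \<open>Climbing paths\<close>

text \<open>An upper bound for the resistance of a path: an edge from x to y has resistance
  \<open>\<beta>\<close> to the power minus the larger of the two levels, at most the term of x.
  Summing over vertices makes concatenation additive.\<close>

definition cost :: "real \<Rightarrow> 'd \<Rightarrow> (int ^ 'd) list \<Rightarrow> real" where
  "cost \<beta> k xs = (\<Sum>y\<leftarrow>xs. \<beta> powi (- (y $ k)))"

text \<open>The length bound \<open>N\<close> confines the path to a box around \<open>x\<close>,
  where the finite-volume model is available; it is quantified away in the end.\<close>

definition cheap_path :: "real \<Rightarrow> 'd \<Rightarrow> int ^ 'd \<Rightarrow> real \<Rightarrow> int \<Rightarrow> nat \<Rightarrow> (int ^ 'd) set \<Rightarrow> bool" where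
  "cheap_path \<beta> k x c L N s \<longleftrightarrow> (\<exists>xs. xs \<noteq> [] \<and> hd xs = x \<and> set xs \<subseteq> s \<and> successively adj xs \<and>
     length xs \<le> N \<and> cost \<beta> k xs \<le> c \<and> L \<le> last xs $ k)"

lemma cost_append: "cost \<beta> k (xs @ ys) = cost \<beta> k xs + cost \<beta> k ys"
  by (simp add: cost_def)

lemma cost_nonneg: "\<beta> > 0 \<Longrightarrow> 0 \<le> cost \<beta> k xs"
  unfolding cost_def by (intro sum_list_nonneg) auto

lemma cost_le:
  assumes "\<beta> > 1" "\<forall>y\<in>set ys. a \<le> y $ k"
  shows "cost \<beta> k ys \<le> real (length ys) * \<beta> powi (- a)"
  using assms(2)
proof (induction ys)
  case (Cons y ys)
  then have "\<beta> powi (- (y $ k)) \<le> \<beta> powi (- a)" using assms(1) by (intro power_int_increasing) auto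
  with Cons show ?case by (simp add: cost_def algebra_simps)
qed (simp add: cost_def)

text \<open>Discrete intermediate value property, as levels change by at most 1 along an
  edge.\<close>

lemma path_level:
  assumes "successively adj xs" "xs \<noteq> []" "hd xs $ k \<le> l" "l \<le> last xs $ k"
  shows "\<exists>y\<in>set xs. y $ k = l"
  using assms
proof (induction xs rule: induct_list012)
  case (3 x y zs)
  show ?case
  proof (cases "x $ k = l")
    case False
    then have "y $ k \<le> l" using 3 adj_component[of x y k] by auto
    then show ?thesis using 3 by auto
  qed auto
qed auto

lemma path_dist:
  assumes "successively adj xs" "y \<in> set xs"
  shows "\<bar>y $ i - hd xs $ i\<bar> \<le> int (length xs)"
  using assms
proof (induction xs rule: induct_list012)
  case (3 x z zs)
  show ?case
  proof (cases "y = x")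
    case False
    then have "\<bar>y $ i - z $ i\<bar> \<le> int (length (z # zs))" using 3 by auto
    moreover have "\<bar>z $ i - x $ i\<bar> \<le> 1" using 3 by (intro adj_component) auto
    ultimately show ?thesis by simp
  qed simp
qed auto

definition lattice_box :: "int ^ 'd \<Rightarrow> nat \<Rightarrow> (int ^ 'd) set" where
  "lattice_box x R = {y. \<forall>i. \<bar>y $ i - x $ i\<bar> \<le> int R}"

lemma finite_lattice_box: "finite (lattice_box x R)"
proof -
  have "lattice_box x R \<subseteq> vec_lambda ` (PiE UNIV (\<lambda>i. {x $ i - int R .. x $ i + int R}))"
  proof
    fix y assume y: "y \<in> lattice_box x R"
    have "vec_nth y \<in> PiE UNIV (\<lambda>i. {x $ i - int R .. x $ i + int R})"
    proof (rule PiE_I)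
      fix i
      have "\<bar>y $ i - x $ i\<bar> \<le> int R" using y by (simp add: lattice_box_def)
      then show "y $ i \<in> {x $ i - int R .. x $ i + int R}" by auto
    qed auto
    then show "y \<in> vec_lambda ` (PiE UNIV (\<lambda>i. {x $ i - int R .. x $ i + int R}))"
      by (intro image_eqI[of _ _ "vec_nth y"]) auto
  qed
  then show ?thesis by (rule finite_subset) (auto intro!: finite_imageI finite_PiE)
qed

text \<open>From a level in [3q, 4q) the chance to reach 8q before falling below 2q is at least (q +
  1) / (6q + 1), hence 1/7. The expected exit time is at most 10 d q^2, so with 140 d q^2 steps at
  most 1/14 is lost to walks that are too slow.\<close>

lemma reach_ge:
  fixes y :: "int ^ 'd" and q :: int
  assumes y: "3 * q \<le> y $ k" "y $ k < 4 * q" and T: "T = nat (140 * int CARD('d) * q\<^sup>2)"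
  shows "1 / 14 \<le> measure (srw_law y) (reach k (2 * q) (8 * q) T)"
proof -
  define l where "l = y $ k"
  have l: "3 * q \<le> l" "l < 4 * q" and q: "q \<ge> 1" using y by (auto simp: l_def)
  let ?d = "real CARD('d)" and ?s = "measure (srw_law y) (stay k (2 * q) (8 * q) T)"
  have "1 / 7 \<le> real_of_int (l - 2 * q + 1) / real_of_int (8 * q - 2 * q + 1)"
    using l q by (simp add: le_divide_eq)
  also have "\<dots> \<le> measure (srw_law y) (reach k (2 * q) (8 * q) T) + ?s"
    unfolding l_def using l q by (intro reach_stay) (auto simp: l_def)
  finally have 1: "1 / 7 \<le> measure (srw_law y) (reach k (2 * q) (8 * q) T) + ?s" .
  have "real (Suc T) * ?s \<le> ?d * real_of_int (l - 2 * q + 1) * real_of_int (8 * q - l)"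
    unfolding l_def using l q by (intro stay_le) (auto simp: l_def)
  also have "\<dots> \<le> ?d * real_of_int (2 * q) * real_of_int (5 * q)"
    using l q by (intro mult_mono) auto
  also have "\<dots> = real T / 14" using T q by (simp add: power2_eq_square)
  also have "\<dots> \<le> real (Suc T) * (1 / 14)" by simp
  finally have "?s \<le> 1 / 14" by (simp only: mult_le_cancel_left_pos of_nat_0_less_iff zero_less_Suc)
  then show ?thesis using 1 by simp
qed

text \<open>The stage from level 4q to level 8q: \<open>s\<close> is already revealed,
  \<open>t\<close> is fresh. The old path crosses the q levels of [3q, 4q), and one of its points on
  each of them forms the target \<open>\<gamma>\<close> of \<open>soup_climb\<close>.\<close>

lemma cheap_path_step:
  fixes x :: "int ^ 'd" and q :: int and T :: nat
  assumes d: "CARD('d) \<ge> 3" and \<beta>: "\<beta> > 1" and c0: "c0 \<ge> 0"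
    "\<forall>(K :: (int ^ 'd) set) k l m. bij_betw (\<lambda>x. x $ k) K {l..<l + int m} \<longrightarrow> c0 * sqrt (real m) \<le> capacity K"
    and s: "cheap_path \<beta> k x c (4 * q) N s" and x: "x $ k \<le> 3 * q" and q: "q \<ge> 1"
    and T: "T = nat (140 * int CARD('d) * q\<^sup>2)" and v: "v \<ge> 0" and R: "N + Suc T \<le> R"
  shows "1 - exp (- v * (1 / 14 * (c0 * sqrt (real_of_int q)))) \<le> measure_pmf.prob (soup (lattice_box x R) v)
    {t. cheap_path \<beta> k x (c + real (Suc T) * \<beta> powi (- (2 * q))) (8 * q) (N + Suc T) (s \<union> t)}"
proof -
  obtain xs where xs: "xs \<noteq> []" "hd xs = x" "set xs \<subseteq> s" "successively adj xs"
     "length xs \<le> N" "cost \<beta> k xs \<le> c" "4 * q \<le> last xs $ k"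
    using s by (auto simp: cheap_path_def)
  have "\<forall>l\<in>{3 * q..<3 * q + int (nat q)}. \<exists>y. y \<in> set xs \<and> y $ k = l"
  proof
    fix l assume "l \<in> {3 * q..<3 * q + int (nat q)}"
    then show "\<exists>y. y \<in> set xs \<and> y $ k = l"
      using path_level[of xs k l] xs x q by auto
  qed
  then obtain Y where Y: "\<And>l. l \<in> {3 * q..<3 * q + int (nat q)} \<Longrightarrow> Y l \<in> set xs \<and> Y l $ k = l"
    by metis
  define \<gamma> where "\<gamma> = Y ` {3 * q..<3 * q + int (nat q)}"
  have bij: "bij_betw (\<lambda>x. x $ k) \<gamma> {3 * q..<3 * q + int (nat q)}"
    unfolding \<gamma>_def using Y by (auto intro!: bij_betwI[of _ _ _ Y])
  have \<gamma>_xs: "\<gamma> \<subseteq> set xs" using Y by (auto simp: \<gamma>_def)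
  have \<gamma>_box: "\<bar>y $ i - x $ i\<bar> \<le> int N" if "y \<in> \<gamma>" for y i
    using path_dist[OF xs(4), of y i] \<gamma>_xs that xs by auto
  have closed: "set ys \<subseteq> lattice_box x R" if ys: "climb k (2 * q) (8 * q) T \<gamma> UNIV ys" for ys
  proof
    fix z assume z: "z \<in> set ys"
    have "\<bar>z $ i - x $ i\<bar> \<le> int R" for i
      using path_dist[OF _ z, of i] \<gamma>_box[of "hd ys" i] ys R by (auto simp: climb_def)
    then show "z \<in> lattice_box x R" by (simp add: lattice_box_def)
  qed
  have "1 - exp (- v * (1 / 14 * (c0 * sqrt (real_of_int q)))) \<le> 1 - exp (- v * (1 / 14 * capacity \<gamma>))"
    using v q c0(2)[rule_format, OF bij] by (simp add: mult_left_mono)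
  also have "\<dots> \<le> measure_pmf.prob (soup (lattice_box x R) v) {t. \<exists>ys. climb k (2 * q) (8 * q) T \<gamma> t ys}"
  proof (rule soup_climb[OF d finite_lattice_box _ v _ _ closed])
    show "\<gamma> \<subseteq> lattice_box x R"
    proof
      fix y assume "y \<in> \<gamma>"
      then have "\<bar>y $ i - x $ i\<bar> \<le> int R" for i using \<gamma>_box[of y i] R by simp
      then show "y \<in> lattice_box x R" by (simp add: lattice_box_def)
    qed
    fix y assume "y \<in> \<gamma>"
    then have "3 * q \<le> y $ k" "y $ k < 4 * q" using bij_betwE[OF bij] q by auto
    then show "1 / 14 \<le> measure (srw_law y) (reach k (2 * q) (8 * q) T)" by (rule reach_ge[OF _ _ T])
  qed auto
  also have "\<dots> \<le> measure_pmf.prob (soup (lattice_box x R) v)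
    {t. cheap_path \<beta> k x (c + real (Suc T) * \<beta> powi (- (2 * q))) (8 * q) (N + Suc T) (s \<union> t)}"
  proof (intro measure_pmf.finite_measure_mono subsetI CollectI)
    fix t assume "t \<in> {t. \<exists>ys. climb k (2 * q) (8 * q) T \<gamma> t ys}"
    then obtain ys where ys: "ys \<noteq> []" "hd ys \<in> \<gamma>" "set ys \<subseteq> t" "successively adj ys" "length ys \<le> Suc T"
      "\<forall>y\<in>set ys. 2 * q \<le> y $ k" "8 * q \<le> last ys $ k" by (auto simp: climb_def)
    \<comment> \<open>The old path is followed up to the start of the climb and its remainder is
      discarded.\<close>
    obtain pre post where split: "xs = pre @ hd ys # post"
      using ys(2) \<gamma>_xs by (meson split_list subsetD)
    have "cost \<beta> k (pre @ ys) \<le> cost \<beta> k xs + cost \<beta> k ys"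
      unfolding split cost_append using cost_nonneg[of \<beta> k "hd ys # post"] \<beta> by simp
    also have "\<dots> \<le> c + real (Suc T) * \<beta> powi (- (2 * q))"
      using cost_le[OF \<beta> ys(6)] xs(6) ys(5) \<beta>
      by (intro add_mono order_trans[OF cost_le[OF \<beta> ys(6)]] mult_right_mono) auto
    finally have "cost \<beta> k (pre @ ys) \<le> c + real (Suc T) * \<beta> powi (- (2 * q))" .
    moreover have "hd (pre @ ys) = x" using xs(2) split ys(1) by (cases pre) auto
    moreover have "successively adj (pre @ ys)"
      using xs(4) ys(4) unfolding split by (auto simp: successively_append_iff successively_Cons)
    moreover have "length (pre @ ys) \<le> N + Suc T" using xs(5) ys(5) split by simp
    moreover have "set (pre @ ys) \<subseteq> s \<union> t" using xs(3) ys(3) split by auto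
    ultimately show "cheap_path \<beta> k x (c + real (Suc T) * \<beta> powi (- (2 * q))) (8 * q) (N + Suc T) (s \<union> t)"
      unfolding cheap_path_def using ys(1,7) by (intro exI[of _ "pre @ ys"]) auto
  qed simp
  finally show ?thesis .
qed

text \<open>One coordinate of the walk is recurrent: with the lower barrier far enough down and then
  enough time, ruin and delay each cost at most \<open>\<eta> / 2\<close>.\<close>

lemma reach_all:
  fixes x :: "int ^ 'd"
  assumes \<eta>: "\<eta> > 0"
  obtains a T where "1 - \<eta> \<le> measure (srw_law x) (reach k a b T)"
proof -
  \<comment> \<open>The ruin estimates require a start at or below the upper barrier.\<close>
  define b' where "b' = max b (x $ k)"
  define n where "n = real_of_int (b' - x $ k)"
  have n: "n \<ge> 0" by (simp add: n_def b'_def)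
  obtain m :: nat where m: "n * 2 / \<eta> < real m" using reals_Archimedean2 by blast
  define a where "a = x $ k - int m"
  obtain T :: nat where T: "real CARD('d) * real (m + 1) * n * 2 / \<eta> < real T" using reals_Archimedean2 by blast
  let ?s = "measure (srw_law x) (stay k a b' T)" and ?r = "measure (srw_law x) (reach k a b' T)"
  have ab: "a \<le> b'" "a - 1 \<le> x $ k" "x $ k \<le> b'" by (auto simp: a_def b'_def)
  have e: "real_of_int (x $ k - a + 1) = real (m + 1)" "real_of_int (b' - a + 1) = n + real (m + 1)"
    by (simp_all add: a_def n_def)
  have "1 - \<eta> / 2 \<le> real (m + 1) / (n + real (m + 1))"
  proof -
    have "n * 2 \<le> \<eta> * (n + real (m + 1))"
    proof -
      have "n * 2 \<le> \<eta> * real m" using m \<eta> by (simp add: divide_less_eq mult.commute)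
      also have "\<dots> \<le> \<eta> * (n + real (m + 1))" using n \<eta> by (intro mult_left_mono) auto
      finally show ?thesis .
    qed
    then show ?thesis using n by (simp add: field_simps)
  qed
  also have "\<dots> \<le> ?r + ?s" using reach_stay[OF ab, of T] by (simp only: e)
  finally have 1: "1 - \<eta> / 2 \<le> ?r + ?s" .
  have "real (Suc T) * ?s \<le> real CARD('d) * real (m + 1) * n"
    using stay_le[OF ab, of T] by (simp only: e n_def)
  also have "\<dots> \<le> real (Suc T) * (\<eta> / 2)" using T \<eta> by (simp add: field_simps)
  finally have "?s \<le> \<eta> / 2" by (simp only: mult_le_cancel_left_pos of_nat_0_less_iff zero_less_Suc)
  then have "1 - \<eta> \<le> ?r" using 1 by simp
  also have "?r \<le> measure (srw_law x) (reach k a b T)"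
  proof -
    interpret prob_space "srw_law x" by (rule prob_space_srw_law)
    show ?thesis
      by (intro finite_measure_mono) (auto simp: sets_srw_law sets_reach, auto simp: reach_def b'_def)
  qed
  finally show ?thesis by (rule that)
qed

lemma geometric_part_le:
  fixes r :: real
  assumes "0 \<le> r" "r < 1" "j0 \<le> j"
  shows "(\<Sum>i\<in>{j0..<j}. r ^ i) \<le> r ^ j0 / (1 - r)"
proof -
  have "(\<Sum>i\<in>{j0..<j}. r ^ i) * (1 - r) = r ^ j0 - r ^ j"
    using assms(3)
  proof (induction j rule: dec_induct)
    case (step n)
    have "(\<Sum>i\<in>{j0..<Suc n}. r ^ i) * (1 - r) = (\<Sum>i\<in>{j0..<n}. r ^ i) * (1 - r) + r ^ n * (1 - r)"
      using step.hyps by (simp add: distrib_right)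
    also have "\<dots> = r ^ j0 - r ^ Suc n" unfolding step.IH by (simp add: algebra_simps)
    finally show ?case .
  qed simp
  also have "\<dots> \<le> r ^ j0" using assms by simp
  finally show ?thesis using assms by (simp add: le_divide_eq)
qed

lemma exp_minus_le_inverse:
  assumes "0 < z" "z \<le> (y :: real)" shows "exp (- y) \<le> 1 / z"
proof -
  have "z \<le> exp y" using assms exp_ge_add_one_self[of y] by linarith
  then show ?thesis using assms by (simp add: exp_minus field_simps)
qed

text \<open>With q = 2^i, \<open>\<beta>\<close> to the power q is the fourth power of exp (q ln
  \<open>\<beta>\<close> / 4), hence at least (q ln \<open>\<beta>\<close> / 4)^4. A factor q^2 pays
  for the number of steps, and q^(-2) = (1/4)^i remains.\<close>

lemma step_cost_le:
  fixes d :: nat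
  assumes \<beta>: "\<beta> > 1" and d: "d \<ge> 1" and T: "T = nat (140 * int d * (2 ^ i)\<^sup>2)"
  shows "real (Suc T) * \<beta> powi (- (2 * 2 ^ i)) \<le> 141 * real d * (4 / ln \<beta>) ^ 4 * (1 / 4) ^ i"
proof -
  define n :: real where "n = 2 ^ i"
  have n: "n \<ge> 1" and l: "ln \<beta> > 0" using \<beta> by (auto simp: n_def)
  have "real T = 140 * real d * n\<^sup>2" using T by (simp add: n_def)
  moreover have "1 * 1 \<le> real d * n\<^sup>2" using n d by (intro mult_mono) auto
  ultimately have T': "real (Suc T) \<le> 141 * real d * n\<^sup>2" by simp
  have "n * ln \<beta> / 4 \<le> exp (n * ln \<beta> / 4)" using exp_ge_add_one_self[of "n * ln \<beta> / 4"] by linarith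
  then have "(n * ln \<beta> / 4) ^ 4 \<le> exp (n * ln \<beta> / 4) ^ 4" using n l by (intro power_mono) auto
  also have "\<dots> = exp (real 4 * (n * ln \<beta> / 4))" by (rule exp_of_nat_mult[symmetric])
  also have "\<dots> = \<beta> ^ (2 ^ i)" using \<beta> exp_of_nat_mult[of "2 ^ i" "ln \<beta>"] by (simp add: n_def)
  also have "\<dots> \<le> \<beta> ^ (2 * 2 ^ i)" using \<beta> by (intro power_increasing) auto
  also have "\<beta> ^ (2 * 2 ^ i) = \<beta> powi (2 * 2 ^ i)" by (simp add: power_int_def nat_mult_distrib nat_power_eq)
  finally have "(n * ln \<beta> / 4) ^ 4 \<le> \<beta> powi (2 * 2 ^ i)" .
  moreover have "0 < (n * ln \<beta> / 4) ^ 4" using n l by simp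
  ultimately have "\<beta> powi (- (2 * 2 ^ i)) \<le> 1 / (n * ln \<beta> / 4) ^ 4"
    unfolding power_int_minus_divide using \<beta> by (intro divide_left_mono mult_pos_pos) auto
  also have "\<dots> = (4 / ln \<beta>) ^ 4 / n ^ 4" by (simp add: power_divide power_mult_distrib)
  finally have "real (Suc T) * \<beta> powi (- (2 * 2 ^ i)) \<le> (141 * real d * n\<^sup>2) * ((4 / ln \<beta>) ^ 4 / n ^ 4)"
    using T' \<beta> by (intro mult_mono) auto
  also have "\<dots> = 141 * real d * (4 / ln \<beta>) ^ 4 * (1 / n\<^sup>2)"
    using n by (simp add: field_simps power2_eq_square power4_eq_xxxx)
  also have "1 / n\<^sup>2 = (1 / 4) ^ i" by (simp add: n_def power_divide power_mult[symmetric] mult.commute[of i] power_mult)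
  finally show ?thesis .
qed

lemma cheap_path_mono:
  assumes "cheap_path \<beta> k x c L N s" "c \<le> c'" "L' \<le> L"
  shows "cheap_path \<beta> k x c' L' N s"
proof -
  obtain xs where "xs \<noteq> []" "hd xs = x" "set xs \<subseteq> s" "successively adj xs" "length xs \<le> N"
    "cost \<beta> k xs \<le> c" "L \<le> last xs $ k"
    using assms(1) by (auto simp: cheap_path_def)
  then show ?thesis using assms(2,3) unfolding cheap_path_def by (intro exI[of _ xs]) auto
qed

lemma cheap_path_subset: "cheap_path \<beta> k x c L N s \<Longrightarrow> s \<subseteq> t \<Longrightarrow> cheap_path \<beta> k x c L N t"
  unfolding cheap_path_def by blast

text \<open>Sprinkling: stage i adds an independent set of level \<open>v i\<close>, and failure
  probabilities and costs add up to geometric sums. The radius \<open>R\<close> is fixed at the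
  outset and covers all stages, since superposition is a statement within one box.\<close>

lemma cheap_path_chain:
  fixes x :: "int ^ 'd"
  assumes d: "CARD('d) \<ge> 3" and \<beta>: "\<beta> > 1" and c0: "c0 > 0"
    "\<forall>(K :: (int ^ 'd) set) k l m. bij_betw (\<lambda>x. x $ k) K {l..<l + int m} \<longrightarrow> c0 * sqrt (real m) \<le> capacity K"
    and x: "x $ k \<le> 3 * 2 ^ j0" and \<delta>: "\<delta> > 0" and v0: "v0 \<ge> 0" and j: "j0 \<le> j"
  defines "K \<equiv> 141 * real CARD('d) * (4 / ln \<beta>) ^ 4"
  defines "T \<equiv> \<lambda>i :: nat. nat (140 * int CARD('d) * (2 ^ i)\<^sup>2)"
  defines "v \<equiv> \<lambda>i. \<delta> * (9 / 10) ^ i / 10"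
  assumes R: "N + (\<Sum>i\<in>{j0..<j}. Suc (T i)) \<le> R"
  shows "measure_pmf.prob (soup (lattice_box x R) v0) {s. cheap_path \<beta> k x c (4 * 2 ^ j0) N s}
      - (\<Sum>i\<in>{j0..<j}. 140 / (\<delta> * c0) * (8 / 9) ^ i) \<le>
    measure_pmf.prob (soup (lattice_box x R) (v0 + (\<Sum>i\<in>{j0..<j}. v i)))
      {s. cheap_path \<beta> k x (c + (\<Sum>i\<in>{j0..<j}. K * (1 / 4) ^ i)) (4 * 2 ^ j) (N + (\<Sum>i\<in>{j0..<j}. Suc (T i))) s}"
  using j R
proof (induction j rule: dec_induct)
  case (step j)
  let ?A = "lattice_box x R" and ?V = "v0 + (\<Sum>i\<in>{j0..<j}. v i)" and ?\<epsilon> = "140 / (\<delta> * c0) * (8 / 9) ^ j"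
  let ?N = "N + (\<Sum>i\<in>{j0..<j}. Suc (T i))" and ?c = "c + (\<Sum>i\<in>{j0..<j}. K * (1 / 4) ^ i)"
  let ?E = "{s. cheap_path \<beta> k x ?c (4 * 2 ^ j) ?N s}"
  let ?F = "{s. cheap_path \<beta> k x (?c + K * (1 / 4) ^ j) (4 * 2 ^ Suc j) (?N + Suc (T j)) s}"
  have vj: "v i \<ge> 0" for i using \<delta> by (simp add: v_def)
  have V: "?V \<ge> 0" using v0 vj by (simp add: sum_nonneg)
  have R': "?N + Suc (T j) \<le> R" using step.prems step.hyps by simp
  have \<epsilon>: "exp (- v j * (1 / 14 * (c0 * sqrt (real_of_int (2 ^ j))))) \<le> ?\<epsilon>"
  proof -
    define z where "z = \<delta> * c0 / 140 * (9 / 8) ^ j"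
    have z: "z > 0" using \<delta> c0 by (simp add: z_def)
    \<comment> \<open>As (9/10) * (5/4) = 9/8, the exponent grows at least like (9/8)^j; bounding
      exp (- y) by 1 / z for z \<le> y gives the ratio 8/9. The constant 140 is 10 * 14.\<close>
    have "(5 / 4 :: real) ^ j \<le> sqrt (2 ^ j)"
    proof (rule real_le_rsqrt)
      have "((5 / 4 :: real) ^ j)\<^sup>2 = (25 / 16) ^ j"
        unfolding power_mult[symmetric] mult.commute[of j] by (simp add: power_mult power2_eq_square)
      also have "\<dots> \<le> 2 ^ j" by (intro power_mono) auto
      finally show "((5 / 4 :: real) ^ j)\<^sup>2 \<le> 2 ^ j" .
    qed
    then have "v j * (1 / 14 * (c0 * (5 / 4) ^ j)) \<le> v j * (1 / 14 * (c0 * sqrt (2 ^ j)))"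
      using vj c0 by (intro mult_left_mono) auto
    moreover have "z = v j * (1 / 14 * (c0 * (5 / 4) ^ j))"
      using power_mult_distrib[of "9 / 10 :: real" "5 / 4" j] by (simp add: z_def v_def)
    ultimately have "exp (- (v j * (1 / 14 * (c0 * sqrt (2 ^ j))))) \<le> 1 / z"
      using z by (intro exp_minus_le_inverse) auto
    also have "1 / z = ?\<epsilon>" using \<delta> c0 by (simp add: z_def power_divide)
    finally show ?thesis by simp
  qed
  have "1 - ?\<epsilon> \<le> measure_pmf.prob (map_pmf (\<lambda>t. s \<union> t) (soup ?A (v j))) ?F" if "s \<in> ?E" for s
  proof -
    have "1 - ?\<epsilon> \<le> 1 - exp (- v j * (1 / 14 * (c0 * sqrt (real_of_int (2 ^ j)))))" using \<epsilon> by simp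
    also have "\<dots> \<le> measure_pmf.prob (soup ?A (v j))
        {t. cheap_path \<beta> k x (?c + real (Suc (T j)) * \<beta> powi (- (2 * 2 ^ j))) (8 * 2 ^ j) (?N + Suc (T j)) (s \<union> t)}"
    proof (rule cheap_path_step[OF d \<beta> _ c0(2) _ _ _ T_def[THEN meta_eq_to_obj_eq, THEN fun_cong] vj R'])
      have "(2 :: int) ^ j0 \<le> 2 ^ j" using step.hyps by (intro power_increasing) auto
      then show "x $ k \<le> 3 * 2 ^ j" using x by linarith
    qed (use that c0 in auto)
    also have "\<dots> \<le> measure_pmf.prob (soup ?A (v j)) ((\<lambda>t. s \<union> t) -` ?F)"
      using step_cost_le[OF \<beta> _ T_def[THEN meta_eq_to_obj_eq, THEN fun_cong], of j] d
      by (intro measure_pmf.finite_measure_mono) (auto elim!: cheap_path_mono simp: K_def)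
    finally show ?thesis by simp
  qed
  then have "measure_pmf.prob (soup ?A ?V) ?E - ?\<epsilon> \<le>
      measure_pmf.prob (bind_pmf (soup ?A ?V) (\<lambda>s. map_pmf (\<lambda>t. s \<union> t) (soup ?A (v j)))) ?F"
    using \<delta> c0 by (intro prob_bind_ge) auto
  also have "bind_pmf (soup ?A ?V) (\<lambda>s. map_pmf (\<lambda>t. s \<union> t) (soup ?A (v j))) = soup ?A (?V + v j)"
    by (rule soup_add[OF d finite_lattice_box V vj, symmetric])
  finally have "measure_pmf.prob (soup ?A ?V) ?E - ?\<epsilon> \<le> measure_pmf.prob (soup ?A (?V + v j)) ?F" .
  with step.IH R' step.hyps show ?case by (simp add: add.assoc)
qed (auto simp: add.assoc)

section \<open>From finitely many stages to an almost sure statement\<close>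

lemma exp_diff_le:
  assumes "0 \<le> a" "a \<le> (b :: real)" shows "exp (- a) - exp (- b) \<le> b - a"
proof -
  have "exp (- a) - exp (- b) = exp (- a) * (1 - exp (- (b - a)))"
    by (simp add: right_diff_distrib mult_exp_exp)
  also have "\<dots> \<le> 1 * (b - a)"
  proof (intro mult_mono)
    show "1 - exp (- (b - a)) \<le> b - a" using exp_ge_add_one_self[of "- (b - a)"] by linarith
  qed (use assms in auto)
  finally show ?thesis by simp
qed

lemma capacity_singleton_le: "capacity {x} \<le> 1"
  by (simp add: capacity_def equilibrium_le_1)

text \<open>Once \<open>N\<close> is quantified away, the event is a countable union over finite
  lists of lattice points.\<close>

lemma sets_cheap_path:
  fixes I :: "'w \<Rightarrow> (int ^ 'd) set"
  assumes I: "interlacement_set M I u"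
  shows "{w \<in> space M. \<exists>N. cheap_path \<beta> k x c L N (I w)} \<in> sets M"
proof -
  have [measurable]: "Measurable.pred M (\<lambda>w. y \<in> I w)" for y
    using I by (simp add: interlacement_set_def pred_def)
  let ?X = "{xs. xs \<noteq> [] \<and> hd xs = x \<and> successively adj xs \<and> cost \<beta> k xs \<le> c \<and> L \<le> last xs $ k}"
  have "{w \<in> space M. \<exists>N. cheap_path \<beta> k x c L N (I w)} = (\<Union>xs\<in>?X. {w \<in> space M. \<forall>y\<in>set xs. y \<in> I w})"
  proof (intro set_eqI iffI)
    fix w assume "w \<in> {w \<in> space M. \<exists>N. cheap_path \<beta> k x c L N (I w)}"
    then obtain xs where "xs \<in> ?X" "w \<in> space M" "\<forall>y\<in>set xs. y \<in> I w"
      by (auto simp: cheap_path_def subset_iff)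
    then show "w \<in> (\<Union>xs\<in>?X. {w \<in> space M. \<forall>y\<in>set xs. y \<in> I w})" by blast
  next
    fix w assume "w \<in> (\<Union>xs\<in>?X. {w \<in> space M. \<forall>y\<in>set xs. y \<in> I w})"
    then obtain xs where "xs \<in> ?X" "w \<in> space M" "\<forall>y\<in>set xs. y \<in> I w" by blast
    then show "w \<in> {w \<in> space M. \<exists>N. cheap_path \<beta> k x c L N (I w)}"
      unfolding cheap_path_def by (auto intro!: exI[of _ "length xs"] exI[of _ xs])
  qed
  also have "\<dots> \<in> sets M" by (rule sets.countable_UN') auto
  finally show ?thesis .
qed

text \<open>The path exists only if x \<in> I, so the failure probability is the difference of two
  probabilities. It is split into three losses of \<open>\<epsilon> / 3\<close>: the intensity
  reserved for the later stages (\<open>\<delta>\<close>), the first climb from \<open>x\<close>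
  (\<open>\<eta>\<close>), and the failure of a later stage (\<open>E\<close>).\<close>

lemma not_prog_le:
  fixes I :: "'w \<Rightarrow> (int ^ 'd) set"
  assumes d: "CARD('d) \<ge> 3" and u: "u > 0" and \<beta>: "\<beta> > 1" and I: "interlacement_set M I u"
    and \<epsilon>: "\<epsilon> > 0"
  obtains C where "\<And>L. measure M {w \<in> space M. x \<in> I w \<and> \<not> (\<exists>N. cheap_path \<beta> k x C L N (I w))} \<le> \<epsilon>"
proof -
  interpret prob_space M using I by (simp add: interlacement_set_def)
  obtain c0 :: real where c0: "c0 > 0"
    "\<forall>(K :: (int ^ 'd) set) k l m. bij_betw (\<lambda>x. x $ k) K {l..<l + int m} \<longrightarrow> c0 * sqrt (real m) \<le> capacity K"
    using capacity_levels[OF d] by metis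
  define \<delta> where "\<delta> = min u (\<epsilon> / 3)"
  define \<eta> where "\<eta> = \<epsilon> / (3 * u)"
  have \<delta>: "\<delta> > 0" "\<delta> \<le> u" "\<delta> \<le> \<epsilon> / 3" and \<eta>: "\<eta> > 0" "u * \<eta> = \<epsilon> / 3"
    using u \<epsilon> by (auto simp: \<delta>_def \<eta>_def)
  define E where "E = 140 / (\<delta> * c0) * 9"
  have E: "E > 0" using \<delta> c0 by (simp add: E_def)
  have "(\<lambda>j. E * (8 / 9) ^ j) \<longlonglongrightarrow> E * 0" by (intro tendsto_intros LIMSEQ_power_zero) auto
  then have "\<forall>\<^sub>F j in sequentially. E * (8 / 9) ^ j < \<epsilon> / 3"
    using \<epsilon> by (intro order_tendstoD) auto
  then obtain j1 where j1: "\<And>j. j \<ge> j1 \<Longrightarrow> E * (8 / 9) ^ j < \<epsilon> / 3"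
    by (auto simp: eventually_sequentially)
  \<comment> \<open>Late enough that all later stages together fail with probability at most
    \<open>\<epsilon> / 3\<close>, and that \<open>x\<close> lies below the levels used by the first
    of them.\<close>
  define j0 where "j0 = max j1 (nat (x $ k))"
  have Ej0: "E * (8 / 9) ^ j0 \<le> \<epsilon> / 3" using j1[of j0] by (simp add: j0_def)
  have "x $ k \<le> int (nat (x $ k))" by simp
  also have "\<dots> \<le> int (2 ^ j0)" unfolding of_nat_le_iff
    by (rule order_trans[OF _ less_imp_le[OF less_exp]]) (simp add: j0_def)
  finally have "x $ k \<le> 2 ^ j0" by simp
  moreover have "(0 :: int) \<le> 2 ^ j0" by simp
  ultimately have x: "x $ k \<le> 3 * 2 ^ j0" by linarith
  obtain a T0 where reach: "1 - \<eta> \<le> measure (srw_law x) (reach k a (4 * 2 ^ j0) T0)"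
    using reach_all[OF \<eta>(1)] by blast
  define p where "p = measure (srw_law x) (reach k a (4 * 2 ^ j0) T0)"
  have p: "p \<ge> 0" "p \<le> 1" "1 - \<eta> \<le> p"
    using reach prob_space.prob_le_1[OF prob_space_srw_law] by (auto simp: p_def)
  define c where "c = real (Suc T0) * \<beta> powi (- a)"
  define K where "K = 141 * real CARD('d) * (4 / ln \<beta>) ^ 4"
  have K: "K \<ge> 0" using \<beta> by (simp add: K_def)
  define T where "T i = nat (140 * int CARD('d) * (2 ^ i)\<^sup>2)" for i :: nat
  define v where "v i = \<delta> * (9 / 10) ^ i / 10" for i :: nat
  define C where "C = c + 2 * K"
  let ?\<kappa> = "capacity {x}"
  have main: "measure M {w \<in> space M. x \<in> I w \<and> \<not> (\<exists>N. cheap_path \<beta> k x C (4 * 2 ^ j) N (I w))} \<le> \<epsilon>"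
    if j: "j0 \<le> j" for j
  proof -
    define N where "N = Suc T0 + (\<Sum>i\<in>{j0..<j}. Suc (T i))"
    have T0_le: "Suc T0 \<le> N" by (simp add: N_def)
    let ?A = "lattice_box x N"
    \<comment> \<open>The level left for the first climb, so that the levels of all stages add up to
      exactly u.\<close>
    define v0 where "v0 = u - (\<Sum>i\<in>{j0..<j}. v i)"
    have "(\<Sum>i\<in>{j0..<j}. v i) = \<delta> / 10 * (\<Sum>i\<in>{j0..<j}. (9 / 10) ^ i)"
      by (simp add: v_def sum_distrib_left)
    also have "\<dots> \<le> \<delta> / 10 * ((9 / 10) ^ j0 / (1 - 9 / 10))"
      using \<delta> j by (intro mult_left_mono geometric_part_le) auto
    also have "\<dots> = \<delta> * (9 / 10) ^ j0" by simp
    also have "\<dots> \<le> \<delta> * 1" using \<delta> by (intro mult_left_mono power_le_one) auto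
    finally have v0: "u - \<delta> \<le> v0" by (simp add: v0_def)
    have v0_le: "v0 \<le> u" using \<delta> by (simp add: v0_def v_def sum_nonneg)
    have v0_ge: "v0 \<ge> 0" using v0 \<delta> by simp
    let ?G = "{s. cheap_path \<beta> k x C (4 * 2 ^ j) N s}"
    \<comment> \<open>With the target set {x} the first climb starts at \<open>x\<close> itself, and
      its capacity is the one that governs the probability of x \<in> I.\<close>
    have "1 - exp (- v0 * (p * ?\<kappa>)) \<le> measure_pmf.prob (soup ?A v0) {s. \<exists>ys. climb k a (4 * 2 ^ j0) T0 {x} s ys}"
    proof (rule soup_climb[OF d finite_lattice_box _ v0_ge p(1)])
      show "{x} \<subseteq> ?A" by (simp add: lattice_box_def)
      fix ys assume ys: "climb k a (4 * 2 ^ j0) T0 {x} UNIV ys"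
      show "set ys \<subseteq> ?A"
      proof
        fix z assume "z \<in> set ys"
        then have "\<bar>z $ i - x $ i\<bar> \<le> int N" for i
          using path_dist[of ys z i] ys T0_le by (auto simp: climb_def)
        then show "z \<in> ?A" by (simp add: lattice_box_def)
      qed
    qed (auto simp: p_def)
    also have "\<dots> \<le> measure_pmf.prob (soup ?A v0) {s. cheap_path \<beta> k x c (4 * 2 ^ j0) (Suc T0) s}"
    proof (intro measure_pmf.finite_measure_mono subsetI CollectI)
      fix s assume "s \<in> {s. \<exists>ys. climb k a (4 * 2 ^ j0) T0 {x} s ys}"
      then obtain ys where ys: "climb k a (4 * 2 ^ j0) T0 {x} s ys" by auto
      then have "cost \<beta> k ys \<le> real (length ys) * \<beta> powi (- a)"
        by (intro cost_le \<beta>) (auto simp: climb_def)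
      also have "\<dots> \<le> c" unfolding c_def using ys \<beta> by (intro mult_right_mono) (auto simp: climb_def)
      finally show "cheap_path \<beta> k x c (4 * 2 ^ j0) (Suc T0) s"
        using ys unfolding cheap_path_def climb_def by (intro exI[of _ ys]) auto
    qed simp
    also have "\<dots> \<le> (\<Sum>i\<in>{j0..<j}. 140 / (\<delta> * c0) * (8 / 9) ^ i) +
        measure_pmf.prob (soup ?A (v0 + (\<Sum>i\<in>{j0..<j}. v i)))
      {s. cheap_path \<beta> k x (c + (\<Sum>i\<in>{j0..<j}. K * (1 / 4) ^ i)) (4 * 2 ^ j) N s}"
      using cheap_path_chain[OF d \<beta> c0 x \<delta>(1) v0_ge j, where N = "Suc T0" and R = N and c = c]
      by (simp add: N_def K_def T_def v_def)
    also have "(\<Sum>i\<in>{j0..<j}. 140 / (\<delta> * c0) * (8 / 9) ^ i) \<le> \<epsilon> / 3"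
    proof -
      have "(\<Sum>i\<in>{j0..<j}. 140 / (\<delta> * c0) * (8 / 9) ^ i) \<le> 140 / (\<delta> * c0) * ((8 / 9) ^ j0 / (1 - 8 / 9))"
        unfolding sum_distrib_left[symmetric] using \<delta> c0 j by (intro mult_left_mono geometric_part_le) auto
      also have "\<dots> = E * (8 / 9) ^ j0" by (simp add: E_def)
      finally show ?thesis using Ej0 by simp
    qed
    also have "v0 + (\<Sum>i\<in>{j0..<j}. v i) = u" by (simp add: v0_def)
    also have "measure_pmf.prob (soup ?A u)
        {s. cheap_path \<beta> k x (c + (\<Sum>i\<in>{j0..<j}. K * (1 / 4) ^ i)) (4 * 2 ^ j) N s} \<le> measure_pmf.prob (soup ?A u) ?G"
    proof -
      have "(\<Sum>i\<in>{j0..<j}. K * (1 / 4) ^ i) \<le> K * ((1 / 4) ^ j0 / (1 - 1 / 4))"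
        unfolding sum_distrib_left[symmetric] using K j by (intro mult_left_mono geometric_part_le) auto
      also have "\<dots> \<le> K * 2"
        using K power_le_one[of "1 / 4 :: real" j0] by (intro mult_left_mono) auto
      finally show ?thesis
        by (intro measure_pmf.finite_measure_mono) (auto elim!: cheap_path_mono simp: C_def)
    qed
    also have "measure_pmf.prob (soup ?A u) ?G = prob {w \<in> space M. I w \<inter> ?A \<in> ?G}"
      using u by (intro interlacement_soup(2)[OF d I _ finite_lattice_box, symmetric]) simp
    also have "\<dots> \<le> prob {w \<in> space M. \<exists>N. cheap_path \<beta> k x C (4 * 2 ^ j) N (I w)}"
      using sets_cheap_path[OF I, of \<beta> k x C "4 * 2 ^ j"]
      by (intro finite_measure_mono) (auto elim!: cheap_path_subset)
    finally have 1: "1 - exp (- v0 * (p * ?\<kappa>)) \<le> \<epsilon> / 3 + prob {w \<in> space M. \<exists>N. cheap_path \<beta> k x C (4 * 2 ^ j) N (I w)}"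
      by simp
    have x_sets: "{w \<in> space M. x \<in> I w} \<in> events" using I by (simp add: interlacement_set_def)
    have "prob {w \<in> space M. {x} \<subseteq> - I w} = exp (- u * ?\<kappa>)"
      using I by (simp add: interlacement_set_def del: insert_subset)
    also have "{w \<in> space M. {x} \<subseteq> - I w} = space M - {w \<in> space M. x \<in> I w}" by auto
    finally have 2: "prob {w \<in> space M. x \<in> I w} = 1 - exp (- u * ?\<kappa>)"
      using prob_compl[OF x_sets] by simp
    have "{w \<in> space M. x \<in> I w \<and> \<not> (\<exists>N. cheap_path \<beta> k x C (4 * 2 ^ j) N (I w))} =
        {w \<in> space M. x \<in> I w} - {w \<in> space M. \<exists>N. cheap_path \<beta> k x C (4 * 2 ^ j) N (I w)}" by auto
    moreover have sub: "{w \<in> space M. \<exists>N. cheap_path \<beta> k x C (4 * 2 ^ j) N (I w)} \<subseteq> {w \<in> space M. x \<in> I w}"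
      by (auto simp: cheap_path_def)
    ultimately have "prob {w \<in> space M. x \<in> I w \<and> \<not> (\<exists>N. cheap_path \<beta> k x C (4 * 2 ^ j) N (I w))} =
        1 - exp (- u * ?\<kappa>) - prob {w \<in> space M. \<exists>N. cheap_path \<beta> k x C (4 * 2 ^ j) N (I w)}"
      using finite_measure_Diff[OF x_sets sets_cheap_path[OF I] sub] 2 by simp
    also have "\<dots> \<le> \<epsilon> / 3 + (exp (- (v0 * p * ?\<kappa>)) - exp (- (u * ?\<kappa>)))" using 1 by (simp add: mult.assoc)
    also have "exp (- (v0 * p * ?\<kappa>)) - exp (- (u * ?\<kappa>)) \<le> u * ?\<kappa> - v0 * p * ?\<kappa>"
    proof (rule exp_diff_le)
      show "0 \<le> v0 * p * ?\<kappa>" by (intro mult_nonneg_nonneg v0_ge p capacity_nonneg)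
      have "v0 * p \<le> u * 1" using v0_le v0_ge p u by (intro mult_mono) auto
      then show "v0 * p * ?\<kappa> \<le> u * ?\<kappa>" using capacity_nonneg[of "{x}"] by (intro mult_right_mono) auto
    qed
    \<comment> \<open>u - v0 p = (u - v0) + v0 (1 - p) is at most
      \<open>\<delta> + u * \<eta>\<close>, and the capacity of a point is at most 1.\<close>
    also have "u * ?\<kappa> - v0 * p * ?\<kappa> \<le> 2 * (\<epsilon> / 3)"
    proof -
      have "v0 * p \<le> u * 1" using v0_le v0_ge p u by (intro mult_mono) auto
      then have "(u - v0 * p) * ?\<kappa> \<le> (u - v0 * p) * 1"
        by (intro mult_left_mono capacity_singleton_le) auto
      moreover have "u - v0 \<le> \<delta>" using v0 by simp
      moreover have "v0 * (1 - p) \<le> u * \<eta>" using v0_le v0_ge p u by (intro mult_mono) auto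
      ultimately show ?thesis using \<delta>(3) \<eta>(2) by (simp add: algebra_simps)
    qed
    finally show ?thesis by simp
  qed
  show ?thesis
  proof (rule that)
    fix L :: int
    define j where "j = max j0 (nat L)"
    have "L \<le> int (nat L)" by simp
    also have "\<dots> \<le> int (2 ^ j)" unfolding of_nat_le_iff
      by (rule order_trans[OF _ less_imp_le[OF less_exp]]) (simp add: j_def)
    finally have "L \<le> 2 ^ j" by simp
    moreover have "(0 :: int) \<le> 2 ^ j" by simp
    ultimately have L: "L \<le> 4 * 2 ^ j" by linarith
    have sets: "{w \<in> space M. x \<in> I w \<and> \<not> (\<exists>N. cheap_path \<beta> k x C L N (I w))} \<in> events" for L
    proof -
      have "{w \<in> space M. x \<in> I w \<and> \<not> (\<exists>N. cheap_path \<beta> k x C L N (I w))} =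
          {w \<in> space M. x \<in> I w} - {w \<in> space M. \<exists>N. cheap_path \<beta> k x C L N (I w)}" by auto
      then show ?thesis using sets_cheap_path[OF I] I by (simp add: interlacement_set_def sets.Diff)
    qed
    have "measure M {w \<in> space M. x \<in> I w \<and> \<not> (\<exists>N. cheap_path \<beta> k x C L N (I w))} \<le>
        measure M {w \<in> space M. x \<in> I w \<and> \<not> (\<exists>N. cheap_path \<beta> k x C (4 * 2 ^ j) N (I w))}"
      using L by (intro finite_measure_mono sets) (auto dest: cheap_path_mono[OF _ order_refl])
    also have "\<dots> \<le> \<epsilon>" by (rule main) (simp add: j_def)
    finally show "measure M {w \<in> space M. x \<in> I w \<and> \<not> (\<exists>N. cheap_path \<beta> k x C L N (I w))} \<le> \<epsilon>" .
  qed
qed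

lemma AE_cheap_path:
  fixes I :: "'w \<Rightarrow> (int ^ 'd) set"
  assumes d: "CARD('d) \<ge> 3" and u: "u > 0" and \<beta>: "\<beta> > 1" and I: "interlacement_set M I u"
  shows "AE w in M. x \<in> I w \<longrightarrow> (\<exists>C. \<forall>L. \<exists>N. cheap_path \<beta> k x C L N (I w))"
proof -
  interpret prob_space M using I by (simp add: interlacement_set_def)
  define B where "B C L = {w \<in> space M. x \<in> I w \<and> \<not> (\<exists>N. cheap_path \<beta> k x C L N (I w))}" for C L
  have B_sets: "B C L \<in> events" for C L
  proof -
    have "B C L = {w \<in> space M. x \<in> I w} - {w \<in> space M. \<exists>N. cheap_path \<beta> k x C L N (I w)}"
      by (auto simp: B_def)
    then show ?thesis using sets_cheap_path[OF I] I by (simp add: interlacement_set_def sets.Diff)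
  qed
  \<comment> \<open>The bad event: every cost bound n fails for some level m. The sets
    \<open>B C L\<close> decrease in \<open>C\<close> and increase in \<open>L\<close>, so a bound
    uniform in \<open>L\<close> passes to the union over levels by continuity from below.\<close>
  define D where "D = (\<Inter>n :: nat. \<Union>m :: nat. B (real n) (int m))"
  have D_sets: "D \<in> events" unfolding D_def using B_sets by (intro sets.countable_INT sets.countable_UN) auto
  have "prob D \<le> \<epsilon>" if \<epsilon>: "\<epsilon> > 0" for \<epsilon>
  proof -
    obtain C where C: "\<And>L. measure M (B C L) \<le> \<epsilon>"
      using not_prog_le[OF d u \<beta> I \<epsilon>, where x = x and k = k] unfolding B_def by blast
    obtain n :: nat where n: "C \<le> real n" using real_arch_simple by blast
    have "B (real n) L \<subseteq> B C L" for L
      unfolding B_def using n by (auto dest: cheap_path_mono[OF _ n order_refl])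
    then have le: "prob (B (real n) (int m)) \<le> \<epsilon>" for m
      using C[of "int m"] B_sets by (meson finite_measure_mono order_trans)
    have "(\<lambda>m. prob (B (real n) (int m))) \<longlonglongrightarrow> prob (\<Union>m. B (real n) (int m))"
    proof (rule finite_Lim_measure_incseq)
      show "incseq (\<lambda>m. B (real n) (int m))"
      proof (rule incseq_SucI)
        fix m
        have "cheap_path \<beta> k x (real n) (int m) N s" if "cheap_path \<beta> k x (real n) (int (Suc m)) N s" for N s
          using that by (rule cheap_path_mono) auto
        then show "B (real n) (int m) \<subseteq> B (real n) (int (Suc m))" unfolding B_def by blast
      qed
    qed (use B_sets in auto)
    then have "prob (\<Union>m. B (real n) (int m)) \<le> \<epsilon>" using le by (intro LIMSEQ_le_const2) auto
    moreover have "prob D \<le> prob (\<Union>m. B (real n) (int m))"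
      unfolding D_def using B_sets by (intro finite_measure_mono sets.countable_UN) auto
    ultimately show ?thesis by simp
  qed
  then have "prob D \<le> 0" by (rule field_le_epsilon[of _ 0, simplified])
  then have "AE w in M. w \<notin> D" using D_sets
    by (intro AE_I[of _ _ D]) (auto simp: emeasure_eq_measure measure_le_0_iff)
  then show ?thesis
  proof (rule AE_mp[OF _ AE_I2[OF impI]], intro impI)
    fix w assume w: "w \<in> space M" "w \<notin> D" "x \<in> I w"
    then obtain n :: nat where n: "\<And>m :: nat. w \<notin> B (real n) (int m)" by (auto simp: D_def)
    have "\<exists>N. cheap_path \<beta> k x (real n) L N (I w)" for L
    proof -
      obtain N where "cheap_path \<beta> k x (real n) (int (nat L)) N (I w)"
        using n[of "nat L"] w by (auto simp: B_def)
      then show ?thesis by (intro exI[of _ N]) (auto elim: cheap_path_mono)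
    qed
    then show "\<exists>C. \<forall>L. \<exists>N. cheap_path \<beta> k x C L N (I w)" by blast
  qed
qed

section \<open>Transience of the biased walk\<close>

text \<open>Loop erasure. It makes the edges of the path distinct, so that the energy along the path
  is at most the total energy.\<close>

lemma path_distinct:
  assumes "xs \<noteq> []" "successively adj xs" "\<beta> > 0"
  shows "\<exists>ys. ys \<noteq> [] \<and> distinct ys \<and> hd ys = hd xs \<and> last ys = last xs \<and> set ys \<subseteq> set xs \<and>
    successively adj ys \<and> cost \<beta> k ys \<le> cost \<beta> k xs"
  using assms(1,2)
proof (induction "length xs" arbitrary: xs rule: less_induct)
  case less
  show ?case
  proof (cases "distinct xs")
    case False
    then obtain as bs cs y where xs: "xs = as @ [y] @ bs @ [y] @ cs" using not_distinct_decomp by blast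
    let ?xs = "as @ [y] @ cs"
    have "successively adj ?xs"
      using less.prems(2) unfolding xs by (auto simp: successively_append_iff successively_Cons)
    with less.hyps[of ?xs] obtain ys where ys: "ys \<noteq> []" "distinct ys" "hd ys = hd ?xs" "last ys = last ?xs"
      "set ys \<subseteq> set ?xs" "successively adj ys" "cost \<beta> k ys \<le> cost \<beta> k ?xs" by (auto simp: xs)
    have "cost \<beta> k ?xs \<le> cost \<beta> k xs"
      unfolding xs cost_append using cost_nonneg[OF assms(3), of k "[y]"] cost_nonneg[OF assms(3), of k bs] by simp
    moreover have "hd ?xs = hd xs" "last ?xs = last xs" unfolding xs by (cases as; cases cs; simp)+
    moreover have "set ?xs \<subseteq> set xs" unfolding xs by auto
    ultimately show ?thesis using ys by (intro exI[of _ ys]) auto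
  qed (use less.prems in auto)
qed

section \<open>Transition probabilities, truncated Green function and Dirichlet energy\<close>

definition tprob :: "('a \<Rightarrow> 'a pmf) \<Rightarrow> nat \<Rightarrow> 'a \<Rightarrow> 'a \<Rightarrow> real" where
  "tprob K n x z = measure (markov_law K x) {X. X n = z}"

lemma tprob_0:
  fixes K :: "'a :: countable \<Rightarrow> 'a pmf"
  shows "tprob K 0 x z = indicator {z} x"
proof (cases "x = z")
  case True
  then show ?thesis using measure_markov_law_start[of K x] by (simp add: tprob_def)
next
  case False
  then have "measure (markov_law K x) {X. X 0 = z} = measure (markov_law K x) {}"
    by (intro measure_markov_law_cong sets_coord) auto
  then show ?thesis using False by (simp add: tprob_def)
qed

lemma tprob_Suc:
  fixes K :: "'a :: countable \<Rightarrow> 'a pmf"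
  assumes "finite S" "set_pmf (K x) \<subseteq> S"
  shows "tprob K (Suc n) x z = (\<Sum>y\<in>S. pmf (K x) y * tprob K n y z)"
  unfolding tprob_def
  by (subst measure_markov_law_step[where K = K and x = x and S = S])
     (use assms in \<open>auto intro: sets_coord[where Q = "\<lambda>y. y = z"]\<close>)

lemma tprob_nonneg: "0 \<le> tprob K n x z"
  by (simp add: tprob_def)

lemma conductance_nonneg: "\<beta> > 0 \<Longrightarrow> 0 \<le> conductance \<beta> k J x y"
  by (simp add: conductance_def)

lemma conductance_sym: "conductance \<beta> k J x y = conductance \<beta> k J y x"
  by (auto simp: conductance_def adj_sym[of x y] max.commute)

lemma total_conductance_nonneg: "\<beta> > 0 \<Longrightarrow> 0 \<le> total_conductance \<beta> k J x"
  unfolding total_conductance_def by (intro sum_nonneg conductance_nonneg)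

lemma not_adj_refl [simp]: "\<not> adj x x"
  by (simp add: adj_def lnorm_def zero_vec_def[symmetric])

lemma set_walk_kernel:
  assumes "\<beta> > 0"
  shows "set_pmf (walk_kernel \<beta> k J x) \<subseteq> insert x {y. adj x y}"
  by (auto simp: set_pmf_eq pmf_walk_kernel[OF assms] conductance_def split: if_splits)

text \<open>Multiplying by the total conductance removes the case distinction in
  \<open>walk_kernel\<close>: where the chain stays put by convention, both sides vanish.\<close>

lemma sum_conductance_kernel:
  assumes "\<beta> > 0"
  shows "total_conductance \<beta> k J x * (\<Sum>y\<in>insert x {y. adj x y}. pmf (walk_kernel \<beta> k J x) y * g y) =
    (\<Sum>y | adj x y. conductance \<beta> k J x y * g y)"
proof (cases "total_conductance \<beta> k J x = 0")
  case True
  then have "conductance \<beta> k J x y = 0" if "adj x y" for y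
    using that unfolding total_conductance_def
    by (subst (asm) sum_nonneg_eq_0_iff) (auto simp: finite_adj conductance_nonneg[OF assms])
  then show ?thesis using True by simp
next
  case False
  have "conductance \<beta> k J x x = 0" by (simp add: conductance_def)
  then show ?thesis using False
    by (simp add: pmf_walk_kernel[OF assms] finite_adj sum_distrib_left)
qed

context
  fixes \<beta> :: real and k :: "'d :: finite" and J :: "(int ^ 'd) set" and z :: "int ^ 'd" and n :: nat
  assumes \<beta>: "\<beta> > 0"
begin

abbreviation "con \<equiv> conductance \<beta> k J"
abbreviation "tot \<equiv> total_conductance \<beta> k J"
abbreviation "tp m x \<equiv> tprob (walk_kernel \<beta> k J) m x z"

text \<open>The expected number of visits to \<open>z\<close> before time \<open>n\<close>. The
  truncation gives it finite support, so the energy computation involves finite sums only.\<close>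

definition "kgreen x = (\<Sum>m<n. tp m x)"

lemma tp_Suc: "tp (Suc m) x = (\<Sum>y\<in>insert x {y. adj x y}. pmf (walk_kernel \<beta> k J x) y * tp m y)"
  by (intro tprob_Suc set_walk_kernel[OF \<beta>]) (simp add: finite_adj)

lemma kgreen_nonneg: "0 \<le> kgreen x"
  unfolding kgreen_def by (intro sum_nonneg tprob_nonneg)

lemma tp_support: "x \<notin> lattice_box z m \<Longrightarrow> tp m x = 0"
proof (induction m arbitrary: x)
  case 0
  then have "x \<noteq> z" by (auto simp: lattice_box_def)
  then show ?case by (simp add: tprob_0)
next
  case (Suc m)
  then obtain i where i: "\<bar>x $ i - z $ i\<bar> > int (Suc m)" by (auto simp: lattice_box_def not_le)
  have "y \<notin> lattice_box z m" if "y \<in> insert x {y. adj x y}" for y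
  proof -
    have "\<bar>y $ i - x $ i\<bar> \<le> 1" using that adj_component[of x y i] by auto
    then have "\<not> \<bar>y $ i - z $ i\<bar> \<le> int m" using i by linarith
    then show ?thesis by (auto simp: lattice_box_def)
  qed
  then show ?case unfolding tp_Suc using Suc.IH by (intro sum.neutral) auto
qed

lemma lattice_box_mono: "m \<le> m' \<Longrightarrow> lattice_box z m \<subseteq> lattice_box z m'"
proof
  fix y assume "m \<le> m'" "y \<in> lattice_box z m"
  then have "\<bar>y $ i - z $ i\<bar> \<le> int m'" for i by (auto simp: lattice_box_def intro: order_trans[of _ "int m"])
  then show "y \<in> lattice_box z m'" by (simp add: lattice_box_def)
qed

lemma kgreen_support: "x \<notin> lattice_box z n \<Longrightarrow> kgreen x = 0"
  unfolding kgreen_def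
proof (intro sum.neutral ballI tp_support)
  fix m assume "x \<notin> lattice_box z n" "m \<in> {..<n}"
  then show "x \<notin> lattice_box z m" using lattice_box_mono[of m n] by auto
qed

text \<open>Telescoping in time: the generator leaves the source at \<open>z\<close> and the term of
  time \<open>n\<close>.\<close>

lemma laplace_kgreen:
  "(\<Sum>y | adj x y. con x y * (kgreen x - kgreen y)) = tot x * (indicator {z} x - tp n x)"
proof -
  have "(\<Sum>y\<in>insert x {y. adj x y}. pmf (walk_kernel \<beta> k J x) y * kgreen y) = (\<Sum>m<n. tp (Suc m) x)"
    unfolding kgreen_def sum_distrib_left tp_Suc by (rule sum.swap)
  also have "\<dots> = kgreen x + (tp n x - tp 0 x)"
    using sum_lessThan_telescope[of "\<lambda>m. tp m x" n] by (simp add: kgreen_def sum_subtractf)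
  finally have *: "(\<Sum>y | adj x y. con x y * kgreen y) = tot x * (kgreen x + (tp n x - tp 0 x))"
    using sum_conductance_kernel[OF \<beta>, of k J x kgreen] by simp
  have "(\<Sum>y | adj x y. con x y * (kgreen x - kgreen y)) = tot x * kgreen x - (\<Sum>y | adj x y. con x y * kgreen y)"
    by (simp add: total_conductance_def right_diff_distrib sum_subtractf sum_distrib_right)
  then show ?thesis unfolding * by (simp add: tprob_0 algebra_simps)
qed

text \<open>Summation by parts. The term of time \<open>n\<close> has the favourable sign and is
  dropped; the factor 2 arises because every edge is counted in both directions. The radius
  \<open>Suc n\<close> puts all neighbours of the support into \<open>B\<close>.\<close>

lemma energy_kgreen:
  assumes B: "finite B" "lattice_box z (Suc n) \<subseteq> B"
  shows "(\<Sum>x\<in>B. \<Sum>y\<in>B. con x y * (kgreen x - kgreen y)\<^sup>2) \<le> 2 * (tot z * kgreen z)"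
proof -
  let ?g = kgreen
  have row: "?g x * (\<Sum>y\<in>B. con x y * (?g x - ?g y)) = ?g x * (tot x * (indicator {z} x - tp n x))" for x
  proof (cases "x \<in> lattice_box z n")
    case True
    have "{y. adj x y} \<subseteq> lattice_box z (Suc n)"
    proof
      fix y assume "y \<in> {y. adj x y}"
      then have adj: "adj x y" by simp
      have "\<bar>y $ i - z $ i\<bar> \<le> int (Suc n)" for i
      proof -
        have "\<bar>y $ i - x $ i\<bar> \<le> 1" by (rule adj_component[OF adj])
        moreover have "\<bar>x $ i - z $ i\<bar> \<le> int n" using True by (simp add: lattice_box_def)
        ultimately show ?thesis by linarith
      qed
      then show "y \<in> lattice_box z (Suc n)" by (simp add: lattice_box_def)
    qed
    then have "(\<Sum>y\<in>B. con x y * (?g x - ?g y)) = (\<Sum>y | adj x y. con x y * (?g x - ?g y))"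
      using B by (intro sum.mono_neutral_right) (auto simp: conductance_def)
    then show ?thesis by (simp add: laplace_kgreen)
  qed (simp add: kgreen_support)
  have "(\<Sum>x\<in>B. \<Sum>y\<in>B. con x y * (?g x - ?g y)\<^sup>2) =
      (\<Sum>x\<in>B. \<Sum>y\<in>B. con x y * (?g x * (?g x - ?g y))) + (\<Sum>x\<in>B. \<Sum>y\<in>B. con x y * (?g y * (?g y - ?g x)))"
    unfolding sum.distrib[symmetric] by (intro sum.cong refl) (simp add: power2_eq_square algebra_simps)
  also have "(\<Sum>x\<in>B. \<Sum>y\<in>B. con x y * (?g y * (?g y - ?g x))) = (\<Sum>x\<in>B. \<Sum>y\<in>B. con x y * (?g x * (?g x - ?g y)))"
    by (subst sum.swap, intro sum.cong refl arg_cong2[of _ _ _ _ "(*)"] conductance_sym)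
  also have "(\<Sum>x\<in>B. \<Sum>y\<in>B. con x y * (?g x * (?g x - ?g y))) =
      (\<Sum>x\<in>B. ?g x * (tot x * (indicator {z} x - tp n x)))"
    unfolding row[symmetric] sum_distrib_left by (simp add: mult_ac)
  also have "\<dots> \<le> (\<Sum>x\<in>B. if x = z then tot z * ?g z else 0)"
  proof (rule sum_mono)
    fix x
    have "?g x * (tot x * (indicator {z} x - tp n x)) \<le> ?g x * (tot x * indicator {z} x)"
      by (intro mult_left_mono total_conductance_nonneg \<beta> kgreen_nonneg) (simp add: tprob_nonneg)
    then show "?g x * (tot x * (indicator {z} x - tp n x)) \<le> (if x = z then tot z * ?g z else 0)"
      by (auto simp: mult.commute)
  qed
  also have "\<dots> = tot z * ?g z"
  proof -
    have "z \<in> B" using B by (auto simp: lattice_box_def)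
    then show ?thesis using B by simp
  qed
  finally show ?thesis by simp
qed

text \<open>Cauchy-Schwarz along the path, in the form \<open>2 D \<le> t c D\<^sup>2 + 1 / (t c)\<close> for a free parameter \<open>t\<close>.\<close>

lemma path_drop_le:
  assumes "xs \<noteq> []" "successively adj xs" "set xs \<subseteq> J" "t > 0" "\<beta> > 1"
  shows "2 * (g (hd xs) - g (last xs)) \<le>
    t * (\<Sum>(x, y)\<leftarrow>zip xs (tl xs). con x y * (g x - g y)\<^sup>2) + cost \<beta> k xs / t"
  using assms(1-3)
proof (induction xs rule: induct_list012)
  case (2 x)
  then show ?case using assms by (simp add: cost_def)
next
  case (3 x y zs)
  let ?c = "con x y" and ?D = "g x - g y"
  have c: "?c = \<beta> powi max (x $ k) (y $ k)" using 3 by (simp add: conductance_def)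
  then have cpos: "?c > 0" using \<beta> by simp
  have "0 \<le> (t * ?c * ?D - 1)\<^sup>2 / (t * ?c)" using assms(4) cpos by simp
  also have "\<dots> = t * (?c * ?D\<^sup>2) - 2 * ?D + 1 / (t * ?c)"
    using assms(4) cpos by (simp add: field_simps power2_eq_square)
  finally have "2 * ?D \<le> t * (?c * ?D\<^sup>2) + 1 / (t * ?c)" by simp
  also have "1 / (t * ?c) = (1 / ?c) / t" by simp
  also have "1 / ?c = \<beta> powi (- max (x $ k) (y $ k))" using \<beta> by (simp add: c power_int_minus_divide)
  also have "\<dots> / t \<le> \<beta> powi (- (x $ k)) / t"
    using assms(4,5) by (intro divide_right_mono power_int_increasing) auto
  finally have "2 * ?D \<le> t * (?c * ?D\<^sup>2) + \<beta> powi (- (x $ k)) / t" by simp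
  moreover have "2 * (g y - g (last (y # zs))) \<le>
    t * (\<Sum>(x, y)\<leftarrow>zip (y # zs) zs. con x y * (g x - g y)\<^sup>2) + cost \<beta> k (y # zs) / t"
    using 3 by simp
  ultimately show ?case by (simp add: cost_def algebra_simps add_divide_distrib)
qed simp

text \<open>The path ends outside the support of \<open>kgreen\<close>, so the drop along it is the
  whole value at its start.\<close>

lemma kgreen_le:
  assumes xs: "xs \<noteq> []" "successively adj xs" "set xs \<subseteq> J" "last xs \<notin> lattice_box z n" and t: "t > 0" and \<beta>1: "\<beta> > 1"
  shows "2 * kgreen (hd xs) \<le> t * (2 * (tot z * kgreen z)) + cost \<beta> k xs / t"
proof -
  obtain ys where ys: "ys \<noteq> []" "distinct ys" "hd ys = hd xs" "last ys = last xs" "set ys \<subseteq> set xs"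
    "successively adj ys" "cost \<beta> k ys \<le> cost \<beta> k xs"
    using path_distinct[OF xs(1,2) \<beta>] by blast
  let ?f = "\<lambda>(x, y). con x y * (kgreen x - kgreen y)\<^sup>2"
  define B where "B = lattice_box z (Suc n) \<union> set ys"
  have B: "finite B" by (simp add: B_def finite_lattice_box)
  have "(\<Sum>e\<leftarrow>zip ys (tl ys). ?f e) = (\<Sum>e\<in>set (zip ys (tl ys)). ?f e)"
    by (intro sum_list_distinct_conv_sum_set distinct_zipI1 ys)
  also have "\<dots> \<le> (\<Sum>e\<in>B \<times> B. ?f e)"
  proof (rule sum_mono2)
    have "set (tl ys) \<subseteq> set ys" by (cases ys) auto
    then show "set (zip ys (tl ys)) \<subseteq> B \<times> B"
      using set_zip_leftD set_zip_rightD unfolding B_def by fast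
  qed (use B in \<open>auto simp: conductance_nonneg[OF \<beta>]\<close>)
  also have "\<dots> = (\<Sum>x\<in>B. \<Sum>y\<in>B. con x y * (kgreen x - kgreen y)\<^sup>2)"
    by (simp add: sum.cartesian_product)
  also have "\<dots> \<le> 2 * (tot z * kgreen z)"
    by (rule energy_kgreen[OF B]) (simp add: B_def)
  finally have E: "(\<Sum>e\<leftarrow>zip ys (tl ys). ?f e) \<le> 2 * (tot z * kgreen z)" .
  have "2 * kgreen (hd xs) = 2 * (kgreen (hd ys) - kgreen (last ys))"
    using ys xs by (simp add: kgreen_support)
  also have "\<dots> \<le> t * (\<Sum>e\<leftarrow>zip ys (tl ys). ?f e) + cost \<beta> k ys / t"
    using ys xs t \<beta>1 by (intro path_drop_le) auto
  also have "\<dots> \<le> t * (2 * (tot z * kgreen z)) + cost \<beta> k xs / t"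
    using E ys t by (intro add_mono mult_left_mono divide_right_mono) auto
  finally show ?thesis .
qed

text \<open>The level to be reached grows with the truncation \<open>n\<close> while
  \<open>C\<close> does not, which makes the bound uniform in \<open>n\<close>.\<close>

lemma kgreen_le_cheap_path:
  assumes "\<And>L. \<exists>N. cheap_path \<beta> k x C L N J" and t: "t > 0" and \<beta>1: "\<beta> > 1"
  shows "2 * kgreen x \<le> t * (2 * (tot z * kgreen z)) + C / t"
proof -
  obtain N where "cheap_path \<beta> k x C (z $ k + int n + 1) N J" using assms(1) by blast
  then obtain xs where xs: "xs \<noteq> []" "hd xs = x" "set xs \<subseteq> J" "successively adj xs"
    "cost \<beta> k xs \<le> C" "z $ k + int n + 1 \<le> last xs $ k" by (auto simp: cheap_path_def)
  have "\<not> \<bar>last xs $ k - z $ k\<bar> \<le> int n" using xs by linarith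
  then have "last xs \<notin> lattice_box z n" by (auto simp: lattice_box_def)
  then have "2 * kgreen x \<le> t * (2 * (tot z * kgreen z)) + cost \<beta> k xs / t"
    using kgreen_le[OF xs(1,4,3) _ t \<beta>1] xs(2) by simp
  also have "\<dots> \<le> t * (2 * (tot z * kgreen z)) + C / t"
    using xs t by (intro add_left_mono divide_right_mono) auto
  finally show ?thesis .
qed

end

text \<open>Uniform bounds on partial sums. For the start \<open>z\<close> the inequality contains
  its own left-hand side and is closed by a small \<open>t\<close>; the value at \<open>z\<close>
  then controls the start \<open>x\<close> with \<open>t = 1\<close>.\<close>

lemma summable_tprob:
  assumes \<beta>: "\<beta> > 1" and x: "x \<in> J"
    and cheap_path: "\<And>y. y \<in> J \<Longrightarrow> \<exists>C. \<forall>L. \<exists>N. cheap_path \<beta> k y C L N J"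
  shows "summable (\<lambda>n. tprob (walk_kernel \<beta> k J) n x z)"
proof -
  let ?g = "\<lambda>n. kgreen \<beta> k J z n" and ?\<pi> = "total_conductance \<beta> k J z"
  have \<beta>0: "\<beta> > 0" using \<beta> by simp
  have \<pi>: "?\<pi> \<ge> 0" by (rule total_conductance_nonneg[OF \<beta>0])
  obtain C where C: "\<And>L. \<exists>N. cheap_path \<beta> k x C L N J" using cheap_path[OF x] by blast
  obtain G where G: "\<And>n. ?\<pi> * ?g n z \<le> G"
  proof (cases "z \<in> J")
    case True
    obtain C' where C': "\<And>L. \<exists>N. cheap_path \<beta> k z C' L N J" using cheap_path[OF True] by blast
    have "?g n z \<le> C' * (2 * ?\<pi> + 1)" for n
    proof -
      \<comment> \<open>With this choice the first term on the right is at most one copy of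
        \<open>?g n z\<close>, absorbed by the two copies on the left.\<close>
      define t where "t = 1 / (2 * ?\<pi> + 1)"
      have t: "t > 0" using \<pi> by (simp add: t_def)
      have "2 * ?g n z \<le> t * (2 * (?\<pi> * ?g n z)) + C' / t"
        by (rule kgreen_le_cheap_path[OF \<beta>0 C' t \<beta>])
      also have "t * (2 * (?\<pi> * ?g n z)) = (2 * ?\<pi> / (2 * ?\<pi> + 1)) * ?g n z" by (simp add: t_def)
      also have "\<dots> \<le> 1 * ?g n z"
        using \<pi> by (intro mult_right_mono kgreen_nonneg[OF \<beta>0]) simp
      also have "C' / t = C' * (2 * ?\<pi> + 1)" by (simp add: t_def)
      finally show ?thesis by simp
    qed
    then have "?\<pi> * ?g n z \<le> ?\<pi> * (C' * (2 * ?\<pi> + 1))" for n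
      using \<pi> by (intro mult_left_mono)
    then show ?thesis by (rule that)
  next
    case False
    \<comment> \<open>Off \<open>J\<close> the total conductance is 0, so the value at
      \<open>z\<close> drops out of the estimate.\<close>
    then have "?\<pi> = 0" by (simp add: total_conductance_def conductance_def)
    then show ?thesis using that[of 0] by simp
  qed
  show ?thesis
  proof (rule summableI_nonneg_bounded[OF tprob_nonneg])
    fix n
    have "2 * ?g n x \<le> 1 * (2 * (?\<pi> * ?g n z)) + C / 1"
      by (rule kgreen_le_cheap_path[OF \<beta>0 C _ \<beta>]) simp
    also have "\<dots> \<le> 2 * G + C" using G[of n] by simp
    finally show "(\<Sum>m<n. tprob (walk_kernel \<beta> k J) m x z) \<le> G + C / 2"
      by (simp add: kgreen_def[OF \<beta>0])
  qed
qed

text \<open>A path that leaves every site for good leaves every box for good, since boxes are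
  finite.\<close>

lemma lnorm_at_top:
  fixes X :: "nat \<Rightarrow> int ^ 'd"
  assumes "\<And>z. \<forall>\<^sub>F n in sequentially. X n \<noteq> z"
  shows "filterlim (\<lambda>n. lnorm (X n)) at_top sequentially"
  unfolding filterlim_at_top
proof
  fix r :: real
  have "\<forall>\<^sub>F n in sequentially. \<forall>z\<in>lattice_box 0 (nat \<lceil>r\<rceil>). X n \<noteq> z"
    using assms by (intro eventually_ball_finite finite_lattice_box) auto
  then show "\<forall>\<^sub>F n in sequentially. r \<le> lnorm (X n)"
  proof eventually_elim
    case (elim n)
    then have "X n \<notin> lattice_box 0 (nat \<lceil>r\<rceil>)" by blast
    then obtain i where "int (nat \<lceil>r\<rceil>) < \<bar>X n $ i\<bar>" by (auto simp: lattice_box_def not_le)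
    then have "r \<le> \<bar>real_of_int (X n $ i)\<bar>" by linarith
    also have "\<dots> \<le> lnorm (X n)"
      using component_le_norm_cart[of "(\<chi> j. real_of_int (X n $ j)) :: real ^ 'd" i] by (simp add: lnorm_def)
    finally show ?case .
  qed
qed

lemma quenched_transient:
  fixes J :: "(int ^ 'd) set"
  assumes \<beta>: "\<beta> > 1" and x: "x \<in> J"
    and cheap_path: "\<And>y. y \<in> J \<Longrightarrow> \<exists>C. \<forall>L. \<exists>N. cheap_path \<beta> k y C L N J"
  shows "AE X in quenched_law \<beta> k J x. \<forall>z. \<forall>\<^sub>F n in sequentially. X n \<noteq> z"
proof -
  interpret prob_space "quenched_law \<beta> k J x"
    unfolding quenched_law_def by (rule prob_space_markov_law)
  have "AE X in quenched_law \<beta> k J x. \<forall>\<^sub>F n in sequentially. X n \<noteq> z" for z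
  proof -
    have sets: "{X. X n = z} \<in> events" for n
      using sets_coord[of "\<lambda>y. y = z" n] by (simp add: quenched_law_def sets_markov_law)
    have "AE X in quenched_law \<beta> k J x. \<forall>\<^sub>F n in sequentially.
        X \<in> space (quenched_law \<beta> k J x) - {X. X n = z}"
    proof (rule borel_cantelli_AE1[OF sets])
      show "summable (\<lambda>n. prob {X. X n = z})"
        using summable_tprob[OF \<beta> x cheap_path, of z] by (simp add: tprob_def quenched_law_def)
    qed (simp add: emeasure_eq_measure)
    then show ?thesis by (rule AE_mp) (auto intro!: AE_I2 elim: eventually_mono)
  qed
  then show ?thesis by (subst AE_all_countable) blast
qed

theorem theorem1p1:
  fixes M :: "'w measure" and I :: "'w \<Rightarrow> (int ^ 'd) set"
    and u \<beta> :: real and k :: 'd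
  assumes "CARD('d) \<ge> 3" and "u > 0" and "\<beta> > 1"
    and "interlacement_set M I u"
  shows "AE X in averaged_law M I \<beta> k.
    filterlim (\<lambda>n. lnorm (X n)) at_top sequentially"
proof -
  note d = assms(1) and u = assms(2) and \<beta> = assms(3) and inter = assms(4)
  have \<beta>0: "\<beta> > 0" using \<beta> by simp
  interpret prob_space M using inter by (simp add: interlacement_set_def)
  have I: "{w \<in> space M. x \<in> I w} \<in> sets M" for x using inter by (simp add: interlacement_set_def)
  \<comment> \<open>Leaving every site for good is visibly a countable combination of coordinate
    events and implies divergence, so the complement of \<open>G\<close> serves as the measurable
    null set.\<close>
  define G where "G = {X :: nat \<Rightarrow> int ^ 'd. \<forall>z. \<forall>\<^sub>F n in sequentially. X n \<noteq> z}"
  have "G = (\<Inter>z. \<Union>N. \<Inter>n\<in>{N..}. {X. X n \<noteq> z})"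
  proof (rule set_eqI)
    fix X :: "nat \<Rightarrow> int ^ 'd"
    show "X \<in> G \<longleftrightarrow> X \<in> (\<Inter>z. \<Union>N. \<Inter>n\<in>{N..}. {X. X n \<noteq> z})"
      unfolding G_def eventually_sequentially mem_Collect_eq INT_iff UN_iff atLeast_iff by blast
  qed
  also have "\<dots> \<in> sets paths"
  proof (rule sets.countable_INT')
    have "(\<Inter>n\<in>{N..}. {X :: nat \<Rightarrow> int ^ 'd. X n \<noteq> z}) \<in> sets paths" for N z
      by (rule sets.countable_INT') (auto intro: sets_coord[of "\<lambda>y. y \<noteq> z"])
    then show "range (\<lambda>z. \<Union>N. \<Inter>n\<in>{N..}. {X :: nat \<Rightarrow> int ^ 'd. X n \<noteq> z}) \<subseteq> sets paths"
      by auto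
  qed auto
  finally have G: "G \<in> sets paths" .
  then have G': "UNIV - G \<in> sets paths"
    using sets.compl_sets[of G paths] by (simp add: space_PiM)
  have "AE w in M. 0 \<in> I w \<longrightarrow> emeasure (quenched_law \<beta> k (I w) 0) (UNIV - G) = 0"
  proof -
    have "AE w in M. \<forall>x. x \<in> I w \<longrightarrow> (\<exists>C. \<forall>L. \<exists>N. cheap_path \<beta> k x C L N (I w))"
      using AE_cheap_path[OF d u \<beta> inter] by (subst AE_all_countable) blast
    then show ?thesis
    proof eventually_elim
      case (elim w)
      show ?case
      proof
        assume "0 \<in> I w"
        then have "AE X in quenched_law \<beta> k (I w) 0. X \<in> G"
          using quenched_transient[OF \<beta>, of 0 "I w" k] elim by (simp add: G_def)
        then show "emeasure (quenched_law \<beta> k (I w) 0) (UNIV - G) = 0"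
          by (subst (asm) AE_iff_measurable[of "UNIV - G"])
             (use G' in \<open>auto simp: quenched_law_def sets_markov_law\<close>)
      qed
    qed
  qed
  then have "AE w in conditioned M I. emeasure (quenched_law \<beta> k (I w) 0) (UNIV - G) = 0"
    unfolding conditioned_def by (intro AE_uniform_measureI I) auto
  then have null: "emeasure (averaged_law M I \<beta> k) (UNIV - G) = 0"
    unfolding emeasure_averaged_law[OF I not_empty \<beta>0 G']
    by (subst nn_integral_cong_AE[of _ "\<lambda>_. 0"]) auto
  have sets: "sets (averaged_law M I \<beta> k) = sets paths"
    unfolding averaged_law_def
    by (rule sets_bind) (auto simp: quenched_law_def sets_markov_law conditioned_def not_empty)
  show ?thesis
  proof (rule AE_I[OF _ null])
    show "UNIV - G \<in> sets (averaged_law M I \<beta> k)" using G' by (simp add: sets)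
    show "{X \<in> space (averaged_law M I \<beta> k). \<not> filterlim (\<lambda>n. lnorm (X n)) at_top sequentially} \<subseteq> UNIV - G"
      by (auto simp: G_def lnorm_at_top)
  qed
qed

end
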